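(* Let $T$ be a linear and continuous operator from $\mathcal S_{1/2}(\mathbf R^{d_1})$ to $\mathcal S_{1/2}'(\mathbf R^{d_2})$ with distribution kernel $K$, and let $d_0\ge \min(d_1,d_2)$. Then the following is true: (1) If $K\in \mathscr S(\mathbf R^{d_2+d_1})$ (the Schwartz space), then there are operators $T_1$ and $T_2$ with kernels $K_1\in \mathscr S(\mathbf R^{d_0+d_1})$ and $K_2\in \mathscr S(\mathbf R^{d_2+d_0})$, respectively, such that $T=T_2\circ T_1$. Furthermore, at least one of $T_1$ and $T_2$ can be chosen as a positive Hermite diagonal operator. (2) If $s\ge 1/2$ and $K\in \mathcal S_s(\mathbf R^{d_2+d_1})$, then there are operators $T_1$ and $T_2$ with kernels $K_1\in \mathcal S_s(\mathbf R^{d_0+d_1})$ and $K_2\in \mathcal S_s(\mathbf R^{d_2+d_0})$, respectively, such that $T=T_2\circ T_1$. Furthermore, at least one of $T_1$ and $T_2$ can be chosen as a positive Hermite diagonal operator. (3) If $s>1/2$ and $K\in \Sigma_s(\mathbf R^{d_2+d_1})$, then there are operators $T_1$ and $T_2$ with kernels $K_1\in \Sigma_s(\mathbf R^{d_0+d_1})$ and $K_2\in \Sigma_s(\mathbf R^{d_2+d_0})$, respectively, such that $T=T_2\circ T_1$. Furthermore, at least one of $T_1$ and $T_2$ can be chosen as a positive Hermite diagonal operator.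
   Context: **Gelfand-Shilov spaces.** For $h,s>0$, $\mathcal S_{s,h}(\mathbf R^d)$ is the Banach space of all $f\in C^\infty(\mathbf R^d)$ such that $$\|f\|_{\mathcal S_{s,h}}=\sup_{\alpha,\beta\in\mathbf N^d,\ x\in\mathbf R^d}\frac{|x^\beta\partial^\alpha f(x)|}{h^{|\alpha|+|\beta|}(\alpha!\,\beta!)^s}<\infty .$$ Set $\mathcal S_s(\mathbf R^d)=\bigcup_{h>0}\mathcal S_{s,h}(\mathbf R^d)$ with the inductive limit topology and $\Sigma_s(\mathbf R^d)=\bigcap_{h>0}\mathcal S_{s,h}(\mathbf R^d)$ with the projective limit (Fréchet) topology. $\mathcal S_s'(\mathbf R^d)$ is the (topological) dual of $\mathcal S_s(\mathbf R^d)$. **Kernels.** $(\cdot,\cdot)_{L^2}$ denotes the $L^2$ scalar product (conjugate-linear in the second argument) and its continuous extensions from $\mathcal S_{1/2}$. Every linear continuous $T:\mathcal S_{1/2}(\mathbf R^{d_1})\to\mathcal S_{1/2}'(\mathbf R^{d_2})$ has a unique distribution kernel $K\in\mathcal S_{1/2}'(\mathbf R^{d_2+d_1})$, determined by $(Tf,g)_{L^2(\mathbf R^{d_2})}=(K,g\otimes\overline f)_{L^2(\mathbf R^{d_2+d_1})}$ for $f\in\mathcal S_{1/2}(\mathbf R^{d_1})$, $g\in\mathcal S_{1/2}(\mathbf R^{d_2})$; when $K$ is a Schwartz function this is $Tf(x)=\int K(x,y)f(y)\,dy$. The composition $T_2\circ T_1$ of operators with kernels $K_1(z,y)$ and $K_2(x,z)$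 in $\mathscr S$ is the operator with kernel $\int_{\mathbf R^{d_0}}K_2(x,z)K_1(z,y)\,dz$. **Hermite functions.** For $\alpha\in\mathbf N^d$, $$h_\alpha(x)=\pi^{-d/4}(-1)^{|\alpha|}(2^{|\alpha|}\alpha!)^{-1/2}e^{|x|^2/2}\,(\partial^\alpha e^{-|x|^2}),\qquad x\in\mathbf R^d.$$ **Hermite diagonal operators.** An operator $T_0:\mathcal S_{1/2}(\mathbf R^d)\to\mathcal S_{1/2}'(\mathbf R^d)$ is positive semi-definite if $(T_0f,f)_{L^2}\ge 0$ for all $f\in\mathcal S_{1/2}(\mathbf R^d)$. For $T_0:\mathcal S_{1/2}(\mathbf R^{m})\to\mathcal S_{1/2}'(\mathbf R^{m})$ linear and continuous and $g\in\mathcal S_{1/2}'(\mathbf R^{k})$, $T_0\otimes g$ is the operator $f\mapsto (T_0f)\otimes g$ from $\mathcal S_{1/2}(\mathbf R^{m})$ to $\mathcal S_{1/2}'(\mathbf R^{m+k})$. Let $n\ge m$. A linear operator $T:\mathcal S_{1/2}(\mathbf R^{m})\to\mathcal S_{1/2}'(\mathbf R^{n})$ is a Hermite diagonal operator if $T=T_0\otimes g$, where the Hermite functions (on $\mathbf R^m$) are eigenfunctions of $T_0$, and either $n=m$ and $g=1$ (so $T=T_0$), or $n>m$ and $g$ is a Hermite function (on $\mathbf R^{n-m}$). It is a positive Hermite diagonal operator if in addition $T_0$ is positive semi-definite.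
   Formalization: If d2 < d0 < d1, neither T1 nor T2 can be Hermite diagonal, since such operators never lower the dimension; in this case only, the "furthermore" is replaced by: T2 can be chosen so that its adjoint is a positive Hermite diagonal operator. *)

theory Defs
  imports "HOL-Analysis.Analysis"
begin

text \<open>
  The statement relates the spaces over R^m, R^k and R^(m+k) for variable m and k, so the
  dimension is a natural number and not a type. A point of R^d is given by the
  first d entries of a sequence \<open>nat \<Rightarrow> real\<close>; a function on R^d is a function on sequences that
  depends on these entries only (predicate \<open>cylinder\<close>), so equality of such functions is equality
  of functions on R^d, and continuity in the product topology of \<open>nat \<Rightarrow> real\<close> is continuity
  on R^d. Likewise only the first d entries of a multi-index \<open>nat \<Rightarrow> nat\<close> matter.
\<close>

type_synonym seq_fun = "(nat \<Rightarrow> real) \<Rightarrow> complex"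

type_synonym functional = "seq_fun \<Rightarrow> complex"

definition cylinder :: "nat \<Rightarrow> seq_fun \<Rightarrow> bool" where
  "cylinder d f \<longleftrightarrow> (\<forall>x y. (\<forall>i<d. x i = y i) \<longrightarrow> f x = f y)"

text \<open>The point (x,y) of R^(m+k), for x in R^m and y in R^k, and the second component y of a point
  of R^(m+k); the first component needs no projection.\<close>

definition append_pt :: "nat \<Rightarrow> (nat \<Rightarrow> real) \<Rightarrow> (nat \<Rightarrow> real) \<Rightarrow> nat \<Rightarrow> real" where
  "append_pt m x y = (\<lambda>i. if i < m then x i else y (i - m))"

definition drop_pt :: "nat \<Rightarrow> (nat \<Rightarrow> real) \<Rightarrow> nat \<Rightarrow> real" where
  "drop_pt m w = (\<lambda>i. w (i + m))"

definition tensor :: "nat \<Rightarrow> seq_fun \<Rightarrow> seq_fun \<Rightarrow> seq_fun" where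
  "tensor m f g = (\<lambda>w. f w * g (drop_pt m w))"

text \<open>Lebesgue measure on R^d. Its points are \<open>undefined\<close> outside \<open>{..<d}\<close>, which integrands
  satisfying \<open>cylinder d\<close> do not see.\<close>

abbreviation leb :: "nat \<Rightarrow> (nat \<Rightarrow> real) measure" where
  "leb d \<equiv> Pi\<^sub>M {..<d} (\<lambda>_. lborel)"


definition pdiff :: "nat \<Rightarrow> seq_fun \<Rightarrow> seq_fun" where
  "pdiff i f = (\<lambda>x. vector_derivative (\<lambda>t. f (x(i := t))) (at (x i)))"

definition smooth_fun :: "nat \<Rightarrow> seq_fun \<Rightarrow> bool" where
  "smooth_fun d f \<longleftrightarrow> cylinder d f \<and>
     (\<forall>js. set js \<subseteq> {..<d} \<longrightarrow>
        continuous_on UNIV (foldr pdiff js f) \<and>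
        (\<forall>i<d. \<forall>x. (\<lambda>t. foldr pdiff js f (x(i := t))) differentiable (at (x i))))"

definition mdiff :: "nat \<Rightarrow> (nat \<Rightarrow> nat) \<Rightarrow> seq_fun \<Rightarrow> seq_fun" where
  "mdiff d \<alpha> f = foldr (\<lambda>i. pdiff i ^^ \<alpha> i) [0..<d] f"

definition mlen :: "nat \<Rightarrow> (nat \<Rightarrow> nat) \<Rightarrow> nat" where
  "mlen d \<alpha> = (\<Sum>i<d. \<alpha> i)"

definition mfact :: "nat \<Rightarrow> (nat \<Rightarrow> nat) \<Rightarrow> real" where
  "mfact d \<alpha> = (\<Prod>i<d. fact (\<alpha> i))"

definition monomial :: "nat \<Rightarrow> (nat \<Rightarrow> nat) \<Rightarrow> (nat \<Rightarrow> real) \<Rightarrow> real" where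
  "monomial d \<beta> x = (\<Prod>i<d. x i ^ \<beta> i)"

definition schwartz :: "nat \<Rightarrow> seq_fun set" where
  "schwartz d = {f. smooth_fun d f \<and>
     (\<forall>\<alpha> \<beta>. bdd_above (range (\<lambda>x. \<bar>monomial d \<beta> x\<bar> * norm (mdiff d \<alpha> f x))))}"


definition gs_quot :: "real \<Rightarrow> real \<Rightarrow> nat \<Rightarrow> seq_fun \<Rightarrow> (nat \<Rightarrow> nat) \<times> (nat \<Rightarrow> nat) \<times> (nat \<Rightarrow> real) \<Rightarrow> real" where
  "gs_quot s h d f = (\<lambda>(\<alpha>, \<beta>, x).
     \<bar>monomial d \<beta> x\<bar> * norm (mdiff d \<alpha> f x) /
       (h ^ (mlen d \<alpha> + mlen d \<beta>) * (mfact d \<alpha> * mfact d \<beta>) powr s))"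

definition gs_step :: "real \<Rightarrow> real \<Rightarrow> nat \<Rightarrow> seq_fun set" where
  "gs_step s h d = {f. smooth_fun d f \<and> bdd_above (range (gs_quot s h d f))}"

definition gs_norm :: "real \<Rightarrow> real \<Rightarrow> nat \<Rightarrow> seq_fun \<Rightarrow> real" where
  "gs_norm s h d f = Sup (range (gs_quot s h d f))"

definition gs :: "real \<Rightarrow> nat \<Rightarrow> seq_fun set" where
  "gs s d = (\<Union>h\<in>{0<..}. gs_step s h d)"

definition gs_proj :: "real \<Rightarrow> nat \<Rightarrow> seq_fun set" where
  "gs_proj s d = (\<Inter>h\<in>{0<..}. gs_step s h d)"

text \<open>The (locally convex) inductive limit topology on \<open>gs s d\<close>: a base of neighbourhoods of 0 is
  formed by the absolutely convex sets whose trace on every step \<open>gs_step s h d\<close> is a neighbourhood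
  of 0 for the norm \<open>gs_norm s h d\<close>.\<close>

definition gs_nbhd :: "real \<Rightarrow> nat \<Rightarrow> seq_fun set \<Rightarrow> bool" where
  "gs_nbhd s d V \<longleftrightarrow> V \<subseteq> gs s d \<and>
     (\<forall>f\<in>V. \<forall>g\<in>V. \<forall>a b :: complex. norm a + norm b \<le> 1 \<longrightarrow> (\<lambda>x. a * f x + b * g x) \<in> V) \<and>
     (\<forall>h>0. \<exists>e>0. \<forall>f\<in>gs_step s h d. gs_norm s h d f < e \<longrightarrow> f \<in> V)"

definition gs_open :: "real \<Rightarrow> nat \<Rightarrow> seq_fun set \<Rightarrow> bool" where
  "gs_open s d U \<longleftrightarrow> U \<subseteq> gs s d \<and> (\<forall>f\<in>U. \<exists>V. gs_nbhd s d V \<and> (\<forall>g\<in>V. (\<lambda>x. f x + g x) \<in> U))"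

definition gs_topology :: "real \<Rightarrow> nat \<Rightarrow> seq_fun topology" where
  "gs_topology s d = topology (gs_open s d)"

lemma gs_nbhd_Int: "gs_nbhd s d V \<Longrightarrow> gs_nbhd s d W \<Longrightarrow> gs_nbhd s d (V \<inter> W)"
proof -
  assume V: "gs_nbhd s d V" and W: "gs_nbhd s d W"
  have "\<exists>e>0. \<forall>f\<in>gs_step s h d. gs_norm s h d f < e \<longrightarrow> f \<in> V \<inter> W" if h: "h > 0" for h
  proof -
    obtain e1 where e1: "e1 > 0" "\<forall>f\<in>gs_step s h d. gs_norm s h d f < e1 \<longrightarrow> f \<in> V"
      using V h unfolding gs_nbhd_def by blast
    obtain e2 where e2: "e2 > 0" "\<forall>f\<in>gs_step s h d. gs_norm s h d f < e2 \<longrightarrow> f \<in> W"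
      using W h unfolding gs_nbhd_def by blast
    show ?thesis using e1 e2 by (intro exI[of _ "min e1 e2"]) auto
  qed
  then show ?thesis using V W unfolding gs_nbhd_def by blast
qed

lemma istopology_gs_open: "istopology (gs_open s d)"
  unfolding istopology_def
proof (intro conjI allI impI)
  fix S T assume S: "gs_open s d S" and T: "gs_open s d T"
  show "gs_open s d (S \<inter> T)"
    unfolding gs_open_def
  proof (intro conjI ballI)
    show "S \<inter> T \<subseteq> gs s d" using S unfolding gs_open_def by blast
    fix f assume f: "f \<in> S \<inter> T"
    obtain V where V: "gs_nbhd s d V" "\<forall>g\<in>V. (\<lambda>x. f x + g x) \<in> S"
      using S f unfolding gs_open_def by blast
    obtain W where W: "gs_nbhd s d W" "\<forall>g\<in>W. (\<lambda>x. f x + g x) \<in> T"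
      using T f unfolding gs_open_def by blast
    show "\<exists>V. gs_nbhd s d V \<and> (\<forall>g\<in>V. (\<lambda>x. f x + g x) \<in> S \<inter> T)"
      using gs_nbhd_Int[OF V(1) W(1)] V(2) W(2) by blast
  qed
next
  fix \<K> assume K: "\<forall>K\<in>\<K>. gs_open s d K"
  show "gs_open s d (\<Union>\<K>)"
    unfolding gs_open_def
  proof (intro conjI ballI)
    show "\<Union>\<K> \<subseteq> gs s d" using K unfolding gs_open_def by blast
    fix f assume "f \<in> \<Union>\<K>"
    then obtain U where U: "U \<in> \<K>" "f \<in> U" by blast
    then obtain V where "gs_nbhd s d V" "\<forall>g\<in>V. (\<lambda>x. f x + g x) \<in> U"
      using K unfolding gs_open_def by blast
    then show "\<exists>V. gs_nbhd s d V \<and> (\<forall>g\<in>V. (\<lambda>x. f x + g x) \<in> \<Union>\<K>)" using U by blast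
  qed
qed

lemma openin_gs_topology: "openin (gs_topology s d) = gs_open s d"
  unfolding gs_topology_def by (rule topology_inverse'[OF istopology_gs_open])


text \<open>Functionals on \<open>gs s d\<close> are set to 0 off \<open>gs s d\<close>, so that they are equal iff they agree there.\<close>

definition gs_dual :: "real \<Rightarrow> nat \<Rightarrow> functional set" where
  "gs_dual s d = {u. continuous_map (gs_topology s d) euclidean u \<and>
     (\<forall>f\<in>gs s d. \<forall>g\<in>gs s d. \<forall>a b. u (\<lambda>x. a * f x + b * g x) = a * u f + b * u g) \<and>
     (\<forall>f. f \<notin> gs s d \<longrightarrow> u f = 0)}"

definition gs_bounded :: "real \<Rightarrow> nat \<Rightarrow> seq_fun set \<Rightarrow> bool" where
  "gs_bounded s d B \<longleftrightarrow> B \<subseteq> gs s d \<and>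
     (\<forall>V. openin (gs_topology s d) V \<and> (\<lambda>_. 0) \<in> V \<longrightarrow>
        (\<exists>r>0. \<forall>t>r. B \<subseteq> (\<lambda>f x. complex_of_real t * f x) ` V))"

text \<open>The strong dual topology: uniform convergence on bounded sets.\<close>

definition gs_dual_open :: "real \<Rightarrow> nat \<Rightarrow> functional set \<Rightarrow> bool" where
  "gs_dual_open s d U \<longleftrightarrow> U \<subseteq> gs_dual s d \<and>
     (\<forall>u\<in>U. \<exists>B e. gs_bounded s d B \<and> e > 0 \<and>
        (\<forall>v\<in>gs_dual s d. (\<forall>\<phi>\<in>B. norm (v \<phi> - u \<phi>) < e) \<longrightarrow> v \<in> U))"

definition gs_dual_topology :: "real \<Rightarrow> nat \<Rightarrow> functional topology" where
  "gs_dual_topology s d = topology (gs_dual_open s d)"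

lemma gs_bounded_Un: "gs_bounded s d A \<Longrightarrow> gs_bounded s d B \<Longrightarrow> gs_bounded s d (A \<union> B)"
proof -
  assume A: "gs_bounded s d A" and B: "gs_bounded s d B"
  have "\<exists>r>0. \<forall>t>r. A \<union> B \<subseteq> (\<lambda>f x. complex_of_real t * f x) ` V"
    if V: "openin (gs_topology s d) V \<and> (\<lambda>_. 0) \<in> V" for V
  proof -
    obtain p where p: "p > 0" "\<forall>t>p. A \<subseteq> (\<lambda>f x. complex_of_real t * f x) ` V"
      using A V unfolding gs_bounded_def by meson
    obtain q where q: "q > 0" "\<forall>t>q. B \<subseteq> (\<lambda>f x. complex_of_real t * f x) ` V"
      using B V unfolding gs_bounded_def by meson
    show ?thesis using p q by (intro exI[of _ "max p q"]) simp
  qed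
  then show ?thesis using A B unfolding gs_bounded_def by simp
qed

lemma istopology_gs_dual_open: "istopology (gs_dual_open s d)"
  unfolding istopology_def
proof (intro conjI allI impI)
  fix S T assume S: "gs_dual_open s d S" and T: "gs_dual_open s d T"
  show "gs_dual_open s d (S \<inter> T)"
    unfolding gs_dual_open_def
  proof (intro conjI ballI)
    show "S \<inter> T \<subseteq> gs_dual s d" using S unfolding gs_dual_open_def by blast
    fix u assume u: "u \<in> S \<inter> T"
    obtain A p where A: "gs_bounded s d A" "p > 0"
      "\<forall>v\<in>gs_dual s d. (\<forall>\<phi>\<in>A. norm (v \<phi> - u \<phi>) < p) \<longrightarrow> v \<in> S"
      using S u unfolding gs_dual_open_def by blast
    obtain B q where B: "gs_bounded s d B" "q > 0"
      "\<forall>v\<in>gs_dual s d. (\<forall>\<phi>\<in>B. norm (v \<phi> - u \<phi>) < q) \<longrightarrow> v \<in> T"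
      using T u unfolding gs_dual_open_def by blast
    show "\<exists>B e. gs_bounded s d B \<and> e > 0 \<and>
        (\<forall>v\<in>gs_dual s d. (\<forall>\<phi>\<in>B. norm (v \<phi> - u \<phi>) < e) \<longrightarrow> v \<in> S \<inter> T)"
      using gs_bounded_Un[OF A(1) B(1)] A(2,3) B(2,3)
      by (intro exI[of _ "A \<union> B"] exI[of _ "min p q"]) auto
  qed
next
  fix \<K> assume K: "\<forall>K\<in>\<K>. gs_dual_open s d K"
  show "gs_dual_open s d (\<Union>\<K>)"
    unfolding gs_dual_open_def
  proof (intro conjI ballI)
    show "\<Union>\<K> \<subseteq> gs_dual s d" using K unfolding gs_dual_open_def by blast
    fix u assume "u \<in> \<Union>\<K>"
    then obtain U where U: "U \<in> \<K>" "u \<in> U" by blast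
    then obtain B e where "gs_bounded s d B" "e > 0"
      "\<forall>v\<in>gs_dual s d. (\<forall>\<phi>\<in>B. norm (v \<phi> - u \<phi>) < e) \<longrightarrow> v \<in> U"
      using K unfolding gs_dual_open_def by blast
    then show "\<exists>B e. gs_bounded s d B \<and> e > 0 \<and>
        (\<forall>v\<in>gs_dual s d. (\<forall>\<phi>\<in>B. norm (v \<phi> - u \<phi>) < e) \<longrightarrow> v \<in> \<Union>\<K>)"
      using U by blast
  qed
qed

lemma openin_gs_dual_topology: "openin (gs_dual_topology s d) = gs_dual_open s d"
  unfolding gs_dual_topology_def by (rule topology_inverse'[OF istopology_gs_dual_open])

text \<open>Distributions are linear functionals, and a function f is identified with
  \<open>\<phi> \<mapsto> \<integral> f \<phi>\<close>; the extended scalar product \<open>(u, \<phi>)\<close>, conjugate-linear in \<open>\<phi>\<close>, is therefore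
  u evaluated at the complex conjugate of \<open>\<phi>\<close>.\<close>

definition dist_of :: "nat \<Rightarrow> seq_fun \<Rightarrow> functional" where
  "dist_of d f = (\<lambda>\<phi>. if \<phi> \<in> gs (1/2) d then (\<integral>x. f x * \<phi> x \<partial>leb d) else 0)"

definition scalar_prod :: "functional \<Rightarrow> seq_fun \<Rightarrow> complex" where
  "scalar_prod u \<phi> = u (\<lambda>x. cnj (\<phi> x))"

definition dist_tensor :: "nat \<Rightarrow> nat \<Rightarrow> functional \<Rightarrow> functional \<Rightarrow> functional" where
  "dist_tensor m k u v =
     (\<lambda>\<phi>. if \<phi> \<in> gs (1/2) (m + k) then u (\<lambda>x. v (\<lambda>y. \<phi> (append_pt m x y))) else 0)"


text \<open>The values of an operator off \<open>gs (1/2) m\<close> are irrelevant.\<close>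

definition cont_ops :: "nat \<Rightarrow> nat \<Rightarrow> (seq_fun \<Rightarrow> functional) set" where
  "cont_ops m n = {T. continuous_map (gs_topology (1/2) m) (gs_dual_topology (1/2) n) T \<and>
     (\<forall>f\<in>gs (1/2) m. \<forall>g\<in>gs (1/2) m. \<forall>a b.
        T (\<lambda>x. a * f x + b * g x) = (\<lambda>\<phi>. a * T f \<phi> + b * T g \<phi>))}"

definition has_kernel :: "nat \<Rightarrow> nat \<Rightarrow> (seq_fun \<Rightarrow> functional) \<Rightarrow> functional \<Rightarrow> bool" where
  "has_kernel m n T K \<longleftrightarrow> (\<forall>f\<in>gs (1/2) m. \<forall>g\<in>gs (1/2) n.
     scalar_prod (T f) g = scalar_prod K (tensor n g (\<lambda>y. cnj (f y))))"

definition kernel_comp :: "nat \<Rightarrow> nat \<Rightarrow> seq_fun \<Rightarrow> seq_fun \<Rightarrow> seq_fun" where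
  "kernel_comp n l K2 K1 =
     (\<lambda>w. \<integral>z. K2 (append_pt n w z) * K1 (append_pt l z (drop_pt n w)) \<partial>leb l)"

definition is_adjoint :: "nat \<Rightarrow> nat \<Rightarrow> (seq_fun \<Rightarrow> functional) \<Rightarrow> (seq_fun \<Rightarrow> functional) \<Rightarrow> bool" where
  "is_adjoint m n T S \<longleftrightarrow> (\<forall>f\<in>gs (1/2) m. \<forall>g\<in>gs (1/2) n.
     scalar_prod (S g) f = cnj (scalar_prod (T f) g))"


definition hermite :: "nat \<Rightarrow> (nat \<Rightarrow> nat) \<Rightarrow> seq_fun" where
  "hermite d \<alpha> = (\<lambda>x.
     complex_of_real (pi powr (- real d / 4) * (- 1) ^ mlen d \<alpha> *
        (2 ^ mlen d \<alpha> * mfact d \<alpha>) powr (- (1/2)) * exp ((\<Sum>i<d. (x i)\<^sup>2) / 2)) *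
     mdiff d \<alpha> (\<lambda>y. complex_of_real (exp (- (\<Sum>i<d. (y i)\<^sup>2)))) x)"

definition hermite_eigen :: "nat \<Rightarrow> (seq_fun \<Rightarrow> functional) \<Rightarrow> bool" where
  "hermite_eigen m T0 \<longleftrightarrow>
     (\<forall>\<alpha>. \<exists>c. T0 (hermite m \<alpha>) = (\<lambda>\<phi>. c * dist_of m (hermite m \<alpha>) \<phi>))"

definition pos_semidef :: "nat \<Rightarrow> (seq_fun \<Rightarrow> functional) \<Rightarrow> bool" where
  "pos_semidef m T0 \<longleftrightarrow> (\<forall>f\<in>gs (1/2) m. scalar_prod (T0 f) f \<in> \<real>\<^sub>\<ge>\<^sub>0)"

definition pos_hermite_diag :: "nat \<Rightarrow> nat \<Rightarrow> (seq_fun \<Rightarrow> functional) \<Rightarrow> bool" where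
  "pos_hermite_diag m n T \<longleftrightarrow> (\<exists>T0\<in>cont_ops m m. hermite_eigen m T0 \<and> pos_semidef m T0 \<and>
     (n = m \<and> (\<forall>f\<in>gs (1/2) m. T f = T0 f) \<or>
      n > m \<and> (\<exists>\<gamma>. \<forall>f\<in>gs (1/2) m.
         T f = dist_tensor m (n - m) (T0 f) (dist_of (n - m) (hermite (n - m) \<gamma>)))))"

text \<open>
  T is the composition of operators \<open>T1\<close> and \<open>T2\<close> through R^(d0) whose kernels belong to the
  spaces X, and one of them is a positive Hermite diagonal operator. The composition is, by
  definition, the operator with kernel \<open>kernel_comp\<close>.

  Hermite diagonal operators do not lower the dimension. If \<open>d2 < d0 < d1\<close>, both \<open>T1\<close> (from R^(d1)
  to R^(d0)) and \<open>T2\<close> (from R^(d0) to R^(d2)) do, so neither can be Hermite diagonal; in this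
  case only, the adjoint of \<open>T2\<close> is required to be a positive Hermite diagonal operator.
\<close>

definition factorizes_within ::
    "(nat \<Rightarrow> seq_fun set) \<Rightarrow> nat \<Rightarrow> nat \<Rightarrow> nat \<Rightarrow> (seq_fun \<Rightarrow> functional) \<Rightarrow> bool" where
  "factorizes_within X d0 d1 d2 T \<longleftrightarrow>
     (\<exists>T1\<in>cont_ops d1 d0. \<exists>T2\<in>cont_ops d0 d2. \<exists>K1\<in>X (d0 + d1). \<exists>K2\<in>X (d2 + d0).
        has_kernel d1 d0 T1 (dist_of (d0 + d1) K1) \<and>
        has_kernel d0 d2 T2 (dist_of (d2 + d0) K2) \<and>
        has_kernel d1 d2 T (dist_of (d2 + d1) (kernel_comp d2 d0 K2 K1)) \<and>
        (pos_hermite_diag d1 d0 T1 \<or> pos_hermite_diag d0 d2 T2 \<or>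
         d2 < d0 \<and> d0 < d1 \<and>
           (\<exists>S\<in>cont_ops d2 d0. is_adjoint d0 d2 T2 S \<and> pos_hermite_diag d2 d0 S)))"

end

theory Submission
  imports Defs "HOL-Probability.Levy"
begin

text \<open>
  Expand the kernel in Hermite functions, \<open>K = \<Sum> a(\<alpha>,\<beta>) h(\<alpha>) \<otimes> h(\<beta>)\<close>. Each of the three kernel
  spaces is characterised by a decay of the coefficients which is stable under square roots. Put
  \<open>\<lambda>(\<beta>) = sqrt (sup over \<alpha> of |a(\<alpha>,\<beta>)|)\<close>. Then \<open>\<lambda>\<close> has the required decay, and so has
  \<open>a(\<alpha>,\<beta>) / \<lambda>(\<beta>)\<close>, because its modulus is at most \<open>sqrt |a(\<alpha>,\<beta>)|\<close>. By orthonormality K is the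
  composition of \<open>K2 = \<Sum> (a(\<alpha>,\<beta>) / \<lambda>(\<beta>)) h(\<alpha>) \<otimes> h(\<beta>)\<close> with the positive Hermite diagonal kernel
  \<open>K1 = \<Sum> \<lambda>(\<beta>) h(\<beta>) \<otimes> h(\<beta>)\<close>. If \<open>d0 > d1\<close>, the index \<open>\<beta>\<close> is padded with zeros in R^d0, that is, the
  first factor of K1 is tensored with a Gaussian. If \<open>d2 \<le> d0 < d1\<close>, the supremum is taken over \<open>\<beta>\<close> and
  the diagonal factor stands on the left. This argument is in \<open>root_sup_majorant\<close>,
  \<open>factor_diag_right\<close> and \<open>factor_diag_left\<close>.

  The substance is the characterisation of the spaces. It is proved for all of them at once: a
  \<open>weight_class\<close> W is a set of sequences with some closure properties, \<open>weighted_space W d\<close> consists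
  of the functions for which \<open>x^\<beta> \<partial>^\<alpha> f\<close> is bounded by \<open>w (|\<alpha>| + |\<beta>|)\<close> for some w in W, and
  \<open>weighted_seqs W d\<close> of the sequences for which \<open>|a \<gamma>| (1 + |\<gamma>|)^(n/2)\<close> is bounded by \<open>w n\<close>.
  All sequences, the sequences dominated by \<open>C h^n n!^s\<close> for some h, and those dominated for every h
  (with C depending on h) give the Schwartz space, \<open>gs s\<close> and \<open>gs_proj s\<close>.

  \<^item> From functions to coefficients (\<open>weighted_space_coef\<close>): the harmonic oscillator \<open>x_i^2 - \<partial>_i^2\<close>
    multiplies the coefficient of index \<open>\<gamma>\<close> by \<open>2 \<gamma>_i + 1\<close>. Commuting its powers past \<open>x_i^p \<partial>_i^q\<close>
    gives a recursion, controlled by a weight v with \<open>(n + 2) v n \<le> v (n + 2)\<close>.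
  \<^item> From coefficients to functions (\<open>series_in_weighted_space\<close>): multiplication by \<open>x_i\<close> and
    differentiation act on coefficient sequences as ladder operators, so every word in these
    operators applied to a Hermite series is again a Hermite series, which can be estimated
    coefficientwise (\<open>word_series_bound\<close>).
  \<^item> That a function is the sum of its Hermite series (\<open>hermite_expansion\<close>) is the completeness of
    the Hermite functions. It is reduced to one variable by induction on the dimension
    (\<open>coef_complete\<close>), where it follows from the uniqueness theorem for characteristic functions
    (\<open>hfun_complete_real\<close>).

  After this, tensor products, partial pairings, conjugates, adjoints and compositions are
  computed on coefficients. An operator is given by its coefficient kernel (\<open>kernel_op\<close>), and its
  continuity follows from a bound by L1 norms, since L1 balls are neighbourhoods of zero in the
  inductive limit topology (\<open>cont_opsI\<close>).
\<close>

text \<open>Absolute summability is understood for unordered sums; the notation is shared with another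
  constant.\<close>

no_notation Infinite_Set_Sum.abs_summable_on (infix \<open>abs'_summable'_on\<close> 50)

section \<open>Hermite functions on the line\<close>

text \<open>The entry, at position \<open>(n - 1, n)\<close>, of the matrix of multiplication by t in the basis of
  Hermite functions.\<close>

definition ladder :: "nat \<Rightarrow> real" where
  "ladder n = sqrt (real n / 2)"

lemma ladder_0 [simp]: "ladder 0 = 0"
  by (simp add: ladder_def)

lemma ladder_Suc_pos [simp]: "ladder (Suc n) > 0"
  by (simp add: ladder_def)

lemma ladder_Suc_nonzero [simp]: "ladder (Suc n) \<noteq> 0"
  by (simp add: ladder_def)

lemma ladder_nonneg [simp]: "ladder n \<ge> 0"
  by (simp add: ladder_def)

lemma ladder_sq: "ladder n * ladder n = real n / 2"
  by (simp add: ladder_def)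

text \<open>The normalised Hermite functions on the line, by their three-term recursion. For \<open>n = 0\<close> the
  term with index \<open>n - 1\<close> has the coefficient \<open>ladder 0 = 0\<close>. That they are given by the Rodrigues
  formula is shown in \<open>hermite_eq\<close>.\<close>

fun hfun :: "nat \<Rightarrow> real \<Rightarrow> real" where
  "hfun 0 t = pi powr (- 1 / 4) * exp (- t\<^sup>2 / 2)"
| "hfun (Suc n) t = (t * hfun n t - ladder n * hfun (n - 1) t) / ladder (Suc n)"

lemma hfun_mult: "t * hfun n t = ladder n * hfun (n - 1) t + ladder (Suc n) * hfun (Suc n) t"
  using ladder_Suc_pos[of n] by (simp add: less_imp_neq[symmetric])

declare hfun.simps(2) [simp del]

text \<open>Differentiating the recursion and removing the factors t with \<open>hfun_mult\<close> leaves the identity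
  \<open>1 + 2 c(m)^2 - c(m + 1)^2 = c(m + 1)^2\<close> for \<open>c(m)^2 = m / 2\<close>.\<close>

lemma hfun_deriv:
  "(hfun n has_real_derivative ladder n * hfun (n - 1) t - ladder (Suc n) * hfun (Suc n) t) (at t)"
proof (induction n rule: less_induct)
  case (less n)
  show ?case
  proof (cases n)
    case 0
    have "hfun 0 = (\<lambda>t. pi powr (- 1 / 4) * exp (- t\<^sup>2 / 2))" by auto
    moreover have "((\<lambda>t. pi powr (- 1 / 4) * exp (- t\<^sup>2 / 2)) has_real_derivative
        - (t * (pi powr (- 1 / 4) * exp (- t\<^sup>2 / 2)))) (at t)"
      by (auto intro!: derivative_eq_intros)
    moreover have "t * hfun 0 t = ladder (Suc 0) * hfun (Suc 0) t" using hfun_mult[of t 0] by simp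
    ultimately show ?thesis using 0 by simp
  next
    case (Suc m)
    let ?c = ladder
    have D: "(hfun m has_real_derivative ?c m * hfun (m - 1) t - ?c (Suc m) * hfun (Suc m) t) (at t)"
      using less Suc by simp
    have E: "((\<lambda>t. ?c m * hfun (m - 1) t) has_real_derivative
        ?c m * (?c (m - 1) * hfun (m - 2) t - ?c m * hfun m t)) (at t)"
    proof (cases m)
      case 0 then show ?thesis by simp
    next
      case (Suc k)
      have "(hfun k has_real_derivative ?c k * hfun (k - 1) t - ?c (Suc k) * hfun (Suc k) t) (at t)"
        using less \<open>n = Suc m\<close> Suc by simp
      from DERIV_cmult[OF this, of "?c (Suc k)"] show ?thesis using Suc by (simp add: numeral_2_eq_2)
    qed
    have F: "(hfun n has_real_derivative ((1 * hfun m t + (?c m * hfun (m - 1) t - ?c (Suc m) * hfun (Suc m) t) * t)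
        - ?c m * (?c (m - 1) * hfun (m - 2) t - ?c m * hfun m t)) / ?c n) (at t)"
    proof -
      have e: "hfun n = (\<lambda>t. (t * hfun m t - ladder m * hfun (m - 1) t) / ladder n)"
        unfolding Suc by (rule ext) (rule hfun.simps(2))
      show ?thesis
        unfolding e by (rule DERIV_cdivide[OF DERIV_diff[OF DERIV_mult[OF DERIV_ident D] E]])
    qed
    have g1: "?c m * (t * hfun (m - 1) t) = ?c m * (?c (m - 1) * hfun (m - 2) t + ?c m * hfun m t)"
      using hfun_mult[of t "m - 1"] by (cases m) (auto simp: numeral_2_eq_2)
    have g2: "t * hfun (Suc m) t = ?c (Suc m) * hfun m t + ?c (Suc n) * hfun (Suc n) t"
      using hfun_mult[of t "Suc m"] Suc by simp
    have "(1 * hfun m t + (?c m * hfun (m - 1) t - ?c (Suc m) * hfun (Suc m) t) * t)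
        - ?c m * (?c (m - 1) * hfun (m - 2) t - ?c m * hfun m t)
      = hfun m t + ?c m * (t * hfun (m - 1) t) - ?c n * (t * hfun (Suc m) t)
        - ?c m * (?c (m - 1) * hfun (m - 2) t - ?c m * hfun m t)"
      using Suc by (simp add: algebra_simps)
    also have "\<dots> = (1 + 2 * (?c m * ?c m) - ?c n * ?c n) * hfun m t - ?c n * ?c (Suc n) * hfun (Suc n) t"
      unfolding g1 g2 using Suc by (simp add: algebra_simps)
    also have "1 + 2 * (?c m * ?c m) - ?c n * ?c n = ?c n * ?c n"
      unfolding ladder_sq Suc by (simp add: field_simps)
    finally have N: "(1 * hfun m t + (?c m * hfun (m - 1) t - ?c (Suc m) * hfun (Suc m) t) * t)
        - ?c m * (?c (m - 1) * hfun (m - 2) t - ?c m * hfun m t)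
        = ?c n * (?c n * hfun m t - ?c (Suc n) * hfun (Suc n) t)"
      by (simp add: right_diff_distrib mult.assoc)
    have "?c n \<noteq> 0" using ladder_Suc_pos[of m] Suc by simp
    with F[unfolded N] have "(hfun n has_real_derivative (?c n * hfun m t - ?c (Suc n) * hfun (Suc n) t)) (at t)"
      by simp
    then show ?thesis using Suc by simp
  qed
qed

lemma hfun_isCont [continuous_intros]: "isCont (hfun n) t"
  using hfun_deriv DERIV_isCont by blast

lemma hfun_continuous_on: "continuous_on A (hfun n)"
  by (simp add: hfun_isCont continuous_at_imp_continuous_on)

lemma hfun_measurable [measurable]: "hfun n \<in> borel_measurable borel"
  using hfun_continuous_on borel_measurable_continuous_onI by blast


lemma power_div_fact_le_exp: "x \<ge> 0 \<Longrightarrow> x ^ k / fact k \<le> exp (x::real)"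
proof -
  assume x: "x \<ge> 0"
  have s: "(\<lambda>n. x ^ n /\<^sub>R fact n) sums exp x" by (rule exp_converges)
  have "(\<Sum>n\<in>{k}. x ^ n /\<^sub>R fact n) \<le> exp x"
    using s x by (intro sum_le_suminf[THEN order_trans]) (auto simp: sums_iff)
  then show ?thesis by (simp add: divide_inverse mult.commute)
qed

lemma abs_power_gauss_bounded: "\<exists>C. \<forall>t::real. \<bar>t\<bar> ^ k * exp (- t\<^sup>2 / 2) \<le> C"
proof (intro exI allI)
  fix t :: real
  have "(t\<^sup>2 / 2) ^ k / fact k \<le> exp (t\<^sup>2 / 2)" by (rule power_div_fact_le_exp) auto
  then have "(t\<^sup>2 / 2) ^ k * exp (- t\<^sup>2 / 2) \<le> fact k" by (simp add: exp_minus field_simps)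
  then have 1: "(t\<^sup>2) ^ k * exp (- t\<^sup>2 / 2) \<le> 2 ^ k * fact k"
    by (simp add: power_divide field_simps)
  have "\<bar>t\<bar> ^ k \<le> 1 + (t\<^sup>2) ^ k"
  proof (cases "\<bar>t\<bar> \<le> 1")
    case True then show ?thesis by (simp add: power_le_one add_increasing2)
  next
    case False
    have "\<bar>t\<bar> ^ 1 \<le> \<bar>t\<bar> ^ 2" using False by (intro power_increasing) auto
    then have "\<bar>t\<bar> ^ k \<le> (\<bar>t\<bar> ^ 2) ^ k" by (intro power_mono) auto
    then show ?thesis by simp
  qed
  then have "\<bar>t\<bar> ^ k * exp (- t\<^sup>2 / 2) \<le> (1 + (t\<^sup>2) ^ k) * exp (- t\<^sup>2 / 2)"
    by (intro mult_right_mono) auto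
  also have "\<dots> \<le> 1 + 2 ^ k * fact k" using 1 by (simp add: algebra_simps add_mono)
  finally show "\<bar>t\<bar> ^ k * exp (- t\<^sup>2 / 2) \<le> 1 + 2 ^ k * fact k" .
qed

text \<open>The power k has to vary in the induction on n, because the recursion raises it by one.\<close>

lemma hfun_decay: "\<exists>C. \<forall>t. \<bar>t\<bar> ^ k * \<bar>hfun n t\<bar> \<le> C"
proof (induction n arbitrary: k rule: less_induct)
  case (less n)
  show ?case
  proof (cases n)
    case 0
    obtain C where C: "\<And>t::real. \<bar>t\<bar> ^ k * exp (- t\<^sup>2 / 2) \<le> C"
      using abs_power_gauss_bounded[of k] by blast
    have "\<bar>t\<bar> ^ k * \<bar>hfun 0 t\<bar> \<le> pi powr (- 1 / 4) * C" for t
      using mult_left_mono[OF C[of t], of "pi powr (- 1 / 4)"] by (simp add: abs_mult algebra_simps)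
    then show ?thesis using 0 by blast
  next
    case (Suc m)
    obtain C where C: "\<And>t. \<bar>t\<bar> ^ Suc k * \<bar>hfun m t\<bar> \<le> C" using less Suc by blast
    obtain C' where C': "\<And>t. \<bar>t\<bar> ^ k * \<bar>hfun (m - 1) t\<bar> \<le> C'" using less Suc by (metis diff_le_self le_imp_less_Suc)
    have "\<bar>t\<bar> ^ k * \<bar>hfun n t\<bar> \<le> (C + ladder m * C') / ladder n" for t
    proof -
      have "\<bar>hfun n t\<bar> * ladder n = \<bar>t * hfun m t - ladder m * hfun (m - 1) t\<bar>"
        using hfun_mult[of t m] Suc by (simp add: abs_mult)
      also have "\<dots> \<le> \<bar>t\<bar> * \<bar>hfun m t\<bar> + ladder m * \<bar>hfun (m - 1) t\<bar>"
        using abs_triangle_ineq4[of "t * hfun m t" "ladder m * hfun (m - 1) t"] by (simp add: abs_mult)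
      finally have "\<bar>t\<bar> ^ k * (\<bar>hfun n t\<bar> * ladder n) \<le> \<bar>t\<bar> ^ k * (\<bar>t\<bar> * \<bar>hfun m t\<bar> + ladder m * \<bar>hfun (m - 1) t\<bar>)"
        by (intro mult_left_mono) auto
      also have "\<dots> = \<bar>t\<bar> ^ Suc k * \<bar>hfun m t\<bar> + ladder m * (\<bar>t\<bar> ^ k * \<bar>hfun (m - 1) t\<bar>)"
        by (simp add: algebra_simps)
      also have "\<dots> \<le> C + ladder m * C'" by (intro add_mono C mult_left_mono C') auto
      finally show ?thesis using Suc ladder_Suc_pos[of m] by (simp add: field_simps)
    qed
    then show ?thesis by blast
  qed
qed

lemma hfun_le_inverse: "\<exists>C. \<forall>t. \<bar>hfun n t\<bar> \<le> C / (1 + t\<^sup>2)"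
proof -
  obtain C where C: "\<And>t. \<bar>t\<bar> ^ 0 * \<bar>hfun n t\<bar> \<le> C" using hfun_decay by blast
  obtain C' where C': "\<And>t. \<bar>t\<bar> ^ 2 * \<bar>hfun n t\<bar> \<le> C'" using hfun_decay by blast
  have "\<bar>hfun n t\<bar> \<le> (C + C') / (1 + t\<^sup>2)" for t
    using C[of t] C'[of t] by (simp add: pos_le_divide_eq add_pos_nonneg algebra_simps)
  then show ?thesis by blast
qed

lemma integrable_inverse_1_plus_sq: "integrable lborel (\<lambda>t::real. 1 / (1 + t\<^sup>2))"
  using integrable_inverse_1_plus_square
  by (simp add: set_integrable_def divide_inverse)

lemma integrable_quadratic_decay:
  fixes f :: "real \<Rightarrow> 'a::{banach, second_countable_topology}"
  assumes "f \<in> borel_measurable borel" "\<And>t. norm (f t) \<le> C / (1 + t\<^sup>2)"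
  shows "integrable lborel f"
proof (rule Bochner_Integration.integrable_bound)
  show "integrable lborel (\<lambda>t::real. C * (1 / (1 + t\<^sup>2)))"
    using integrable_inverse_1_plus_sq by (rule integrable_mult_right)
  show "AE t in lborel. norm (f t) \<le> norm (C * (1 / (1 + t\<^sup>2)))"
  proof (rule AE_I2)
    fix t
    have "norm (f t) \<le> C * (1 / (1 + t\<^sup>2))" using assms(2)[of t] by simp
    then show "norm (f t) \<le> norm (C * (1 / (1 + t\<^sup>2)))" by (simp only: real_norm_def)
  qed
qed (use assms in simp)

lemma quadratic_decay_tendsto:
  fixes f :: "real \<Rightarrow> 'a::real_normed_vector"
  assumes "\<And>t. norm (f t) \<le> C / (1 + t\<^sup>2)"
  shows "(f \<longlongrightarrow> 0) at_top" "(f \<longlongrightarrow> 0) at_bot"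
proof -
  have l: "((\<lambda>t::real. C / (1 + t\<^sup>2)) \<longlongrightarrow> 0) at_top" "((\<lambda>t::real. C / (1 + t\<^sup>2)) \<longlongrightarrow> 0) at_bot"
    by real_asymp+
  show "(f \<longlongrightarrow> 0) at_top" by (rule Lim_null_comparison[OF _ l(1)]) (use assms in auto)
  show "(f \<longlongrightarrow> 0) at_bot" by (rule Lim_null_comparison[OF _ l(2)]) (use assms in auto)
qed

text \<open>Integration by parts on the whole line, in the form that needs no splitting of the integrand.\<close>

lemma integral_derivative_zero:
  fixes F f :: "real \<Rightarrow> 'a::euclidean_space"
  assumes D: "\<And>t. (F has_vector_derivative f t) (at t)" and c: "continuous_on UNIV f"
    and F: "\<And>t. norm (F t) \<le> C / (1 + t\<^sup>2)" and f: "\<And>t. norm (f t) \<le> C' / (1 + t\<^sup>2)"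
  shows "(\<integral>t. f t \<partial>lborel) = 0"
proof -
  have "(LBINT x=-\<infinity>..\<infinity>. f x) = 0 - 0"
  proof (rule interval_integral_FTC_integrable)
    show "set_integrable lborel (einterval (-\<infinity>) \<infinity>) f"
      using integrable_quadratic_decay[OF borel_measurable_continuous_onI[OF c] f]
      by (simp add: set_integrable_def)
    show "((F \<circ> real_of_ereal) \<longlongrightarrow> 0) (at_right (-\<infinity>))" "((F \<circ> real_of_ereal) \<longlongrightarrow> 0) (at_left \<infinity>)"
      using quadratic_decay_tendsto[OF F] by (simp_all only: ereal_tendsto_simps)
  qed (use D c in \<open>auto simp: continuous_on_eq_continuous_at\<close>)
  then show ?thesis by (simp add: interval_lebesgue_integral_def set_lebesgue_integral_def)
qed


lemma hfun_product_decay: "\<exists>C. \<forall>t. \<bar>hfun m t * hfun n t\<bar> \<le> C / (1 + t\<^sup>2)"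
proof -
  obtain C where C: "\<And>t. \<bar>t\<bar> ^ 0 * \<bar>hfun m t\<bar> \<le> C" using hfun_decay by blast
  obtain D where D: "\<And>t. \<bar>hfun n t\<bar> \<le> D / (1 + t\<^sup>2)" using hfun_le_inverse by blast
  have "\<bar>hfun m t * hfun n t\<bar> \<le> C * D / (1 + t\<^sup>2)" for t
    using mult_mono[OF C[of t] D[of t]] C[of t] by (simp add: abs_mult)
  then show ?thesis by blast
qed

lemma hfun_product_integrable [simp]: "integrable lborel (\<lambda>t. hfun m t * hfun n t)"
proof -
  obtain C where "\<And>t. \<bar>hfun m t * hfun n t\<bar> \<le> C / (1 + t\<^sup>2)" using hfun_product_decay by blast
  then show ?thesis by (intro integrable_quadratic_decay[where C = C]) auto
qed

lemma hfun_bounded_all: "\<exists>C. \<forall>t. \<bar>hfun n t\<bar> \<le> C"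
  using hfun_decay[of 0 n] by simp

abbreviation "hfun' n t \<equiv> ladder n * hfun (n - 1) t - ladder (Suc n) * hfun (Suc n) t"

text \<open>Let \<open>I m n\<close> be the inner product of \<open>hfun m\<close> and \<open>hfun n\<close>. The integral of the derivative of
  \<open>hfun m * hfun n\<close> vanishes, and multiplication by t is symmetric. These are two linear relations
  between the four neighbours of \<open>I m n\<close>, and their sum contains only two of them.\<close>

lemma hfun_inner_shift:
  "ladder m * (\<integral>t. hfun (m - 1) t * hfun n t \<partial>lborel) =
   ladder (Suc n) * (\<integral>t. hfun m t * hfun (Suc n) t \<partial>lborel)"
proof -
  let ?I = "\<lambda>m n. \<integral>t. hfun m t * hfun n t \<partial>lborel"
  let ?f = "\<lambda>t. hfun' m t * hfun n t + hfun' n t * hfun m t"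
  have f_eq: "?f = (\<lambda>t. ladder m * (hfun (m - 1) t * hfun n t) - ladder (Suc m) * (hfun (Suc m) t * hfun n t)
     + (ladder n * (hfun m t * hfun (n - 1) t) - ladder (Suc n) * (hfun m t * hfun (Suc n) t)))"
    by (auto simp: algebra_simps)
  obtain C1 where C1: "\<And>t. \<bar>hfun m t * hfun n t\<bar> \<le> C1 / (1 + t\<^sup>2)" using hfun_product_decay by blast
  obtain a1 where a1: "\<And>t. \<bar>hfun (m-1) t * hfun n t\<bar> \<le> a1 / (1 + t\<^sup>2)" using hfun_product_decay by blast
  obtain a2 where a2: "\<And>t. \<bar>hfun (Suc m) t * hfun n t\<bar> \<le> a2 / (1 + t\<^sup>2)" using hfun_product_decay by blast
  obtain a3 where a3: "\<And>t. \<bar>hfun m t * hfun (n-1) t\<bar> \<le> a3 / (1 + t\<^sup>2)" using hfun_product_decay by blast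
  obtain a4 where a4: "\<And>t. \<bar>hfun m t * hfun (Suc n) t\<bar> \<le> a4 / (1 + t\<^sup>2)" using hfun_product_decay by blast
  have "\<bar>?f t\<bar> \<le> (ladder m * a1 + ladder (Suc m) * a2 + ladder n * a3 + ladder (Suc n) * a4) / (1 + t\<^sup>2)" for t
  proof -
    have "\<bar>?f t\<bar> \<le> ladder m * \<bar>hfun (m - 1) t * hfun n t\<bar> + ladder (Suc m) * \<bar>hfun (Suc m) t * hfun n t\<bar>
     + (ladder n * \<bar>hfun m t * hfun (n - 1) t\<bar> + ladder (Suc n) * \<bar>hfun m t * hfun (Suc n) t\<bar>)"
      unfolding f_eq[THEN fun_cong]
      by (intro order_trans[OF abs_triangle_ineq] add_mono order_trans[OF abs_triangle_ineq4])
         (simp_all add: abs_mult)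
    also have "\<dots> \<le> ladder m * (a1 / (1 + t\<^sup>2)) + ladder (Suc m) * (a2 / (1 + t\<^sup>2))
     + (ladder n * (a3 / (1 + t\<^sup>2)) + ladder (Suc n) * (a4 / (1 + t\<^sup>2)))"
      by (intro add_mono mult_left_mono a1 a2 a3 a4) auto
    finally show ?thesis by (simp add: add_divide_distrib)
  qed
  note b = this
  have "(\<integral>t. ?f t \<partial>lborel) = 0"
  proof (rule integral_derivative_zero)
    show "((\<lambda>t. hfun m t * hfun n t) has_vector_derivative ?f t) (at t)" for t
      using DERIV_mult[OF hfun_deriv[of m t] hfun_deriv[of n t]]
      by (simp add: has_real_derivative_iff_has_vector_derivative)
    show "continuous_on UNIV ?f" by (intro continuous_intros hfun_continuous_on)
  qed (use C1 b in auto)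
  then have 1: "ladder m * ?I (m-1) n - ladder (Suc m) * ?I (Suc m) n
     + (ladder n * ?I m (n-1) - ladder (Suc n) * ?I m (Suc n)) = 0"
    unfolding f_eq by simp
  have "(\<integral>t. (t * hfun m t) * hfun n t \<partial>lborel) =
      (\<integral>t. ladder m * (hfun (m - 1) t * hfun n t) + ladder (Suc m) * (hfun (Suc m) t * hfun n t) \<partial>lborel)"
    unfolding hfun_mult[of _ m] by (simp add: algebra_simps)
  also have "\<dots> = ladder m * ?I (m-1) n + ladder (Suc m) * ?I (Suc m) n" by simp
  finally have "(\<integral>t. (t * hfun m t) * hfun n t \<partial>lborel) = ladder m * ?I (m-1) n + ladder (Suc m) * ?I (Suc m) n" .
  moreover have "(\<integral>t. hfun m t * (t * hfun n t) \<partial>lborel) =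
      (\<integral>t. ladder n * (hfun m t * hfun (n - 1) t) + ladder (Suc n) * (hfun m t * hfun (Suc n) t) \<partial>lborel)"
    unfolding hfun_mult[of _ n] by (simp add: algebra_simps)
  then have "(\<integral>t. hfun m t * (t * hfun n t) \<partial>lborel) = ladder n * ?I m (n-1) + ladder (Suc n) * ?I m (Suc n)"
    by simp
  ultimately have 2: "ladder m * ?I (m-1) n + ladder (Suc m) * ?I (Suc m) n
     = ladder n * ?I m (n-1) + ladder (Suc n) * ?I m (Suc n)"
    by (simp add: ac_simps)
  show ?thesis using 1 2 by linarith
qed

lemma hfun_0_norm: "(\<integral>t. hfun 0 t * hfun 0 t \<partial>lborel) = 1"
proof -
  have "hfun 0 t * hfun 0 t = normal_density 0 (1 / sqrt 2) t" for t
  proof -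
    have "pi powr (- 1 / 4) * pi powr (- 1 / 4) = pi powr (-(1 / 2))"
      unfolding powr_add[symmetric] by (rule arg_cong[where f = "\<lambda>x. pi powr x"]) simp
    also have "\<dots> = 1 / sqrt pi" by (simp add: powr_minus_divide powr_half_sqrt)
    finally have p: "pi powr (- 1 / 4) * pi powr (- 1 / 4) = 1 / sqrt pi" .
    have e: "exp (- t\<^sup>2 / 2) * exp (- t\<^sup>2 / 2) = exp (- t\<^sup>2)" by (simp add: mult_exp_exp)
    have "hfun 0 t * hfun 0 t = (pi powr (- 1 / 4) * pi powr (- 1 / 4)) * (exp (- t\<^sup>2 / 2) * exp (- t\<^sup>2 / 2))"
      by (simp add: algebra_simps)
    then show ?thesis unfolding p e by (simp add: normal_density_def power_divide)
  qed
  then show ?thesis by (simp add: integral_normal_density)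
qed

lemma hfun_orthonormal: "(\<integral>t. hfun m t * hfun n t \<partial>lborel) = (if m = n then 1 else 0)"
proof (induction n arbitrary: m)
  case 0
  show ?case
  proof (cases m)
    case 0 then show ?thesis using hfun_0_norm by simp
  next
    case (Suc k)
    have "ladder (Suc k) * (\<integral>t. hfun 0 t * hfun (Suc k) t \<partial>lborel) = 0"
      using hfun_inner_shift[of 0 k] by simp
    then show ?thesis using Suc ladder_Suc_pos[of k] by (simp add: mult.commute)
  qed
next
  case (Suc n)
  have *: "ladder (Suc n) * (\<integral>t. hfun m t * hfun (Suc n) t \<partial>lborel) = ladder m * (if m - 1 = n then 1 else 0)"
    using hfun_inner_shift[of m n] Suc by simp
  show ?case
  proof (cases m)
    case 0 then show ?thesis using * ladder_Suc_pos[of n] by (auto)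
  next
    case (Suc k) then show ?thesis using * ladder_Suc_pos[of n] by (auto simp: less_imp_neq[symmetric])
  qed
qed

text \<open>The square of \<open>hfun n\<close> is the integral of \<open>2 * hfun n * hfun' n\<close>, hence at most the integral over
  the line of \<open>(hfun n)^2 + (hfun' n)^2\<close>. By orthonormality this is \<open>n + 3/2\<close>.\<close>

lemma hfun_sup_bound: "\<bar>hfun n t\<bar> \<le> 2 * (real n + 1)"
proof -
  let ?g = "\<lambda>x. 2 * hfun n x * hfun' n x"
  have cont: "continuous_on UNIV ?g" by (intro continuous_intros hfun_continuous_on)
  have int1: "integrable lborel (\<lambda>x. hfun n x * hfun n x + hfun' n x * hfun' n x)"
    by (simp add: algebra_simps)
  have "integrable lborel (\<lambda>x. hfun n x * hfun (n - 1) x * ladder n * 2 - hfun n x * hfun (Suc n) x * ladder (Suc n) * 2)"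
    by (intro Bochner_Integration.integrable_diff integrable_mult_left hfun_product_integrable)
  then have intg: "integrable lborel ?g" by (rule back_subst[where P = "integrable lborel"]) (auto simp: algebra_simps)
  obtain C where C: "\<And>t. \<bar>hfun n t * hfun n t\<bar> \<le> C / (1 + t\<^sup>2)" using hfun_product_decay by blast
  have "(LBINT x=-\<infinity>..t. ?g x) = (hfun n t)\<^sup>2 - 0"
  proof (rule interval_integral_FTC_integrable)
    show "((\<lambda>x. (hfun n x)\<^sup>2) has_vector_derivative ?g x) (at x)" for x
      using DERIV_mult[OF hfun_deriv[of n x] hfun_deriv[of n x]]
      by (simp add: has_real_derivative_iff_has_vector_derivative power2_eq_square algebra_simps)
    show "set_integrable lborel (einterval (-\<infinity>) t) ?g"
      unfolding set_integrable_def by (intro integrable_mult_indicator intg) auto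
    have "((\<lambda>x. (hfun n x)\<^sup>2) \<longlongrightarrow> 0) at_bot"
      by (rule quadratic_decay_tendsto[where C = C]) (use C in \<open>auto simp: power2_eq_square\<close>)
    then show "(((\<lambda>x. (hfun n x)\<^sup>2) \<circ> real_of_ereal) \<longlongrightarrow> 0) (at_right (-\<infinity>))"
      by (simp only: ereal_tendsto_simps)
    have "((\<lambda>x. (hfun n x)\<^sup>2) \<longlongrightarrow> (hfun n t)\<^sup>2) (at_left t)"
      using hfun_isCont[of t n] unfolding isCont_def
      by (intro tendsto_power) (rule tendsto_within_subset[where S = UNIV], auto)
    then show "(((\<lambda>x. (hfun n x)\<^sup>2) \<circ> real_of_ereal) \<longlongrightarrow> (hfun n t)\<^sup>2) (at_left (ereal t))"
      by (simp only: ereal_tendsto_simps)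
  qed (use cont in \<open>auto simp: continuous_on_eq_continuous_at\<close>)
  then have "(hfun n t)\<^sup>2 = (\<integral>x. indicator (einterval (-\<infinity>) t) x * ?g x \<partial>lborel)"
    by (simp add: interval_lebesgue_integral_def set_lebesgue_integral_def)
  also have "\<dots> \<le> (\<integral>x. hfun n x * hfun n x + hfun' n x * hfun' n x \<partial>lborel)"
  proof (rule integral_mono[OF _ int1])
    show "integrable lborel (\<lambda>x. indicator (einterval (-\<infinity>) t) x * ?g x)"
      using integrable_mult_indicator[OF _ intg, of "einterval (-\<infinity>) t"] by simp
    fix x
    have "2 * a * b \<le> a * a + b * b" for a b :: real using sum_squares_bound[of a b] by (simp add: power2_eq_square)
    then show "indicator (einterval (-\<infinity>) t) x * ?g x \<le> hfun n x * hfun n x + hfun' n x * hfun' n x"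
      by (auto simp: indicator_def)
  qed
  also have "(\<lambda>x. hfun n x * hfun n x + hfun' n x * hfun' n x) =
     (\<lambda>x. hfun n x * hfun n x + (ladder n * ladder n * (hfun (n - 1) x * hfun (n - 1) x)
       - 2 * ladder n * ladder (Suc n) * (hfun (n - 1) x * hfun (Suc n) x)
       + ladder (Suc n) * ladder (Suc n) * (hfun (Suc n) x * hfun (Suc n) x)))"
    by (auto simp: algebra_simps)
  also have "(\<integral>x. hfun n x * hfun n x + (ladder n * ladder n * (hfun (n - 1) x * hfun (n - 1) x)
       - 2 * ladder n * ladder (Suc n) * (hfun (n - 1) x * hfun (Suc n) x)
       + ladder (Suc n) * ladder (Suc n) * (hfun (Suc n) x * hfun (Suc n) x)) \<partial>lborel)
     = 1 + (ladder n * ladder n + ladder (Suc n) * ladder (Suc n))"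
    by (simp add: hfun_orthonormal)
  also have "\<dots> \<le> (2 * (real n + 1))\<^sup>2" unfolding ladder_sq by (simp add: power2_eq_square field_simps)
  finally have "\<bar>hfun n t\<bar>\<^sup>2 \<le> (2 * (real n + 1))\<^sup>2" by simp
  then show ?thesis by (rule power2_le_imp_le) simp
qed

lemma integrable_times_bounded:
  fixes g h :: "'a \<Rightarrow> 'b::{real_normed_algebra, banach, second_countable_topology}"
  assumes "integrable M g" "h \<in> borel_measurable M" "\<And>x. x \<in> space M \<Longrightarrow> norm (h x) \<le> C"
  shows "integrable M (\<lambda>x. g x * h x)"
proof (rule Bochner_Integration.integrable_bound)
  show "integrable M (\<lambda>x. C * norm (g x))" using assms by simp
  show "AE x in M. norm (g x * h x) \<le> norm (C * norm (g x))"
  proof (rule AE_I2)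
    fix x assume x: "x \<in> space M"
    have "norm (g x * h x) \<le> norm (g x) * norm (h x)" by (rule norm_mult_ineq)
    also have "\<dots> \<le> norm (g x) * C" using assms(3)[OF x] by (intro mult_left_mono) auto
    finally show "norm (g x * h x) \<le> norm (C * norm (g x))" by (simp add: mult.commute abs_le_iff)
  qed
qed (use assms in simp)

lemma continuous_AE_zero:
  fixes g :: "real \<Rightarrow> 'a::real_normed_vector"
  assumes "continuous_on UNIV g" "AE t in lborel. g t = 0"
  shows "g t = 0"
proof -
  have o: "open {t. g t \<noteq> 0}" using assms(1) by (intro open_Collect_neq) auto
  have "{t. g t \<noteq> 0} \<in> null_sets lborel"
    using assms(2) o by (simp add: AE_iff_null_sets)
  then have "negligible {t. g t \<noteq> 0}"
    by (simp add: negligible_iff_null_sets null_sets_completionI)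
  then show ?thesis using open_not_negligible[OF o] by blast
qed

text \<open>All moments of \<open>F = g * hfun 0\<close> vanish. As \<open>exp |u t| * hfun 0 t\<close> is bounded, the Fourier
  transform of F may be computed from the power series of the exponential, so it vanishes too.
  Hence the positive and the negative part of F are densities with the same characteristic
  function, and they agree by Levy's uniqueness theorem.\<close>

lemma hfun_complete_real:
  fixes g :: "real \<Rightarrow> real"
  assumes c: "continuous_on UNIV g" and b: "\<And>t. \<bar>g t\<bar> \<le> C / (1 + t\<^sup>2)"
    and z: "\<And>n. (\<integral>t. g t * hfun n t \<partial>lborel) = 0"
  shows "g t = 0"
proof -
  have gm [measurable]: "g \<in> borel_measurable borel" using c by (rule borel_measurable_continuous_onI)
  have gi: "integrable lborel g" by (rule integrable_quadratic_decay[where C = C]) (use b in auto)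
  have int: "integrable lborel (\<lambda>t. g t * (t ^ k * hfun n t))" for k n
  proof -
    obtain D where "\<And>t. \<bar>t\<bar> ^ k * \<bar>hfun n t\<bar> \<le> D" using hfun_decay by blast
    then show ?thesis by (intro integrable_times_bounded[OF gi, where C = D]) (auto simp: abs_mult power_abs)
  qed
  have mom: "(\<integral>t. g t * (t ^ k * hfun n t) \<partial>lborel) = 0" for k n
  proof (induction k arbitrary: n)
    case 0 then show ?case using z by simp
  next
    case (Suc k)
    have "g t * (t ^ Suc k * hfun n t) = ladder n * (g t * (t ^ k * hfun (n - 1) t)) +
        ladder (Suc n) * (g t * (t ^ k * hfun (Suc n) t))" for t
      using arg_cong[OF hfun_mult[of t n], of "\<lambda>y. g t * t ^ k * y"] by (simp add: algebra_simps)
    then show ?case using Suc int by simp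
  qed
  define F where "F = (\<lambda>t. g t * hfun 0 t)"
  have Fm [measurable]: "F \<in> borel_measurable borel" unfolding F_def by simp
  have Fi: "integrable lborel F" using int[of 0 0] by (simp add: F_def)
  have char0: "(\<integral>t. of_real (F t) * iexp (u * t) \<partial>lborel) = 0" for u
  proof -
    let ?s = "\<lambda>N t. of_real (F t) * (\<Sum>k<N. (\<i> * of_real (u * t)) ^ k /\<^sub>R fact k)"
    have "(\<lambda>N. \<integral>t. ?s N t \<partial>lborel) \<longlonglongrightarrow> (\<integral>t. of_real (F t) * iexp (u * t) \<partial>lborel)"
    proof (rule integral_dominated_convergence)
      show "integrable lborel (\<lambda>t. pi powr (- 1 / 4) * exp (u\<^sup>2 / 2) * \<bar>g t\<bar>)" using gi by simp
      show "AE t in lborel. (\<lambda>N. ?s N t) \<longlonglongrightarrow> of_real (F t) * iexp (u * t)"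
        using exp_converges by (intro AE_I2 tendsto_mult tendsto_const) (simp add: sums_def)
      fix N show "AE t in lborel. norm (?s N t) \<le> pi powr (- 1 / 4) * exp (u\<^sup>2 / 2) * \<bar>g t\<bar>"
      proof (rule AE_I2)
        fix t
        have "norm (\<Sum>k<N. (\<i> * of_real (u * t)) ^ k /\<^sub>R fact k) \<le> (\<Sum>k<N. \<bar>u * t\<bar> ^ k /\<^sub>R fact k)"
          by (rule order_trans[OF norm_sum]) (simp add: norm_power norm_mult power_mult_distrib abs_mult)
        also have "\<dots> \<le> exp \<bar>u * t\<bar>"
          using exp_converges[of "\<bar>u * t\<bar>"] by (intro sum_le_suminf[THEN order_trans]) (auto simp: sums_iff)
        also have "\<dots> \<le> exp (u\<^sup>2 / 2 + t\<^sup>2 / 2)"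
          using sum_squares_bound[of "\<bar>u\<bar>" "\<bar>t\<bar>"] by (simp add: abs_mult)
        finally have e: "norm (\<Sum>k<N. (\<i> * of_real (u * t)) ^ k /\<^sub>R fact k) \<le> exp (u\<^sup>2 / 2 + t\<^sup>2 / 2)" .
        have "norm (?s N t) \<le> \<bar>F t\<bar> * exp (u\<^sup>2 / 2 + t\<^sup>2 / 2)"
          unfolding norm_mult by (rule mult_mono) (use e in auto)
        also have "\<dots> = pi powr (- 1 / 4) * exp (u\<^sup>2 / 2) * \<bar>g t\<bar> * (exp (- t\<^sup>2 / 2) * exp (t\<^sup>2 / 2))"
          by (simp add: F_def abs_mult exp_add)
        also have "exp (- t\<^sup>2 / 2) * exp (t\<^sup>2 / 2) = 1" by (simp add: mult_exp_exp)
        finally show "norm (?s N t) \<le> pi powr (- 1 / 4) * exp (u\<^sup>2 / 2) * \<bar>g t\<bar>" by simp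
      qed
    qed auto
    moreover have "(\<integral>t. ?s N t \<partial>lborel) = 0" for N
    proof -
      have "?s N t = (\<Sum>k<N. ((\<i> * of_real u) ^ k / fact k) * complex_of_real (g t * (t ^ k * hfun 0 t)))" for t
        unfolding sum_distrib_left F_def
        by (intro sum.cong refl) (simp add: scaleR_conv_of_real power_mult_distrib divide_inverse algebra_simps del: hfun.simps)
      then show ?thesis using int mom by (simp del: of_real_mult hfun.simps)
    qed
    ultimately show ?thesis by (simp add: LIMSEQ_const_iff)
  qed
  \<comment> \<open>The added Gaussian makes the common mass m positive, so that one can normalise.\<close>
  define p where "p = (\<lambda>t. max 0 (F t) + hfun 0 t * hfun 0 t)"
  define q where "q = (\<lambda>t. max 0 (- F t) + hfun 0 t * hfun 0 t)"
  have [measurable]: "p \<in> borel_measurable borel" "q \<in> borel_measurable borel"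
    unfolding p_def q_def by (simp_all del: hfun.simps)
  have pq0: "p t \<ge> 0" "q t \<ge> 0" for t unfolding p_def q_def by simp_all
  have pi: "integrable lborel p" and qi: "integrable lborel q"
    unfolding p_def q_def using Fi by (simp_all del: hfun.simps)
  have diff: "p t - q t = F t" for t unfolding p_def q_def by auto
  define m where "m = (\<integral>t. p t \<partial>lborel)"
  have "m \<ge> (\<integral>t. hfun 0 t * hfun 0 t \<partial>lborel)" unfolding m_def p_def
    using Fi by (intro integral_mono) (simp_all del: hfun.simps)
  then have m: "m > 0" using hfun_0_norm by linarith
  have "(\<integral>t. p t - q t \<partial>lborel) = 0" unfolding diff using mom[of 0 0] by (simp add: F_def)
  then have mq: "(\<integral>t. q t \<partial>lborel) = m" using pi qi by (simp add: m_def)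
  let ?M1 = "density lborel (\<lambda>t. ennreal (p t / m))" and ?M2 = "density lborel (\<lambda>t. ennreal (q t / m))"
  have rd: "real_distribution (density lborel (\<lambda>t. ennreal (r t / m)))"
    if "integrable lborel r" "(\<integral>t. r t \<partial>lborel) = m" "\<And>t. r t \<ge> 0" for r
  proof -
    have [measurable]: "r \<in> borel_measurable borel" using that(1) by auto
    have "emeasure (density lborel (\<lambda>t. ennreal (r t / m))) UNIV = (\<integral>\<^sup>+t. ennreal (r t / m) \<partial>lborel)"
      by (subst emeasure_density) auto
    also have "\<dots> = ennreal (\<integral>t. r t / m \<partial>lborel)"
      using that m by (intro nn_integral_eq_integral) auto
    also have "\<dots> = 1" using that m by simp
    finally show ?thesis unfolding real_distribution_def real_distribution_axioms_def
      by (auto intro!: prob_spaceI)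
  qed
  have ch: "char (density lborel (\<lambda>t. ennreal (r t / m))) u = (\<integral>t. of_real (r t) * iexp (u * t) \<partial>lborel) / m"
    if "integrable lborel r" "\<And>t. r t \<ge> 0" for r u
  proof -
    have [measurable]: "r \<in> borel_measurable borel" using that(1) by auto
    show ?thesis unfolding char_def using that m
      by (subst integral_density) (auto simp: scaleR_conv_of_real)
  qed
  have "char ?M1 = char ?M2"
  proof
    fix u
    have ii: "integrable lborel (\<lambda>t. complex_of_real (r t) * iexp (u * t))" if "integrable lborel r" for r
      using that by (intro integrable_times_bounded[where C = 1]) auto
    have "(\<integral>t. of_real (p t) * iexp (u * t) - of_real (q t) * iexp (u * t) \<partial>lborel) = 0"
      using char0[of u] by (simp add: left_diff_distrib[symmetric] of_real_diff[symmetric] diff del: of_real_diff)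
    then have "(\<integral>t. of_real (p t) * iexp (u * t) \<partial>lborel) = (\<integral>t. of_real (q t) * iexp (u * t) \<partial>lborel)"
      using ii[OF pi] ii[OF qi] by simp
    then show "char ?M1 u = char ?M2 u" using ch pi qi pq0 by simp
  qed
  then have "?M1 = ?M2"
    by (intro Levy_uniqueness rd) (use pi qi mq pq0 in \<open>auto simp: m_def\<close>)
  then have "AE t in lborel. ennreal (p t / m) = ennreal (q t / m)"
    by (subst (asm) sigma_finite_measure.density_unique_iff[OF lborel.sigma_finite_measure_axioms]) auto
  then have "AE t in lborel. g t = 0"
  proof (rule AE_mp, intro AE_I2 impI)
    fix t assume "ennreal (p t / m) = ennreal (q t / m)"
    then have "p t = q t" using pq0 m by simp
    then have "F t = 0" using diff[of t] by simp
    then show "g t = 0" by (simp add: F_def)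
  qed
  then show ?thesis using continuous_AE_zero[OF c] by blast
qed

lemma hfun_complete:
  fixes g :: "real \<Rightarrow> complex"
  assumes c: "continuous_on UNIV g" and b: "\<And>t. norm (g t) \<le> C / (1 + t\<^sup>2)"
    and z: "\<And>n. (\<integral>t. g t * of_real (hfun n t) \<partial>lborel) = 0"
  shows "g t = 0"
proof -
  have gi: "integrable lborel g" by (rule integrable_quadratic_decay[OF borel_measurable_continuous_onI[OF c] b])
  have i: "integrable lborel (\<lambda>t. g t * of_real (hfun n t))" for n
  proof -
    obtain D where "\<And>t. \<bar>hfun n t\<bar> \<le> D" using hfun_bounded_all by blast
    then show ?thesis by (intro integrable_times_bounded[OF gi, where C = D]) auto
  qed
  have "Re (g t) = 0"
  proof (rule hfun_complete_real[where g = "\<lambda>t. Re (g t)" and C = C])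
    show "continuous_on UNIV (\<lambda>t. Re (g t))" using c by (intro continuous_intros)
    show "\<bar>Re (g t)\<bar> \<le> C / (1 + t\<^sup>2)" for t using b[of t] abs_Re_le_cmod[of "g t"] by linarith
    show "(\<integral>t. Re (g t) * hfun n t \<partial>lborel) = 0" for n
      using integral_Re[OF i[of n]] z[of n] by simp
  qed
  moreover have "Im (g t) = 0"
  proof (rule hfun_complete_real[where g = "\<lambda>t. Im (g t)" and C = C])
    show "continuous_on UNIV (\<lambda>t. Im (g t))" using c by (intro continuous_intros)
    show "\<bar>Im (g t)\<bar> \<le> C / (1 + t\<^sup>2)" for t using b[of t] abs_Im_le_cmod[of "g t"] by linarith
    show "(\<integral>t. Im (g t) * hfun n t \<partial>lborel) = 0" for n
      using integral_Im[OF i[of n]] z[of n] by simp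
  qed
  ultimately show ?thesis by (simp add: complex_eq_iff)
qed

section \<open>Hermite functions of several variables\<close>

interpretation lborel_product: product_sigma_finite "\<lambda>_::nat. lborel :: real measure" ..

definition hprod :: "nat \<Rightarrow> (nat \<Rightarrow> nat) \<Rightarrow> (nat \<Rightarrow> real) \<Rightarrow> real" where
  "hprod d \<gamma> x = (\<Prod>i<d. hfun (\<gamma> i) (x i))"

definition decay_weight :: "nat \<Rightarrow> (nat \<Rightarrow> real) \<Rightarrow> real" where
  "decay_weight d x = (\<Prod>i<d. 1 / (1 + (x i)\<^sup>2))"

text \<open>Continuous functions whose decay suffices for integration in one variable at a time. All
  function spaces considered below are contained in this one.\<close>

definition quad_decay :: "nat \<Rightarrow> seq_fun set" where
  "quad_decay d = {f. cylinder d f \<and> continuous_on UNIV f \<and> (\<exists>C. \<forall>x. norm (f x) \<le> C * decay_weight d x)}"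

definition coef :: "nat \<Rightarrow> seq_fun \<Rightarrow> (nat \<Rightarrow> nat) \<Rightarrow> complex" where
  "coef d f \<gamma> = (\<integral>x. f x * of_real (hprod d \<gamma> x) \<partial>leb d)"

text \<open>A bound for the supremum of \<open>hprod d \<gamma>\<close>, of polynomial growth in \<open>\<gamma>\<close>.\<close>

definition hbound :: "nat \<Rightarrow> (nat \<Rightarrow> nat) \<Rightarrow> real" where
  "hbound d \<gamma> = (\<Prod>i<d. 2 * (real (\<gamma> i) + 1))"

lemma hbound_nonneg [simp]: "hbound d \<gamma> \<ge> 0"
  unfolding hbound_def by (intro prod_nonneg) auto

lemma hprod_bound: "\<bar>hprod d \<gamma> x\<bar> \<le> hbound d \<gamma>"
  unfolding hprod_def hbound_def abs_prod by (intro prod_mono conjI hfun_sup_bound) auto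

lemma hprod_cong: "(\<And>i. i < d \<Longrightarrow> \<gamma> i = \<gamma>' i) \<Longrightarrow> (\<And>i. i < d \<Longrightarrow> x i = x' i) \<Longrightarrow> hprod d \<gamma> x = hprod d \<gamma>' x'"
  unfolding hprod_def by (intro prod.cong) auto

lemma hprod_split: "i < d \<Longrightarrow> hprod d \<gamma> x = hfun (\<gamma> i) (x i) * (\<Prod>j\<in>{..<d} - {i}. hfun (\<gamma> j) (x j))"
  unfolding hprod_def by (rule prod.remove) auto

lemma hprod_upd_index:
  "i < d \<Longrightarrow> hprod d (\<gamma>(i := k)) x = hfun k (x i) * (\<Prod>j\<in>{..<d} - {i}. hfun (\<gamma> j) (x j))"
  by (subst hprod_split[of i]) (auto intro!: prod.cong)

lemma hprod_upd_pt:
  "i < d \<Longrightarrow> hprod d \<gamma> (x(i := t)) = hfun (\<gamma> i) t * (\<Prod>j\<in>{..<d} - {i}. hfun (\<gamma> j) (x j))"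
  by (subst hprod_split[of i]) (auto intro!: prod.cong)

lemma hprod_continuous: "continuous_on UNIV (hprod d \<gamma>)"
proof -
  have "continuous_on UNIV (\<lambda>x :: nat \<Rightarrow> real. hfun (\<gamma> i) (x i))" for i
    by (rule continuous_on_compose2[OF hfun_continuous_on[of UNIV] continuous_on_product_coordinates]) simp
  then show ?thesis unfolding hprod_def[abs_def] by (intro continuous_on_prod) auto
qed

lemma hprod_mult:
  assumes "i < d"
  shows "x i * hprod d \<gamma> x = ladder (\<gamma> i) * hprod d (\<gamma>(i := \<gamma> i - 1)) x
           + ladder (Suc (\<gamma> i)) * hprod d (\<gamma>(i := Suc (\<gamma> i))) x"
proof -
  have "x i * hprod d \<gamma> x = (x i * hfun (\<gamma> i) (x i)) * (\<Prod>j\<in>{..<d} - {i}. hfun (\<gamma> j) (x j))"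
    using hprod_split[OF assms, of \<gamma> x] by simp
  then show ?thesis unfolding hfun_mult hprod_upd_index[OF assms] by (simp add: algebra_simps)
qed

lemma hprod_deriv:
  assumes "i < d"
  shows "((\<lambda>t. hprod d \<gamma> (x(i := t))) has_real_derivative
    ladder (\<gamma> i) * hprod d (\<gamma>(i := \<gamma> i - 1)) (x(i := t))
      - ladder (Suc (\<gamma> i)) * hprod d (\<gamma>(i := Suc (\<gamma> i))) (x(i := t))) (at t)"
proof -
  have e: "(\<Prod>j\<in>{..<d} - {i}. hfun ((\<gamma>(i := k)) j) (x j)) = (\<Prod>j\<in>{..<d} - {i}. hfun (\<gamma> j) (x j))" for k
    by (intro prod.cong) auto
  show ?thesis unfolding hprod_upd_pt[OF assms] e
    using DERIV_cmult_right[OF hfun_deriv[of "\<gamma> i" t], of "\<Prod>j\<in>{..<d} - {i}. hfun (\<gamma> j) (x j)"]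
    by (simp add: algebra_simps)
qed

subsection \<open>Integration over cylinders\<close>

lemma continuous_on_upd_value: "continuous_on UNIV (\<lambda>t::real. (x :: nat \<Rightarrow> real)(i := t))"
proof (rule continuous_on_coordinatewise_then_product)
  show "continuous_on UNIV (\<lambda>t::real. (x(i := t)) j)" for j by (cases "j = i") auto
qed

lemma continuous_on_upd_pt: "continuous_on UNIV (\<lambda>x :: nat \<Rightarrow> real. x(i := t))"
proof (rule continuous_on_coordinatewise_then_product)
  show "continuous_on UNIV (\<lambda>x :: nat \<Rightarrow> real. (x(i := t)) j)" for j by (cases "j = i") auto
qed

lemma integral_norm_le:
  fixes f :: "'a \<Rightarrow> 'b::{banach, second_countable_topology}"
  assumes "integrable M f" "integrable M g" "\<And>x. norm (f x) \<le> g x"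
  shows "norm (\<integral>x. f x \<partial>M) \<le> (\<integral>x. g x \<partial>M)"
  by (rule order_trans[OF integral_norm_bound integral_mono]) (use assms in auto)

text \<open>A cylinder function does not change when the irrelevant coordinates are set to 0. This
  modification is measurable from the finite product into the Borel sets of the product topology
  of all sequences.\<close>

lemma cylinder_measurable:
  fixes f :: seq_fun
  assumes "cylinder d f" "continuous_on UNIV f"
  shows "f \<in> borel_measurable (leb d)"
proof -
  let ?r = "\<lambda>x i. if i < d then x i else 0 :: real"
  have "?r \<in> borel_measurable (leb d)"
  proof (rule measurable_coordinatewise_then_product)
    fix i show "(\<lambda>x. ?r x i) \<in> borel_measurable (leb d)"
      by (cases "i < d") (auto intro: measurable_component_singleton)
  qed
  then have "(\<lambda>x. f (?r x)) \<in> borel_measurable (leb d)"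
    using borel_measurable_continuous_onI[OF assms(2)] by (rule measurable_compose)
  moreover have "f (?r x) = f x" for x using assms(1) unfolding cylinder_def by simp
  ultimately show ?thesis by simp
qed

lemma hprod_cylinder: "cylinder d (\<lambda>x. complex_of_real (hprod d \<gamma> x))"
  unfolding cylinder_def using hprod_cong by (metis (full_types))

lemma hprod_measurable [measurable]: "hprod d \<gamma> \<in> borel_measurable (leb d)"
  unfolding hprod_def[abs_def] by (auto intro!: borel_measurable_prod measurable_compose[OF measurable_component_singleton])

lemma decay_weight_pos: "decay_weight d x > 0"
  unfolding decay_weight_def by (intro prod_pos) (auto simp: add_pos_nonneg)

lemma decay_weight_le: "i < d \<Longrightarrow> decay_weight d x \<le> 1 / (1 + (x i)\<^sup>2)"
proof -
  assume i: "i < d"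
  have "decay_weight d x = 1 / (1 + (x i)\<^sup>2) * (\<Prod>j\<in>{..<d} - {i}. 1 / (1 + (x j)\<^sup>2))"
    unfolding decay_weight_def using i by (intro prod.remove) auto
  also have "\<dots> \<le> 1 / (1 + (x i)\<^sup>2) * 1"
    by (intro mult_left_mono prod_le_1) (auto simp: field_simps add_pos_nonneg)
  finally show ?thesis by simp
qed

lemma decay_weight_integrable: "integrable (leb d) (decay_weight d)"
  unfolding decay_weight_def[abs_def]
  by (intro lborel_product.product_integrable_prod integrable_inverse_1_plus_sq) auto

lemma quad_decayD:
  assumes "f \<in> quad_decay d"
  shows "cylinder d f" "continuous_on UNIV f" "f \<in> borel_measurable (leb d)"
    "\<exists>C\<ge>0. \<forall>x. norm (f x) \<le> C * decay_weight d x"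
proof -
  show "cylinder d f" "continuous_on UNIV f" using assms unfolding quad_decay_def by auto
  then show "f \<in> borel_measurable (leb d)" by (rule cylinder_measurable)
  obtain C where C: "\<And>x. norm (f x) \<le> C * decay_weight d x" using assms unfolding quad_decay_def by auto
  have "norm (f x) \<le> max C 0 * decay_weight d x" for x
    by (rule order_trans[OF C]) (intro mult_right_mono, auto simp: decay_weight_pos less_imp_le)
  then show "\<exists>C\<ge>0. \<forall>x. norm (f x) \<le> C * decay_weight d x" by (intro exI[of _ "max C 0"]) auto
qed

lemma quad_decay_integrable:
  assumes "f \<in> quad_decay d" shows "integrable (leb d) f"
proof -
  obtain C where C: "C \<ge> 0" "\<And>x. norm (f x) \<le> C * decay_weight d x" using quad_decayD(4)[OF assms] by auto
  show ?thesis
  proof (rule Bochner_Integration.integrable_bound)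
    show "integrable (leb d) (\<lambda>x. C * decay_weight d x)" using decay_weight_integrable by simp
    show "AE x in leb d. norm (f x) \<le> norm (C * decay_weight d x)"
      using C decay_weight_pos by (intro AE_I2) (simp add: abs_of_nonneg less_imp_le)
  qed (rule quad_decayD(3)[OF assms])
qed

lemma quad_decay_mult_bounded:
  assumes f: "f \<in> quad_decay d" and "cylinder d g" "continuous_on UNIV g" "\<And>x. norm (g x) \<le> B"
  shows "(\<lambda>x. f x * g x) \<in> quad_decay d"
proof -
  obtain C where C: "C \<ge> 0" "\<And>x. norm (f x) \<le> C * decay_weight d x" using quad_decayD(4)[OF f] by auto
  have "norm (f x * g x) \<le> (C * B) * decay_weight d x" for x
  proof -
    have "norm (f x * g x) \<le> (C * decay_weight d x) * B"
      unfolding norm_mult using C(1) decay_weight_pos[of d x] by (intro mult_mono C assms) auto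
    then show ?thesis by (simp add: algebra_simps)
  qed
  moreover have "cylinder d (\<lambda>x. f x * g x)" using quad_decayD(1)[OF f] assms(2) unfolding cylinder_def by metis
  moreover have "continuous_on UNIV (\<lambda>x. f x * g x)" using quad_decayD(2)[OF f] assms(3) by (intro continuous_intros)
  ultimately show ?thesis unfolding quad_decay_def by blast
qed

lemma quad_decay_times_hprod:
  assumes "f \<in> quad_decay d" shows "(\<lambda>x. f x * of_real (hprod d \<gamma> x)) \<in> quad_decay d"
proof (rule quad_decay_mult_bounded[OF assms hprod_cylinder, where B = "hbound d \<gamma>"])
  show "continuous_on UNIV (\<lambda>x. complex_of_real (hprod d \<gamma> x))"
    using hprod_continuous by (intro continuous_intros)
qed (use hprod_bound in simp)

lemma integrable_times_hprod:
  assumes "f \<in> quad_decay d" shows "integrable (leb d) (\<lambda>x. f x * of_real (hprod d \<gamma> x))"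
  by (rule quad_decay_integrable[OF quad_decay_times_hprod[OF assms]])

lemma coef_norm_le:
  assumes "integrable (leb d) f"
  shows "norm (coef d f \<gamma>) \<le> hbound d \<gamma> * (\<integral>x. norm (f x) \<partial>leb d)"
proof -
  have "norm (coef d f \<gamma>) \<le> (\<integral>x. hbound d \<gamma> * norm (f x) \<partial>leb d)"
    unfolding coef_def
  proof (rule integral_norm_le)
    show "integrable (leb d) (\<lambda>x. f x * of_real (hprod d \<gamma> x))"
      using assms hprod_bound by (intro integrable_times_bounded[where C = "hbound d \<gamma>"]) auto
    show "norm (f x * of_real (hprod d \<gamma> x)) \<le> hbound d \<gamma> * norm (f x)" for x
      using mult_left_mono[OF hprod_bound[of d \<gamma> x], of "norm (f x)"] by (simp add: norm_mult mult.commute)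
  qed (use assms in simp)
  then show ?thesis by simp
qed

lemma leb_integral_split:
  fixes f :: seq_fun
  assumes i: "i < d" and f: "integrable (leb d) f"
  shows "(\<integral>x. f x \<partial>leb d) = (\<integral>x. (\<integral>t. f (x(i := t)) \<partial>lborel) \<partial>Pi\<^sub>M ({..<d} - {i}) (\<lambda>_. lborel))"
proof -
  have e: "insert i ({..<d} - {i}) = {..<d}" using i by auto
  show ?thesis
    using lborel_product.product_integral_insert[of "{..<d} - {i}" i f, unfolded e] f by simp
qed

lemma coef_mult:
  assumes f: "f \<in> quad_decay d" and i: "i < d"
  shows "coef d (\<lambda>x. of_real (x i) * f x) \<gamma> = ladder (\<gamma> i) * coef d f (\<gamma>(i := \<gamma> i - 1))
           + ladder (Suc (\<gamma> i)) * coef d f (\<gamma>(i := Suc (\<gamma> i)))"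
proof -
  have "of_real (x i) * f x * of_real (hprod d \<gamma> x)
      = of_real (ladder (\<gamma> i)) * (f x * of_real (hprod d (\<gamma>(i := \<gamma> i - 1)) x))
      + of_real (ladder (Suc (\<gamma> i))) * (f x * of_real (hprod d (\<gamma>(i := Suc (\<gamma> i))) x))" for x
  proof -
    have "of_real (x i) * f x * of_real (hprod d \<gamma> x) = f x * of_real (x i * hprod d \<gamma> x)" by simp
    then show ?thesis unfolding hprod_mult[OF i] by (simp add: algebra_simps)
  qed
  then show ?thesis unfolding coef_def
    by (simp add: integrable_times_hprod[OF f])
qed

lemma pdiff_has_vector_derivative:
  assumes "\<And>x. (\<lambda>t. f (x(i := t))) differentiable (at (x i))"
  shows "((\<lambda>s. f (x(i := s))) has_vector_derivative pdiff i f (x(i := t))) (at t)"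
  using assms[of "x(i := t)"] unfolding pdiff_def by (simp add: vector_derivative_works)

text \<open>Integration by parts in the variable i.\<close>

lemma coef_pdiff:
  assumes f: "f \<in> quad_decay d" and i: "i < d" and g: "pdiff i f \<in> quad_decay d"
    and D: "\<And>x. (\<lambda>t. f (x(i := t))) differentiable (at (x i))"
  shows "coef d (pdiff i f) \<gamma> = ladder (Suc (\<gamma> i)) * coef d f (\<gamma>(i := Suc (\<gamma> i)))
           - ladder (\<gamma> i) * coef d f (\<gamma>(i := \<gamma> i - 1))"
proof -
  let ?h' = "\<lambda>x. ladder (\<gamma> i) * hprod d (\<gamma>(i := \<gamma> i - 1)) x
      - ladder (Suc (\<gamma> i)) * hprod d (\<gamma>(i := Suc (\<gamma> i))) x"
  let ?F = "\<lambda>x. pdiff i f x * of_real (hprod d \<gamma> x) + f x * of_real (?h' x)"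
  have F_eq: "?F = (\<lambda>x. pdiff i f x * of_real (hprod d \<gamma> x) +
      (of_real (ladder (\<gamma> i)) * (f x * of_real (hprod d (\<gamma>(i := \<gamma> i - 1)) x)) -
       of_real (ladder (Suc (\<gamma> i))) * (f x * of_real (hprod d (\<gamma>(i := Suc (\<gamma> i))) x))))"
    by (auto simp: algebra_simps)
  have int: "integrable (leb d) ?F" unfolding F_eq by (simp add: integrable_times_hprod f g)
  obtain C where C: "C \<ge> 0" "\<And>x. norm (f x) \<le> C * decay_weight d x" using quad_decayD(4)[OF f] by auto
  obtain C' where C': "C' \<ge> 0" "\<And>x. norm (pdiff i f x) \<le> C' * decay_weight d x" using quad_decayD(4)[OF g] by auto
  have dw: "decay_weight d (x(i := t)) \<le> 1 / (1 + t\<^sup>2)" for x t using decay_weight_le[OF i, of "x(i := t)"] by simp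
  have bd: "norm (u * v) \<le> (K * B) / (1 + t\<^sup>2)"
    if "norm u \<le> K * decay_weight d (x(i := t))" "norm v \<le> B" "K \<ge> 0" for u v :: complex and K B x t
  proof -
    have "norm (u * v) \<le> (K * (1 / (1 + t\<^sup>2))) * B"
      unfolding norm_mult using that dw[of x t] order_trans[OF norm_ge_zero that(2)]
      by (intro mult_mono order_trans[OF that(1)] mult_left_mono) auto
    then show ?thesis by simp
  qed
  define B' where "B' = ladder (\<gamma> i) * hbound d (\<gamma>(i := \<gamma> i - 1)) + ladder (Suc (\<gamma> i)) * hbound d (\<gamma>(i := Suc (\<gamma> i)))"
  have h'b: "norm (complex_of_real (?h' x)) \<le> B'" for x
    unfolding norm_of_real B'_def
    by (rule order_trans[OF abs_triangle_ineq4]) (simp add: abs_mult add_mono mult_left_mono hprod_bound)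
  have "(\<integral>t. ?F (x(i := t)) \<partial>lborel) = 0" for x
  proof (rule integral_derivative_zero)
    show "((\<lambda>t. f (x(i := t)) * of_real (hprod d \<gamma> (x(i := t)))) has_vector_derivative ?F (x(i := t))) (at t)" for t
    proof -
      have "((\<lambda>t. complex_of_real (hprod d \<gamma> (x(i := t)))) has_vector_derivative of_real (?h' (x(i := t)))) (at t)"
        using hprod_deriv[OF i, of \<gamma> x t]
        by (intro has_vector_derivative_of_real) (simp add: has_real_derivative_iff_has_vector_derivative)
      from has_vector_derivative_mult[OF pdiff_has_vector_derivative[where f = f and i = i and x = x and t = t, OF D] this]
      show ?thesis by (simp add: add.commute)
    qed
    have "continuous_on UNIV ?F"
      by (intro continuous_intros quad_decayD(2)[OF f] quad_decayD(2)[OF g] hprod_continuous)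
    then show "continuous_on UNIV (\<lambda>t. ?F (x(i := t)))"
      by (rule continuous_on_compose2[OF _ continuous_on_upd_value]) auto
    show "norm (f (x(i := t)) * of_real (hprod d \<gamma> (x(i := t)))) \<le> (C * hbound d \<gamma>) / (1 + t\<^sup>2)" for t
      using C hprod_bound by (intro bd) auto
    show "norm (?F (x(i := t))) \<le> (C' * hbound d \<gamma> + C * B') / (1 + t\<^sup>2)" for t
      unfolding add_divide_distrib
    proof (rule order_trans[OF norm_triangle_ineq], rule add_mono)
      show "norm (pdiff i f (x(i := t)) * of_real (hprod d \<gamma> (x(i := t)))) \<le> C' * hbound d \<gamma> / (1 + t\<^sup>2)"
        using C' hprod_bound by (intro bd) auto
      show "norm (f (x(i := t)) * of_real (?h' (x(i := t)))) \<le> C * B' / (1 + t\<^sup>2)"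
        using C h'b by (intro bd) auto
    qed
  qed
  then have "(\<integral>x. ?F x \<partial>leb d) = 0"
    unfolding leb_integral_split[OF i int] by simp
  moreover have "A + (B - C) = 0 \<Longrightarrow> A = C - B" for A B C :: complex
    by (simp add: algebra_simps add_eq_0_iff)
  ultimately show ?thesis unfolding F_eq coef_def
    by (simp add: integrable_times_hprod f g)
qed

subsection \<open>Completeness\<close>

text \<open>The coefficient with respect to the last variable is again a function of the same kind, in the
  other variables; its continuity is dominated convergence.\<close>

lemma quad_decay_slice:
  assumes f: "f \<in> quad_decay (Suc d)"
  shows "(\<lambda>x. \<integral>t. f (x(d := t)) * of_real (hfun n t) \<partial>lborel) \<in> quad_decay d" (is "?G \<in> _")
proof -
  obtain C where C: "C \<ge> 0" "\<And>x. norm (f x) \<le> C * decay_weight (Suc d) x" using quad_decayD(4)[OF f] by auto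
  obtain B where B: "\<And>t. \<bar>hfun n t\<bar> \<le> B" using hfun_bounded_all by blast
  have dw: "decay_weight (Suc d) (x(d := t)) = decay_weight d x * (1 / (1 + t\<^sup>2))" for x t
    unfolding decay_weight_def by (simp del: power2_abs) 
  have b: "norm (f (x(d := t)) * of_real (hfun n t)) \<le> C * decay_weight d x * B * (1 / (1 + t\<^sup>2))" for x t
  proof -
    have "norm (f (x(d := t)) * of_real (hfun n t)) \<le> (C * decay_weight (Suc d) (x(d := t))) * B"
      unfolding norm_mult using C decay_weight_pos[of "Suc d" "x(d:=t)"] B by (intro mult_mono) auto
    then show ?thesis unfolding dw by (simp add: algebra_simps)
  qed
  have fc: "continuous_on UNIV (\<lambda>t. f (x(d := t)))" for x
    by (rule continuous_on_compose2[OF quad_decayD(2)[OF f] continuous_on_upd_value]) auto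
  have [measurable]: "(\<lambda>t. f (x(d := t))) \<in> borel_measurable borel" for x
    by (rule borel_measurable_continuous_onI[OF fc])
  have B0: "B \<ge> 0" using B[of 0] by linarith
  have dw1: "decay_weight d x \<le> 1" for x unfolding decay_weight_def
    by (intro prod_le_1) (auto simp: field_simps add_pos_nonneg)
  have "cylinder d ?G" unfolding cylinder_def
  proof (intro allI impI)
    fix x y :: "nat \<Rightarrow> real" assume "\<forall>i<d. x i = y i"
    then have "f (x(d := t)) = f (y(d := t))" for t
      using quad_decayD(1)[OF f] unfolding cylinder_def by (auto simp: less_Suc_eq)
    then show "?G x = ?G y" by simp
  qed
  moreover have "continuous_on UNIV ?G" unfolding continuous_on_sequentially
  proof (intro allI ballI impI, elim conjE)
    fix xs :: "nat \<Rightarrow> nat \<Rightarrow> real" and x assume "xs \<longlonglongrightarrow> x"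
    have "((\<lambda>k. ?G (xs k)) \<longlonglongrightarrow> ?G x)"
    proof (rule integral_dominated_convergence)
      show "integrable lborel (\<lambda>t::real. C * B * (1 / (1 + t\<^sup>2)))"
        using integrable_inverse_1_plus_sq by (rule integrable_mult_right)
      show "AE t in lborel. (\<lambda>k. f ((xs k)(d := t)) * of_real (hfun n t)) \<longlonglongrightarrow> f (x(d := t)) * of_real (hfun n t)"
      proof (intro AE_I2 tendsto_mult tendsto_const)
        fix t
        have "continuous_on UNIV (\<lambda>x. f (x(d := t)))"
          by (rule continuous_on_compose2[OF quad_decayD(2)[OF f] continuous_on_upd_pt]) auto
        then show "(\<lambda>k. f ((xs k)(d := t))) \<longlonglongrightarrow> f (x(d := t))"
          using \<open>xs \<longlonglongrightarrow> x\<close> unfolding continuous_on_sequentially by (auto simp: comp_def)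
      qed
      show "AE t in lborel. norm (f ((xs k)(d := t)) * of_real (hfun n t)) \<le> C * B * (1 / (1 + t\<^sup>2))" for k
      proof (rule AE_I2)
        fix t
        have "C * decay_weight d (xs k) * B * (1 / (1 + t\<^sup>2)) \<le> C * 1 * B * (1 / (1 + t\<^sup>2))"
          using C B0 dw1 by (intro mult_right_mono mult_left_mono) auto
        with b[of "xs k" t] show "norm (f ((xs k)(d := t)) * of_real (hfun n t)) \<le> C * B * (1 / (1 + t\<^sup>2))" by simp
      qed
    qed auto
    then show "(?G \<circ> xs) \<longlonglongrightarrow> ?G x" by (simp add: comp_def)
  qed
  moreover have "norm (?G x) \<le> C * B * (\<integral>t. 1 / (1 + t\<^sup>2) \<partial>lborel) * decay_weight d x" for x
  proof -
    have "norm (?G x) \<le> (\<integral>t. C * decay_weight d x * B * (1 / (1 + t\<^sup>2)) \<partial>lborel)"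
    proof (rule integral_norm_le)
      show i2: "integrable lborel (\<lambda>t::real. C * decay_weight d x * B * (1 / (1 + t\<^sup>2)))"
        using integrable_inverse_1_plus_sq by (rule integrable_mult_right)
      show "integrable lborel (\<lambda>t. f (x(d := t)) * of_real (hfun n t))"
        by (rule Bochner_Integration.integrable_bound[OF i2])
           (use b in \<open>auto intro!: AE_I2 intro: order_trans[OF _ abs_ge_self] simp del: times_divide_eq_right\<close>)
    qed (use b in auto)
    also have "\<dots> = C * decay_weight d x * B * (\<integral>t. 1 / (1 + t\<^sup>2) \<partial>lborel)"
      by (rule integral_mult_right_zero)
    finally show ?thesis by (simp add: ac_simps)
  qed
  ultimately show ?thesis unfolding quad_decay_def by blast
qed

text \<open>The coefficients of f with respect to the last variable are functions of d variables with
  vanishing coefficients, so they vanish by induction. Now the one-dimensional result applies on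
  every line in the direction of the last variable.\<close>

lemma coef_complete:
  assumes "f \<in> quad_decay d" "\<And>\<gamma>. coef d f \<gamma> = 0"
  shows "f x = 0"
  using assms
proof (induction d arbitrary: f x)
  case 0
  have "f y = f x" for y using quad_decayD(1)[OF 0(1)] unfolding cylinder_def by auto
  then have c: "f = (\<lambda>_. f x)" by auto
  interpret finite_measure "leb 0" by rule (simp add: space_PiM PiM_empty)
  have "coef 0 f (\<lambda>_. 0) = f x"
    unfolding coef_def hprod_def by (subst c) (simp add: measure_def PiM_empty)
  then show ?case using 0 by simp
next
  case (Suc d)
  let ?G = "\<lambda>n x. \<integral>t. f (x(d := t)) * of_real (hfun n t) \<partial>lborel"
  have G: "?G n x = 0" for n x
  proof (rule Suc.IH)
    show "?G n \<in> quad_decay d" by (rule quad_decay_slice[OF Suc.prems(1)])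
    fix \<gamma>
    have "coef (Suc d) f (\<gamma>(d := n)) = (\<integral>x. \<integral>t. f (x(d := t)) * of_real (hprod (Suc d) (\<gamma>(d := n)) (x(d := t))) \<partial>lborel \<partial>leb d)"
      unfolding coef_def lessThan_Suc
      by (rule lborel_product.product_integral_insert)
         (use integrable_times_hprod[OF Suc.prems(1)] in \<open>simp_all add: lessThan_Suc\<close>)
    also have "\<dots> = (\<integral>x. ?G n x * of_real (hprod d \<gamma> x) \<partial>leb d)"
    proof (intro Bochner_Integration.integral_cong refl)
      fix x
      have "hprod (Suc d) (\<gamma>(d := n)) (x(d := t)) = hfun n t * hprod d \<gamma> x" for t
        unfolding hprod_def by (simp add: mult.commute)
      then have "(\<integral>t. f (x(d := t)) * of_real (hprod (Suc d) (\<gamma>(d := n)) (x(d := t))) \<partial>lborel)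
         = (\<integral>t. (f (x(d := t)) * of_real (hfun n t)) * of_real (hprod d \<gamma> x) \<partial>lborel)"
        by (simp add: mult.assoc)
      also have "\<dots> = ?G n x * of_real (hprod d \<gamma> x)" by (rule integral_mult_left_zero)
      finally show "(\<integral>t. f (x(d := t)) * of_real (hprod (Suc d) (\<gamma>(d := n)) (x(d := t))) \<partial>lborel)
         = ?G n x * of_real (hprod d \<gamma> x)" .
    qed
    finally show "coef d (?G n) \<gamma> = 0" using Suc.prems(2) unfolding coef_def[of d] by simp
  qed
  obtain C where C: "C \<ge> 0" "\<And>x. norm (f x) \<le> C * decay_weight (Suc d) x" using quad_decayD(4)[OF Suc.prems(1)] by auto
  have "f (x(d := x d)) = 0"
  proof (rule hfun_complete[where g = "\<lambda>t. f (x(d := t))" and C = C])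
    show "continuous_on UNIV (\<lambda>t. f (x(d := t)))"
      by (rule continuous_on_compose2[OF quad_decayD(2)[OF Suc.prems(1)] continuous_on_upd_value]) auto
    show "norm (f (x(d := t))) \<le> C / (1 + t\<^sup>2)" for t
      using order_trans[OF C(2) mult_left_mono[OF decay_weight_le[of d "Suc d" "x(d := t)"] C(1)]] by simp
  qed (rule G)
  then show ?case by simp
qed

lemma hprod_orthonormal:
  "(\<integral>x. hprod d \<alpha> x * hprod d \<beta> x \<partial>leb d) = (if \<forall>i<d. \<alpha> i = \<beta> i then 1 else 0)"
proof -
  have "(\<integral>x. hprod d \<alpha> x * hprod d \<beta> x \<partial>leb d) = (\<integral>x. (\<Prod>i<d. hfun (\<alpha> i) (x i) * hfun (\<beta> i) (x i)) \<partial>leb d)"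
    unfolding hprod_def by (simp add: prod.distrib)
  also have "\<dots> = (\<Prod>i<d. \<integral>t. hfun (\<alpha> i) t * hfun (\<beta> i) t \<partial>lborel)"
    by (rule lborel_product.product_integral_prod) auto
  also have "\<dots> = (if \<forall>i<d. \<alpha> i = \<beta> i then 1 else 0)"
    unfolding hfun_orthonormal by auto
  finally show ?thesis .
qed

lemma hprod_quad_decay: "(\<lambda>x. complex_of_real (hprod d \<gamma> x)) \<in> quad_decay d"
proof -
  obtain C where C: "\<And>n t. \<bar>hfun n t\<bar> \<le> C n / (1 + t\<^sup>2)" using hfun_le_inverse by metis
  have "norm (complex_of_real (hprod d \<gamma> x)) \<le> (\<Prod>i<d. C (\<gamma> i)) * decay_weight d x" for x
    unfolding norm_of_real hprod_def decay_weight_def abs_prod prod.distrib[symmetric]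
    by (intro prod_mono) (use C in auto)
  then show ?thesis unfolding quad_decay_def using hprod_cylinder hprod_continuous
    by (auto intro!: continuous_intros)
qed

lemma coef_hprod: "coef d (\<lambda>x. of_real (hprod d \<alpha> x)) \<beta> = (if \<forall>i<d. \<alpha> i = \<beta> i then 1 else 0)"
proof -
  have "coef d (\<lambda>x. of_real (hprod d \<alpha> x)) \<beta> = of_real (\<integral>x. hprod d \<alpha> x * hprod d \<beta> x \<partial>leb d)"
    unfolding coef_def by (simp add: of_real_mult[symmetric] del: of_real_mult)
  then show ?thesis unfolding hprod_orthonormal by simp
qed

subsection \<open>The Hermite functions are products\<close>

text \<open>The n-th derivative of \<open>exp (- t^2)\<close>.\<close>

definition gauss_deriv :: "nat \<Rightarrow> real \<Rightarrow> real" where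
  "gauss_deriv n t = pi powr (1 / 4) * (- 1) ^ n * sqrt (2 ^ n * fact n) * (exp (- t\<^sup>2 / 2) * hfun n t)"

lemma gauss_deriv_has_derivative: "(gauss_deriv n has_real_derivative gauss_deriv (Suc n) t) (at t)"
proof -
  have "((\<lambda>t. exp (- t\<^sup>2 / 2) * hfun n t) has_real_derivative
     (- t * exp (- t\<^sup>2 / 2)) * hfun n t + hfun' n t * exp (- t\<^sup>2 / 2)) (at t)"
    by (rule DERIV_mult[OF _ hfun_deriv]) (auto intro!: derivative_eq_intros)
  also have "(- t * exp (- t\<^sup>2 / 2)) * hfun n t + hfun' n t * exp (- t\<^sup>2 / 2)
     = exp (- t\<^sup>2 / 2) * (hfun' n t - t * hfun n t)" by (simp add: algebra_simps)
  also have "\<dots> = - (2 * ladder (Suc n)) * (exp (- t\<^sup>2 / 2) * hfun (Suc n) t)"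
    unfolding hfun_mult by (simp add: algebra_simps)
  also have "2 * ladder (Suc n) = sqrt (2 * Suc n)"
    unfolding ladder_def by (rule real_sqrt_unique[symmetric]) (auto simp: power_mult_distrib)
  finally have "((\<lambda>t. exp (- t\<^sup>2 / 2) * hfun n t) has_real_derivative
     - sqrt (2 * Suc n) * (exp (- t\<^sup>2 / 2) * hfun (Suc n) t)) (at t)" .
  from DERIV_cmult[OF this, of "pi powr (1 / 4) * (- 1) ^ n * sqrt (2 ^ n * fact n)"]
  have D: "(gauss_deriv n has_real_derivative pi powr (1 / 4) * (- 1) ^ n * sqrt (2 ^ n * fact n) *
       (- sqrt (2 * Suc n) * (exp (- t\<^sup>2 / 2) * hfun (Suc n) t))) (at t)"
    unfolding gauss_deriv_def[abs_def] .
  have "sqrt (2 ^ Suc n * fact (Suc n)) = sqrt (2 ^ n * fact n) * sqrt (2 * Suc n)"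
    by (simp add: real_sqrt_mult[symmetric] algebra_simps)
  then have "gauss_deriv (Suc n) t = pi powr (1 / 4) * (- 1) ^ n * sqrt (2 ^ n * fact n) *
       (- sqrt (2 * Suc n) * (exp (- t\<^sup>2 / 2) * hfun (Suc n) t))"
    unfolding gauss_deriv_def by simp
  with D show ?thesis by simp
qed

lemma gauss_deriv_0: "gauss_deriv 0 t = exp (- t\<^sup>2)"
proof -
  have "pi powr (1 / 4) * pi powr (- 1 / 4) = 1" by (simp add: powr_minus)
  moreover have "exp (- t\<^sup>2 / 2) * exp (- t\<^sup>2 / 2) = exp (- t\<^sup>2)" by (simp add: mult_exp_exp)
  moreover have "gauss_deriv 0 t = (pi powr (1 / 4) * pi powr (- 1 / 4)) * (exp (- t\<^sup>2 / 2) * exp (- t\<^sup>2 / 2))"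
    unfolding gauss_deriv_def by (simp add: ac_simps)
  ultimately show ?thesis by simp
qed

definition gauss_prod :: "nat \<Rightarrow> (nat \<Rightarrow> nat) \<Rightarrow> seq_fun" where
  "gauss_prod d \<beta> = (\<lambda>x. of_real (\<Prod>i<d. gauss_deriv (\<beta> i) (x i)))"

lemma pdiff_gauss_prod:
  assumes "i < d" shows "pdiff i (gauss_prod d \<beta>) = gauss_prod d (\<beta>(i := Suc (\<beta> i)))"
proof
  fix x
  let ?r = "\<Prod>j\<in>{..<d} - {i}. gauss_deriv (\<beta> j) (x j)"
  have e: "(\<Prod>j<d. gauss_deriv (\<beta>' j) (x' j)) = gauss_deriv (\<beta>' i) (x' i) * ?r"
    if "\<And>j. j \<noteq> i \<Longrightarrow> \<beta>' j = \<beta> j" "\<And>j. j \<noteq> i \<Longrightarrow> x' j = x j" for \<beta>' x'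
    using prod.remove[of "{..<d}" i "\<lambda>j. gauss_deriv (\<beta>' j) (x' j)"] assms that by simp
  have "((\<lambda>t. gauss_prod d \<beta> (x(i := t))) has_vector_derivative gauss_prod d (\<beta>(i := Suc (\<beta> i))) x) (at (x i))"
    unfolding gauss_prod_def
    apply (subst e, simp, simp, subst e, simp, simp)
    using DERIV_cmult_right[OF gauss_deriv_has_derivative[of "\<beta> i" "x i"], of ?r]
    by (intro has_vector_derivative_of_real) (simp add: has_real_derivative_iff_has_vector_derivative)
  then show "pdiff i (gauss_prod d \<beta>) x = gauss_prod d (\<beta>(i := Suc (\<beta> i))) x"
    unfolding pdiff_def by (rule vector_derivative_at)
qed

lemma pdiff_pow_gauss_prod:
  "i < d \<Longrightarrow> (pdiff i ^^ k) (gauss_prod d \<beta>) = gauss_prod d (\<beta>(i := \<beta> i + k))"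
  by (induction k) (simp_all add: pdiff_gauss_prod)

lemma mdiff_gauss: "mdiff d \<alpha> (gauss_prod d (\<lambda>_. 0)) = gauss_prod d \<alpha>"
proof -
  have "set is \<subseteq> {..<d} \<Longrightarrow> distinct is \<Longrightarrow>
     foldr (\<lambda>i. pdiff i ^^ \<alpha> i) is (gauss_prod d (\<lambda>_. 0)) = gauss_prod d (\<lambda>i. if i \<in> set is then \<alpha> i else 0)" for "is"
  proof (induction "is")
    case (Cons a "is")
    have "(\<lambda>i. if i \<in> set is then \<alpha> i else 0)(a := (if a \<in> set is then \<alpha> a else 0) + \<alpha> a)
       = (\<lambda>i. if i \<in> set (a # is) then \<alpha> i else 0)" using Cons by auto
    then show ?case using Cons by (simp add: pdiff_pow_gauss_prod)
  qed simp
  from this[of "[0..<d]"] have "mdiff d \<alpha> (gauss_prod d (\<lambda>_. 0)) = gauss_prod d (\<lambda>i. if i \<in> set [0..<d] then \<alpha> i else 0)"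
    unfolding mdiff_def by (simp add: atLeast0LessThan)
  also have "\<dots> = gauss_prod d \<alpha>"
    unfolding gauss_prod_def by (intro ext arg_cong[where f = of_real] prod.cong) auto
  finally show ?thesis .
qed

lemma hermite_eq: "hermite d \<alpha> = (\<lambda>x. of_real (hprod d \<alpha> x))"
proof
  fix x :: "nat \<Rightarrow> real"
  have g: "(\<lambda>y. complex_of_real (exp (- (\<Sum>i<d. (y i)\<^sup>2)))) = gauss_prod d (\<lambda>_. 0)"
    unfolding gauss_prod_def gauss_deriv_0 by (auto simp: exp_sum[symmetric] sum_negf)
  have p1: "pi powr (- real d / 4) = (\<Prod>i<d. pi powr (- 1 / 4))"
    by (simp add: powr_realpow[symmetric] powr_powr)
  have p2: "(2 ^ mlen d \<alpha> * mfact d \<alpha>) powr (- (1/2)) = (\<Prod>i<d. (2 ^ \<alpha> i * fact (\<alpha> i)) powr (- (1/2)))"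
    unfolding mlen_def mfact_def power_sum prod.distrib[symmetric]
    by (rule prod_powr_distrib)
  have p3: "exp ((\<Sum>i<d. (x i)\<^sup>2) / 2) = (\<Prod>i<d. exp ((x i)\<^sup>2 / 2))"
    unfolding sum_divide_distrib by (rule exp_sum) auto
  have f: "pi powr (- 1 / 4) * (- 1) ^ n * (2 ^ n * fact n) powr (- (1/2)) * exp (t\<^sup>2 / 2) * gauss_deriv n t
      = hfun n t" for n and t :: real
  proof -
    have a: "pi powr (- 1 / 4) * pi powr (1 / 4) = 1" by (simp add: powr_minus)
    have b: "(- 1) ^ n * (- 1) ^ n = (1 :: real)" by (simp add: power_mult_distrib[symmetric])
    have c: "((2 ^ n * fact n) :: real) powr (- (1/2)) * sqrt (2 ^ n * fact n) = 1"
      by (simp add: powr_minus powr_half_sqrt)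
    have e: "exp (t\<^sup>2 / 2) * exp (- t\<^sup>2 / 2) = 1" by (simp add: mult_exp_exp)
    have "pi powr (- 1 / 4) * (- 1) ^ n * (2 ^ n * fact n) powr (- (1/2)) * exp (t\<^sup>2 / 2) * gauss_deriv n t
      = (pi powr (- 1 / 4) * pi powr (1 / 4)) * ((- 1) ^ n * (- 1) ^ n) *
        ((2 ^ n * fact n) powr (- (1/2)) * sqrt (2 ^ n * fact n)) * (exp (t\<^sup>2 / 2) * exp (- t\<^sup>2 / 2)) * hfun n t"
      unfolding gauss_deriv_def by (simp only: ac_simps)
    then show ?thesis unfolding a b c e by simp
  qed
  have "hermite d \<alpha> x = of_real ((\<Prod>i<d. pi powr (- 1 / 4) * (- 1) ^ \<alpha> i * (2 ^ \<alpha> i * fact (\<alpha> i)) powr (- (1/2))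
      * exp ((x i)\<^sup>2 / 2) * gauss_deriv (\<alpha> i) (x i)))"
    unfolding hermite_def g mdiff_gauss
    unfolding gauss_prod_def p1 p2 p3 of_real_mult[symmetric] prod.distrib
    unfolding mlen_def power_sum by simp
  then show "hermite d \<alpha> x = of_real (hprod d \<alpha> x)" unfolding f hprod_def .
qed

section \<open>Hermite series\<close>

subsection \<open>Multi-indices\<close>

text \<open>The multi-indices of R^d are represented by sequences that vanish from position d on, so that
  each is counted once in a sum. With this normalisation \<open>mi m \<subseteq> mi n\<close> for \<open>m \<le> n\<close>.\<close>

definition mi :: "nat \<Rightarrow> (nat \<Rightarrow> nat) set" where
  "mi d = {\<gamma>. \<forall>i\<ge>d. \<gamma> i = 0}"

definition mi_append :: "nat \<Rightarrow> (nat \<Rightarrow> nat) \<Rightarrow> (nat \<Rightarrow> nat) \<Rightarrow> nat \<Rightarrow> nat" where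
  "mi_append n \<alpha> \<beta> = (\<lambda>i. if i < n then \<alpha> i else \<beta> (i - n))"

definition mi_take :: "nat \<Rightarrow> (nat \<Rightarrow> nat) \<Rightarrow> nat \<Rightarrow> nat" where
  "mi_take n \<gamma> = (\<lambda>i. if i < n then \<gamma> i else 0)"

definition mi_drop :: "nat \<Rightarrow> (nat \<Rightarrow> nat) \<Rightarrow> nat \<Rightarrow> nat" where
  "mi_drop n \<gamma> = (\<lambda>i. \<gamma> (i + n))"

lemma mi_take_in [simp]: "mi_take d \<gamma> \<in> mi d"
  by (simp add: mi_def mi_take_def)

lemma mi_drop_in: "\<gamma> \<in> mi (n + m) \<Longrightarrow> mi_drop n \<gamma> \<in> mi m"
  by (simp add: mi_def mi_drop_def)

lemma mi_append_in: "\<beta> \<in> mi m \<Longrightarrow> mi_append n \<alpha> \<beta> \<in> mi (n + m)"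
  by (simp add: mi_def mi_append_def)

lemma mi_take_append: "\<alpha> \<in> mi n \<Longrightarrow> mi_take n (mi_append n \<alpha> \<beta>) = \<alpha>"
  by (auto simp: mi_def mi_append_def mi_take_def)

lemma mi_drop_append [simp]: "mi_drop n (mi_append n \<alpha> \<beta>) = \<beta>"
  by (auto simp: mi_append_def mi_drop_def)

lemma mi_append_take_drop [simp]: "mi_append n (mi_take n \<gamma>) (mi_drop n \<gamma>) = \<gamma>"
  by (auto simp: mi_append_def mi_drop_def mi_take_def)

lemma bij_mi_append: "bij_betw (\<lambda>(\<alpha>, \<beta>). mi_append n \<alpha> \<beta>) (mi n \<times> mi m) (mi (n + m))"
  by (rule bij_betw_byWitness[where f' = "\<lambda>\<gamma>. (mi_take n \<gamma>, mi_drop n \<gamma>)"])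
     (auto simp: mi_take_append mi_append_in mi_drop_in)

lemma sum_lessThan_add: "(\<Sum>i<n + m. f i) = (\<Sum>i<n. f i) + (\<Sum>i<m. f (i + n))" for f :: "nat \<Rightarrow> 'a::comm_monoid_add"
  by (induction m) (auto simp: ac_simps)

lemma prod_lessThan_add: "(\<Prod>i<n + m. f i) = (\<Prod>i<n. f i) * (\<Prod>i<m. f (i + n))" for f :: "nat \<Rightarrow> 'a::comm_monoid_mult"
  by (induction m) (auto simp: ac_simps)

lemma mlen_append: "mlen (n + m) (mi_append n \<alpha> \<beta>) = mlen n \<alpha> + mlen m \<beta>"
  unfolding mlen_def sum_lessThan_add by (simp add: mi_append_def)

lemma hprod_append: "hprod (n + m) (mi_append n \<alpha> \<beta>) w = hprod n \<alpha> w * hprod m \<beta> (drop_pt n w)"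
  unfolding hprod_def prod_lessThan_add by (simp add: mi_append_def drop_pt_def)

lemma drop_append_pt [simp]: "drop_pt n (append_pt n x y) = y"
  by (auto simp: append_pt_def drop_pt_def)

lemma abs_summable_times:
  fixes a :: "'a \<Rightarrow> 'c::{real_normed_field, banach}"
  assumes a: "a abs_summable_on A" and b: "b abs_summable_on B"
  shows "(\<lambda>(x, y). a x * b y) abs_summable_on A \<times> B"
proof -
  have "(\<lambda>y. norm (a x * b y)) = (\<lambda>y. norm (a x) * norm (b y))" for x by (auto simp: norm_mult)
  moreover have "(\<lambda>x. \<Sum>\<^sub>\<infinity>y\<in>B. norm (a x) * norm (b y)) = (\<lambda>x. norm (a x) * (\<Sum>\<^sub>\<infinity>y\<in>B. norm (b y)))"
    by (auto simp: infsum_cmult_right')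
  ultimately show ?thesis
    using a b by (subst Infinite_Sum.abs_summable_on_Sigma_iff)
      (auto simp: norm_mult abs_mult infsum_nonneg intro!: summable_on_cmult_right summable_on_cmult_left)
qed

lemma summable_mi_prod:
  fixes g :: "nat \<Rightarrow> real"
  assumes g: "\<And>n. g n \<ge> 0" "summable g"
  shows "(\<lambda>\<gamma>. \<Prod>i<d. g (\<gamma> i)) summable_on mi d"
proof (induction d)
  case 0
  have "mi 0 = {\<lambda>_. 0}" by (auto simp: mi_def)
  then show ?case by simp
next
  case (Suc d)
  have gs: "g summable_on UNIV" using g by (simp add: summable_on_UNIV_nonneg_real_iff)
  have "bij_betw (\<lambda>n. (\<lambda>i. if i = 0 then n else 0)) UNIV (mi 1)"
    by (rule bij_betw_byWitness[where f' = "\<lambda>\<gamma>. \<gamma> 0"]) (auto simp: mi_def)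
  from summable_on_reindex_bij_betw[OF this, of "\<lambda>\<gamma>. g (\<gamma> 0)"]
  have 1: "(\<lambda>\<gamma>. g (\<gamma> 0)) summable_on mi 1" using gs by simp
  have "(\<lambda>(\<alpha>, \<beta>). (\<Prod>i<d. g (\<alpha> i)) * g (\<beta> 0)) abs_summable_on mi d \<times> mi 1"
    by (rule abs_summable_times) (use Suc 1 g in \<open>auto simp: prod_nonneg abs_prod\<close>)
  then have "(\<lambda>(\<alpha>, \<beta>). (\<Prod>i<d. g (\<alpha> i)) * g (\<beta> 0)) summable_on mi d \<times> mi 1"
    by (rule Infinite_Sum.abs_summable_summable)
  also have "(\<lambda>(\<alpha>, \<beta>). (\<Prod>i<d. g (\<alpha> i)) * g (\<beta> 0)) =
      (\<lambda>\<gamma>. \<Prod>i<Suc d. g (\<gamma> i)) \<circ> (\<lambda>(\<alpha>, \<beta>). mi_append d \<alpha> \<beta>)"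
    by (auto simp: mi_append_def)
  finally show ?case
    using summable_on_reindex_bij_betw[OF bij_mi_append[of d 1], of "\<lambda>\<gamma>. \<Prod>i<Suc d. g (\<gamma> i)"]
    by (simp add: comp_def)
qed

definition inv_sq_prod :: "nat \<Rightarrow> (nat \<Rightarrow> nat) \<Rightarrow> real" where
  "inv_sq_prod d \<gamma> = (\<Prod>i<d. 1 / (1 + real (\<gamma> i))\<^sup>2)"

lemma inv_sq_prod_summable: "inv_sq_prod d summable_on mi d"
proof -
  have "summable (\<lambda>n. inverse (real (Suc n) ^ 2))"
    using inverse_power_summable[of 2, where 'a = real] by (subst summable_Suc_iff) simp
  then have "summable (\<lambda>n. 1 / (1 + real n)\<^sup>2)" by (simp add: divide_inverse add.commute)
  then show ?thesis unfolding inv_sq_prod_def[abs_def] by (intro summable_mi_prod) auto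
qed

text \<open>The square root of \<open>1 + |\<gamma>|\<close> is the size of the matrix entries of \<open>x_i\<close> and \<open>\<partial>_i\<close> near the
  index \<open>\<gamma>\<close>. One power of it corresponds to one operator.\<close>

definition mroot :: "nat \<Rightarrow> (nat \<Rightarrow> nat) \<Rightarrow> real" where
  "mroot d \<gamma> = sqrt (1 + real (mlen d \<gamma>))"

lemma mroot_ge_1: "mroot d \<gamma> \<ge> 1"
  by (simp add: mroot_def)

lemma mroot_sq: "mroot d \<gamma> ^ 2 = 1 + real (mlen d \<gamma>)"
  by (simp add: mroot_def)

lemma le_mlen: "i < d \<Longrightarrow> \<gamma> i \<le> mlen d \<gamma>"
  unfolding mlen_def by (rule member_le_sum) auto

text \<open>Six powers of \<open>mroot\<close> for each variable pay for the supremum of a Hermite function and for the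
  convergence of the series: \<open>1 + \<gamma>_i\<close> is at most the square of \<open>mroot\<close>, and
  \<open>2 (1 + \<gamma>_i) = 2 (1 + \<gamma>_i)^3 / (1 + \<gamma>_i)^2\<close>.\<close>

lemma hbound_le: "hbound d \<gamma> \<le> 2 ^ d * mroot d \<gamma> ^ (6 * d) * inv_sq_prod d \<gamma>"
proof -
  have "hbound d \<gamma> = 2 ^ d * (\<Prod>i<d. (1 + real (\<gamma> i)) ^ 3) * inv_sq_prod d \<gamma>"
  proof -
    have "2 ^ d = (\<Prod>i<d. 2 :: real)" by simp
    moreover have "2 * (real n + 1) = 2 * (1 + real n) ^ 3 * (1 / (1 + real n)\<^sup>2)" for n
    proof -
      have "2 * y = 2 * y ^ 3 * (1 / y\<^sup>2)" if "y \<noteq> 0" for y :: real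
        using that by (simp add: power2_eq_square power3_eq_cube)
      from this[of "1 + real n"] show ?thesis by (simp add: add.commute)
    qed
    ultimately show ?thesis unfolding hbound_def inv_sq_prod_def
      by (simp only: prod.distrib[symmetric])
  qed
  also have "(\<Prod>i<d. (1 + real (\<gamma> i)) ^ 3) \<le> (\<Prod>i<d. (mroot d \<gamma> ^ 2) ^ 3)"
    unfolding mroot_sq by (intro prod_mono conjI power_mono) (auto simp: le_mlen)
  also have "\<dots> = mroot d \<gamma> ^ (6 * d)" by (simp add: power_mult[symmetric])
  finally show ?thesis by (simp add: mult_right_mono inv_sq_prod_def prod_nonneg)
qed

text \<open>This makes the Hermite series with coefficients a converge absolutely and uniformly.\<close>

definition hsummable :: "nat \<Rightarrow> ((nat \<Rightarrow> nat) \<Rightarrow> complex) \<Rightarrow> bool" where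
  "hsummable d a \<longleftrightarrow> (\<lambda>\<gamma>. norm (a \<gamma>) * hbound d \<gamma>) summable_on mi d"

definition rapid :: "nat \<Rightarrow> ((nat \<Rightarrow> nat) \<Rightarrow> complex) \<Rightarrow> bool" where
  "rapid d a \<longleftrightarrow> (\<forall>n. \<exists>C. \<forall>\<gamma>\<in>mi d. norm (a \<gamma>) * mroot d \<gamma> ^ n \<le> C)"

lemma norm_hbound_le:
  assumes "norm (a \<gamma>) * mroot d \<gamma> ^ (6 * d) \<le> C"
  shows "norm (a \<gamma>) * hbound d \<gamma> \<le> C * 2 ^ d * inv_sq_prod d \<gamma>"
proof -
  have "norm (a \<gamma>) * hbound d \<gamma> \<le> norm (a \<gamma>) * (2 ^ d * mroot d \<gamma> ^ (6 * d) * inv_sq_prod d \<gamma>)"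
    by (intro mult_left_mono hbound_le) auto
  also have "\<dots> = (norm (a \<gamma>) * mroot d \<gamma> ^ (6 * d)) * (2 ^ d * inv_sq_prod d \<gamma>)" by simp
  also have "\<dots> \<le> C * (2 ^ d * inv_sq_prod d \<gamma>)"
    by (intro mult_right_mono assms) (auto simp: inv_sq_prod_def prod_nonneg)
  finally show ?thesis by simp
qed

lemma hsummable_bound:
  assumes "\<And>\<gamma>. \<gamma> \<in> mi d \<Longrightarrow> norm (a \<gamma>) * mroot d \<gamma> ^ (6 * d) \<le> C"
  shows "hsummable d a"
    "(\<Sum>\<^sub>\<infinity>\<gamma>\<in>mi d. norm (a \<gamma>) * hbound d \<gamma>) \<le> C * 2 ^ d * (\<Sum>\<^sub>\<infinity>\<gamma>\<in>mi d. inv_sq_prod d \<gamma>)"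
proof -
  have s: "(\<lambda>\<gamma>. C * 2 ^ d * inv_sq_prod d \<gamma>) summable_on mi d"
    by (intro summable_on_cmult_right inv_sq_prod_summable)
  show h: "hsummable d a" unfolding hsummable_def
    by (rule summable_on_comparison_test[OF s]) (use norm_hbound_le[where a = a, OF assms] in auto)
  have "(\<Sum>\<^sub>\<infinity>\<gamma>\<in>mi d. norm (a \<gamma>) * hbound d \<gamma>) \<le> (\<Sum>\<^sub>\<infinity>\<gamma>\<in>mi d. C * 2 ^ d * inv_sq_prod d \<gamma>)"
    by (rule infsum_mono) (use h s norm_hbound_le[where a = a, OF assms] in \<open>auto simp: hsummable_def\<close>)
  then show "(\<Sum>\<^sub>\<infinity>\<gamma>\<in>mi d. norm (a \<gamma>) * hbound d \<gamma>) \<le> C * 2 ^ d * (\<Sum>\<^sub>\<infinity>\<gamma>\<in>mi d. inv_sq_prod d \<gamma>)"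
    by (simp add: infsum_cmult_right')
qed

lemma rapid_hsummable: "rapid d a \<Longrightarrow> hsummable d a"
  unfolding rapid_def using hsummable_bound(1) by metis

subsection \<open>Convergence, continuity and integration of Hermite series\<close>

definition series :: "nat \<Rightarrow> ((nat \<Rightarrow> nat) \<Rightarrow> complex) \<Rightarrow> seq_fun" where
  "series d a x = (\<Sum>\<^sub>\<infinity>\<gamma>\<in>mi d. a \<gamma> * of_real (hprod d \<gamma> x))"

lemma norm_term_le: "norm (a \<gamma> * complex_of_real (hprod d \<gamma> x)) \<le> norm (a \<gamma>) * hbound d \<gamma>"
  unfolding norm_mult norm_of_real by (intro mult_left_mono hprod_bound) auto

lemma series_abs_summable:
  assumes "hsummable d a"
  shows "(\<lambda>\<gamma>. a \<gamma> * complex_of_real (hprod d \<gamma> x)) abs_summable_on mi d"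
  by (rule summable_on_comparison_test[OF assms[unfolded hsummable_def]]) (use norm_term_le in auto)

lemma series_summable:
  "hsummable d a \<Longrightarrow> (\<lambda>\<gamma>. a \<gamma> * complex_of_real (hprod d \<gamma> x)) summable_on mi d"
  by (rule Infinite_Sum.abs_summable_summable, rule series_abs_summable)

lemma series_norm_le:
  assumes "hsummable d a" shows "norm (series d a x) \<le> (\<Sum>\<^sub>\<infinity>\<gamma>\<in>mi d. norm (a \<gamma>) * hbound d \<gamma>)"
  unfolding series_def
  by (rule norm_infsum_le[OF has_sum_infsum[OF series_summable[OF assms]] has_sum_infsum[OF assms[unfolded hsummable_def]]])
     (use norm_term_le in auto)

lemma series_cylinder: "cylinder d (series d a)"
  unfolding cylinder_def series_def
proof (intro allI impI infsum_cong)
  fix x y \<gamma> assume "\<forall>i<d. x i = (y i :: real)"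
  then have "hprod d \<gamma> x = hprod d \<gamma> y" by (intro hprod_cong) auto
  then show "a \<gamma> * complex_of_real (hprod d \<gamma> x) = a \<gamma> * complex_of_real (hprod d \<gamma> y)" by simp
qed

lemma series_continuous:
  assumes "hsummable d a" shows "continuous_on UNIV (series d a)"
proof -
  have "uniform_limit UNIV (\<lambda>X x. \<Sum>\<gamma>\<in>X. a \<gamma> * complex_of_real (hprod d \<gamma> x)) (series d a) (finite_subsets_at_top (mi d))"
    unfolding series_def[abs_def]
    by (rule Weierstrass_m_test_general[where M = "\<lambda>\<gamma>. norm (a \<gamma>) * hbound d \<gamma>"])
       (use norm_term_le assms in \<open>auto simp: hsummable_def\<close>)
  then show ?thesis
    by (rule uniform_limit_theorem[rotated])
       (auto intro!: always_eventually continuous_intros hprod_continuous)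
qed

lemma series_measurable:
  "hsummable d a \<Longrightarrow> series d a \<in> borel_measurable (leb d)"
  by (intro cylinder_measurable series_cylinder series_continuous)

lemma series_times_integrable:
  assumes a: "hsummable d a" and g: "integrable (leb d) g"
  shows "integrable (leb d) (\<lambda>x. series d a x * g x)"
proof -
  have "integrable (leb d) (\<lambda>x. g x * series d a x)"
    by (rule integrable_times_bounded[OF g series_measurable[OF a] series_norm_le[OF a]])
  then show ?thesis by (simp add: mult.commute)
qed

text \<open>The finite partial sums converge uniformly, and g is integrable.\<close>

lemma series_integral:
  assumes a: "hsummable d a" and g: "integrable (leb d) g"
  shows "(\<integral>x. series d a x * g x \<partial>leb d) = (\<Sum>\<^sub>\<infinity>\<gamma>\<in>mi d. a \<gamma> * coef d g \<gamma>)"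
proof -
  let ?S = "\<lambda>X x. \<Sum>\<gamma>\<in>X. a \<gamma> * complex_of_real (hprod d \<gamma> x)"
  have int: "integrable (leb d) (\<lambda>x. g x * complex_of_real (hprod d \<gamma> x))" for \<gamma>
    by (intro integrable_times_bounded[OF g, where C = "hbound d \<gamma>"]) (auto simp: hprod_bound)
  have fin: "(\<integral>x. ?S X x * g x \<partial>leb d) = (\<Sum>\<gamma>\<in>X. a \<gamma> * coef d g \<gamma>)" for X
  proof -
    have "?S X x * g x = (\<Sum>\<gamma>\<in>X. a \<gamma> * (g x * complex_of_real (hprod d \<gamma> x)))" for x
      unfolding sum_distrib_right by (intro sum.cong) (auto simp: ac_simps)
    then show ?thesis unfolding coef_def using int by simp
  qed
  have intX: "integrable (leb d) (\<lambda>x. ?S X x * g x)" for X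
  proof -
    have "?S X x * g x = (\<Sum>\<gamma>\<in>X. a \<gamma> * (g x * complex_of_real (hprod d \<gamma> x)))" for x
      unfolding sum_distrib_right by (intro sum.cong) (auto simp: ac_simps)
    then show ?thesis using int by simp
  qed
  have ul: "uniform_limit UNIV ?S (series d a) (finite_subsets_at_top (mi d))"
    unfolding series_def[abs_def]
    by (rule Weierstrass_m_test_general[where M = "\<lambda>\<gamma>. norm (a \<gamma>) * hbound d \<gamma>"])
       (use norm_term_le a in \<open>auto simp: hsummable_def\<close>)
  define G where "G = (\<integral>x. norm (g x) \<partial>leb d)"
  have G0: "G \<ge> 0" unfolding G_def by simp
  have "((\<lambda>X. \<Sum>\<gamma>\<in>X. a \<gamma> * coef d g \<gamma>) \<longlongrightarrow> (\<integral>x. series d a x * g x \<partial>leb d)) (finite_subsets_at_top (mi d))"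
  proof (rule tendstoI)
    fix e :: real assume e: "e > 0"
    define \<delta> where "\<delta> = e / (G + 1)"
    have \<delta>: "\<delta> > 0" using e G0 by (simp add: \<delta>_def)
    show "\<forall>\<^sub>F X in finite_subsets_at_top (mi d). dist (\<Sum>\<gamma>\<in>X. a \<gamma> * coef d g \<gamma>) (\<integral>x. series d a x * g x \<partial>leb d) < e"
      using uniform_limitD[OF ul \<delta>]
    proof (rule eventually_mono)
      fix X assume X: "\<forall>x\<in>UNIV. dist (?S X x) (series d a x) < \<delta>"
      have "dist (\<Sum>\<gamma>\<in>X. a \<gamma> * coef d g \<gamma>) (\<integral>x. series d a x * g x \<partial>leb d)
          = norm (\<integral>x. (?S X x * g x - series d a x * g x) \<partial>leb d)"
        unfolding dist_norm fin[symmetric]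
        by (subst Bochner_Integration.integral_diff[OF intX series_times_integrable[OF a g]]) simp
      also have "\<dots> \<le> (\<integral>x. \<delta> * norm (g x) \<partial>leb d)"
      proof (rule integral_norm_le)
        show "integrable (leb d) (\<lambda>x. ?S X x * g x - series d a x * g x)"
          by (intro Bochner_Integration.integrable_diff intX series_times_integrable[OF a g])
        show "norm (?S X x * g x - series d a x * g x) \<le> \<delta> * norm (g x)" for x
          using X by (simp add: left_diff_distrib[symmetric] norm_mult dist_norm mult_right_mono less_imp_le)
      qed (use g in simp)
      also have "\<dots> = \<delta> * G" unfolding G_def by simp
      also have "\<dots> < e"
        using e G0 unfolding \<delta>_def by (simp add: field_simps)
      finally show "dist (\<Sum>\<gamma>\<in>X. a \<gamma> * coef d g \<gamma>) (\<integral>x. series d a x * g x \<partial>leb d) < e" .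
    qed
  qed
  then have "((\<lambda>\<gamma>. a \<gamma> * coef d g \<gamma>) has_sum (\<integral>x. series d a x * g x \<partial>leb d)) (mi d)"
    by (simp add: has_sum_def)
  then show ?thesis by (rule infsumI[symmetric])
qed

lemma coef_mi_take: "coef d f (mi_take d \<gamma>) = coef d f \<gamma>"
proof -
  have "hprod d (mi_take d \<gamma>) = hprod d \<gamma>" by (intro ext hprod_cong) (auto simp: mi_take_def)
  then show ?thesis unfolding coef_def by simp
qed

lemma coef_series:
  assumes "hsummable d a" "\<gamma> \<in> mi d"
  shows "coef d (series d a) \<gamma> = a \<gamma>"
proof -
  have "coef d (series d a) \<gamma> = (\<Sum>\<^sub>\<infinity>\<beta>\<in>mi d. a \<beta> * coef d (\<lambda>x. of_real (hprod d \<gamma> x)) \<beta>)"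
    unfolding coef_def[of d "series d a"]
    by (rule series_integral[OF assms(1)]) (rule quad_decay_integrable[OF hprod_quad_decay])
  also have "\<dots> = (\<Sum>\<^sub>\<infinity>\<beta>\<in>{\<gamma>}. a \<beta>)"
    unfolding coef_hprod
  proof (rule infsum_cong_neutral)
    fix \<beta> assume "\<beta> \<in> mi d - {\<gamma>}"
    then have "\<beta> \<noteq> \<gamma>" "\<forall>i\<ge>d. \<beta> i = \<gamma> i" using assms(2) by (auto simp: mi_def)
    then have "\<exists>i<d. \<gamma> i \<noteq> \<beta> i" by (metis ext linorder_not_less)
    then show "a \<beta> * (if \<forall>i<d. \<gamma> i = \<beta> i then 1 else 0) = 0" by auto
  qed (use assms(2) in auto)
  finally show ?thesis by simp
qed

subsection \<open>Termwise differentiation\<close>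

lemma has_vector_derivative_iff_tendsto:
  fixes f :: "real \<Rightarrow> 'b::real_normed_vector"
  shows "(f has_vector_derivative D) (at t0) \<longleftrightarrow> ((\<lambda>t. (f t - f t0) /\<^sub>R (t - t0)) \<longlongrightarrow> D) (at t0)"
proof -
  have ev: "\<forall>\<^sub>F t in at t0. norm ((f t - f t0 - (t - t0) *\<^sub>R D) /\<^sub>R norm (t - t0)) = norm ((f t - f t0) /\<^sub>R (t - t0) - D)"
    unfolding eventually_at
  proof (intro exI[of _ 1] conjI ballI impI)
    fix t :: real assume "t \<noteq> t0 \<and> dist t t0 < 1"
    then have "(f t - f t0) /\<^sub>R (t - t0) - D = (f t - f t0 - (t - t0) *\<^sub>R D) /\<^sub>R (t - t0)"
      by (simp add: scaleR_diff_right)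
    then show "norm ((f t - f t0 - (t - t0) *\<^sub>R D) /\<^sub>R norm (t - t0)) = norm ((f t - f t0) /\<^sub>R (t - t0) - D)"
      by simp
  qed simp
  have "(f has_vector_derivative D) (at t0) \<longleftrightarrow>
      ((\<lambda>t. (f t - f t0 - (t - t0) *\<^sub>R D) /\<^sub>R norm (t - t0)) \<longlongrightarrow> 0) (at t0)"
    unfolding has_vector_derivative_def has_derivative_at_within by (simp add: bounded_linear_scaleR_left)
  also have "\<dots> \<longleftrightarrow> ((\<lambda>t. norm ((f t - f t0 - (t - t0) *\<^sub>R D) /\<^sub>R norm (t - t0))) \<longlongrightarrow> 0) (at t0)"
    by (rule tendsto_norm_zero_iff[symmetric])
  also have "\<dots> \<longleftrightarrow> ((\<lambda>t. norm ((f t - f t0) /\<^sub>R (t - t0) - D)) \<longlongrightarrow> 0) (at t0)"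
    by (rule tendsto_cong[OF ev])
  also have "\<dots> \<longleftrightarrow> ((\<lambda>t. (f t - f t0) /\<^sub>R (t - t0)) \<longlongrightarrow> D) (at t0)"
    by (simp add: tendsto_norm_zero_iff LIM_zero_iff)
  finally show ?thesis .
qed

text \<open>By the mean value inequality the difference quotients of the terms are dominated by \<open>M'\<close>, so
  their series converges uniformly and its limit at \<open>t0\<close> may be taken termwise.\<close>

lemma infsum_has_vector_derivative:
  fixes u :: "'a \<Rightarrow> real \<Rightarrow> 'b::banach"
  assumes D: "\<And>k t. k \<in> A \<Longrightarrow> (u k has_vector_derivative u' k t) (at t)"
    and M: "\<And>k t. k \<in> A \<Longrightarrow> norm (u k t) \<le> M k" "M summable_on A"
    and M': "\<And>k t. k \<in> A \<Longrightarrow> norm (u' k t) \<le> M' k" "M' summable_on A"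
  shows "((\<lambda>t. \<Sum>\<^sub>\<infinity>k\<in>A. u k t) has_vector_derivative (\<Sum>\<^sub>\<infinity>k\<in>A. u' k t0)) (at t0)"
unfolding has_vector_derivative_iff_tendsto
proof -
  let ?q = "\<lambda>k t. (u k t - u k t0) /\<^sub>R (t - t0)"
  have su: "(\<lambda>k. u k t) summable_on A" for t
    by (rule Infinite_Sum.abs_summable_summable, rule summable_on_comparison_test[OF M(2)]) (use M(1) in auto)
  have su': "(\<lambda>k. u' k t) summable_on A" for t
    by (rule Infinite_Sum.abs_summable_summable, rule summable_on_comparison_test[OF M'(2)]) (use M'(1) in auto)
  have qb: "norm (?q k t) \<le> M' k" if k: "k \<in> A" and t: "t \<noteq> t0" for k t
  proof -
    have "norm (u k t - u k t0) \<le> M' k * norm (t - t0)"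
    proof (rule differentiable_bound[of UNIV])
      show "(u k has_derivative (\<lambda>h. h *\<^sub>R u' k s)) (at s within UNIV)" for s
        using D[OF k, of s] by (simp add: has_vector_derivative_def)
      show "onorm (\<lambda>h. h *\<^sub>R u' k s) \<le> M' k" for s
        using onorm_scaleR_left[OF bounded_linear_ident, of "u' k s"] M'(1)[OF k, of s] by (simp add: onorm_id)
    qed auto
    moreover have "norm (?q k t) = norm (u k t - u k t0) / \<bar>t - t0\<bar>"
      by (simp only: norm_scaleR) (simp add: divide_inverse)
    ultimately show ?thesis using t by (simp add: pos_divide_le_eq)
  qed
  have ul: "uniform_limit (- {t0}) (\<lambda>X t. \<Sum>k\<in>X. ?q k t) (\<lambda>t. \<Sum>\<^sub>\<infinity>k\<in>A. ?q k t) (finite_subsets_at_top A)"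
    by (rule Weierstrass_m_test_general[OF _ M'(2)]) (use qb in auto)
  have "((\<lambda>t. \<Sum>\<^sub>\<infinity>k\<in>A. ?q k t) \<longlongrightarrow> (\<Sum>\<^sub>\<infinity>k\<in>A. u' k t0)) (at t0)"
  proof (rule swap_uniform_limit'[OF _ _ ul])
    show "\<forall>\<^sub>F X in finite_subsets_at_top A. ((\<lambda>t. \<Sum>k\<in>X. ?q k t) \<longlongrightarrow> (\<Sum>k\<in>X. u' k t0)) (at t0)"
      unfolding eventually_finite_subsets_at_top
    proof (intro exI[of _ "{}"] conjI allI impI)
      fix X assume X: "finite X \<and> {} \<subseteq> X \<and> X \<subseteq> A"
      show "((\<lambda>t. \<Sum>k\<in>X. ?q k t) \<longlongrightarrow> (\<Sum>k\<in>X. u' k t0)) (at t0)"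
      proof (rule tendsto_sum)
        fix k assume "k \<in> X"
        then have "(u k has_vector_derivative u' k t0) (at t0)" using D X by auto
        then show "((\<lambda>t. ?q k t) \<longlongrightarrow> u' k t0) (at t0)"
          by (simp add: has_vector_derivative_iff_tendsto)
      qed
    qed auto
    show "((\<lambda>X. \<Sum>k\<in>X. u' k t0) \<longlongrightarrow> (\<Sum>\<^sub>\<infinity>k\<in>A. u' k t0)) (finite_subsets_at_top A)"
      using infsum_tendsto[OF su'] .
    show "\<forall>\<^sub>F t in at t0. t \<in> - {t0}" by (auto simp: eventually_at intro: exI[of _ 1])
  qed auto
  moreover have "(\<Sum>\<^sub>\<infinity>k\<in>A. ?q k t) = ((\<Sum>\<^sub>\<infinity>k\<in>A. u k t) - (\<Sum>\<^sub>\<infinity>k\<in>A. u k t0)) /\<^sub>R (t - t0)" for t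
    using infsum_add[OF su[of t] summable_on_uminus[THEN iffD2, OF su[of t0]]]
    by (simp add: infsum_scaleR_right infsum_uminus)
  ultimately show "((\<lambda>t. ((\<Sum>\<^sub>\<infinity>k\<in>A. u k t) - (\<Sum>\<^sub>\<infinity>k\<in>A. u k t0)) /\<^sub>R (t - t0)) \<longlongrightarrow> (\<Sum>\<^sub>\<infinity>k\<in>A. u' k t0)) (at t0)"
    by simp
qed

subsection \<open>Ladder operators on coefficient sequences\<close>

definition raise_idx :: "nat \<Rightarrow> ((nat \<Rightarrow> nat) \<Rightarrow> 'c::real_normed_field) \<Rightarrow> (nat \<Rightarrow> nat) \<Rightarrow> 'c" where
  "raise_idx i a \<gamma> = of_real (ladder (Suc (\<gamma> i))) * a (\<gamma>(i := Suc (\<gamma> i)))"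

definition lower_idx :: "nat \<Rightarrow> ((nat \<Rightarrow> nat) \<Rightarrow> 'c::real_normed_field) \<Rightarrow> (nat \<Rightarrow> nat) \<Rightarrow> 'c" where
  "lower_idx i a \<gamma> = of_real (ladder (\<gamma> i)) * a (\<gamma>(i := \<gamma> i - 1))"

text \<open>The action on Hermite coefficients of multiplication by \<open>x_i\<close> (for \<open>True\<close>) and of
  differentiation in the variable i (for \<open>False\<close>).\<close>

definition shift_op :: "bool \<Rightarrow> nat \<Rightarrow> ((nat \<Rightarrow> nat) \<Rightarrow> complex) \<Rightarrow> (nat \<Rightarrow> nat) \<Rightarrow> complex" where
  "shift_op b i a \<gamma> = raise_idx i a \<gamma> + (if b then 1 else - 1) * lower_idx i a \<gamma>"

lemma upd_in_mi: "i < d \<Longrightarrow> \<gamma> \<in> mi d \<Longrightarrow> \<gamma>(i := k) \<in> mi d"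
  by (simp add: mi_def)

lemma mlen_upd: "i < d \<Longrightarrow> mlen d (\<gamma>(i := k)) + \<gamma> i = mlen d \<gamma> + k"
proof -
  assume i: "i < d"
  have "mlen d (\<gamma>(i := k)) = k + (\<Sum>j\<in>{..<d} - {i}. \<gamma> j)"
    unfolding mlen_def using i by (subst sum.remove[of _ i]) (auto intro!: sum.cong)
  moreover have "mlen d \<gamma> = \<gamma> i + (\<Sum>j\<in>{..<d} - {i}. \<gamma> j)"
    unfolding mlen_def using i by (subst sum.remove[of _ i]) auto
  ultimately show ?thesis by simp
qed

lemma mlen_up: "i < d \<Longrightarrow> mlen d (\<gamma>(i := Suc (\<gamma> i))) = Suc (mlen d \<gamma>)"
  using mlen_upd[of i d \<gamma> "Suc (\<gamma> i)"] by simp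

lemma mlen_down: "i < d \<Longrightarrow> \<gamma> i > 0 \<Longrightarrow> Suc (mlen d (\<gamma>(i := \<gamma> i - 1))) = mlen d \<gamma>"
  using mlen_upd[of i d \<gamma> "\<gamma> i - 1"] by simp

text \<open>Raising the index in position i is a bijection of the multi-indices onto those with a positive
  entry there. The two lemmas below move the shifts from the coefficients to the Hermite functions.\<close>

lemma has_sum_raise_iff:
  assumes i: "i < d" and F: "\<And>\<gamma>. \<gamma> i = 0 \<Longrightarrow> F \<gamma> = 0"
  shows "((\<lambda>\<gamma>. F (\<gamma>(i := Suc (\<gamma> i)))) has_sum S) (mi d) \<longleftrightarrow> (F has_sum S) (mi d)"
proof -
  have "bij_betw (\<lambda>\<gamma>. \<gamma>(i := Suc (\<gamma> i))) (mi d) {\<gamma>\<in>mi d. \<gamma> i > 0}"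
    by (rule bij_betw_byWitness[where f' = "\<lambda>\<gamma>. \<gamma>(i := \<gamma> i - 1)"]) (use i in \<open>auto simp: upd_in_mi\<close>)
  from has_sum_reindex_bij_betw[OF this]
  have "((\<lambda>\<gamma>. F (\<gamma>(i := Suc (\<gamma> i)))) has_sum S) (mi d) \<longleftrightarrow> (F has_sum S) {\<gamma>\<in>mi d. \<gamma> i > 0}" .
  also have "\<dots> \<longleftrightarrow> (F has_sum S) (mi d)"
    by (rule has_sum_cong_neutral) (use F in auto)
  finally show ?thesis .
qed

lemma has_sum_raise_idx:
  assumes i: "i < d" and s: "((\<lambda>\<gamma>. raise_idx i a \<gamma> * k \<gamma>) has_sum S) (mi d)"
  shows "((\<lambda>\<gamma>. a \<gamma> * (of_real (ladder (\<gamma> i)) * k (\<gamma>(i := \<gamma> i - 1)))) has_sum S) (mi d)"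
  using s by (subst has_sum_raise_iff[OF i, symmetric]) (auto simp: raise_idx_def ac_simps)

lemma has_sum_lower_idx:
  assumes i: "i < d" and s: "((\<lambda>\<gamma>. lower_idx i a \<gamma> * k \<gamma>) has_sum S) (mi d)"
  shows "((\<lambda>\<gamma>. a \<gamma> * (of_real (ladder (Suc (\<gamma> i))) * k (\<gamma>(i := Suc (\<gamma> i))))) has_sum S) (mi d)"
proof -
  have "((\<lambda>\<gamma>. lower_idx i a (\<gamma>(i := Suc (\<gamma> i))) * k (\<gamma>(i := Suc (\<gamma> i)))) has_sum S) (mi d)"
    using s by (subst has_sum_raise_iff[OF i]) (auto simp: lower_idx_def)
  then show ?thesis by (simp add: lower_idx_def ac_simps)
qed

lemma rapid_add: "rapid d a \<Longrightarrow> rapid d b \<Longrightarrow> rapid d (\<lambda>\<gamma>. a \<gamma> + b \<gamma>)"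
  unfolding rapid_def
proof
  fix n assume a: "\<forall>n. \<exists>C. \<forall>\<gamma>\<in>mi d. norm (a \<gamma>) * mroot d \<gamma> ^ n \<le> C"
    and b: "\<forall>n. \<exists>C. \<forall>\<gamma>\<in>mi d. norm (b \<gamma>) * mroot d \<gamma> ^ n \<le> C"
  obtain C D where CD: "\<forall>\<gamma>\<in>mi d. norm (a \<gamma>) * mroot d \<gamma> ^ n \<le> C" "\<forall>\<gamma>\<in>mi d. norm (b \<gamma>) * mroot d \<gamma> ^ n \<le> D"
    using a b by metis
  have "norm (a \<gamma> + b \<gamma>) * mroot d \<gamma> ^ n \<le> C + D" if "\<gamma> \<in> mi d" for \<gamma>
  proof -
    have "norm (a \<gamma> + b \<gamma>) * mroot d \<gamma> ^ n \<le> (norm (a \<gamma>) + norm (b \<gamma>)) * mroot d \<gamma> ^ n"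
      using mroot_ge_1[of d \<gamma>] by (intro mult_right_mono norm_triangle_ineq) auto
    with CD that show ?thesis by (fastforce simp: algebra_simps)
  qed
  then show "\<exists>C. \<forall>\<gamma>\<in>mi d. norm (a \<gamma> + b \<gamma>) * mroot d \<gamma> ^ n \<le> C" by blast
qed

lemma rapid_cmult: "rapid d a \<Longrightarrow> rapid d (\<lambda>\<gamma>. c * a \<gamma>)"
  unfolding rapid_def
proof
  fix n assume "\<forall>n. \<exists>C. \<forall>\<gamma>\<in>mi d. norm (a \<gamma>) * mroot d \<gamma> ^ n \<le> C"
  then obtain C where C: "\<forall>\<gamma>\<in>mi d. norm (a \<gamma>) * mroot d \<gamma> ^ n \<le> C" by metis
  show "\<exists>C. \<forall>\<gamma>\<in>mi d. norm (c * a \<gamma>) * mroot d \<gamma> ^ n \<le> C"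
    by (rule exI[of _ "norm c * C"]) (use C in \<open>auto simp: norm_mult mult.assoc intro!: mult_left_mono\<close>)
qed

lemma ladder_le_mroot: "i < d \<Longrightarrow> ladder (\<gamma> i) \<le> mroot d \<gamma>"
  using le_mlen[of i d \<gamma>] unfolding ladder_def mroot_def by (intro real_sqrt_le_mono) simp

lemma rapid_raise_idx:
  assumes i: "i < d" and a: "rapid d a" shows "rapid d (raise_idx i a)"
  unfolding rapid_def
proof
  fix n
  obtain C where C: "\<And>\<gamma>. \<gamma> \<in> mi d \<Longrightarrow> norm (a \<gamma>) * mroot d \<gamma> ^ Suc n \<le> C"
    using a unfolding rapid_def by metis
  have "norm (raise_idx i a \<gamma>) * mroot d \<gamma> ^ n \<le> C" if \<gamma>: "\<gamma> \<in> mi d" for \<gamma>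
  proof -
    let ?u = "\<gamma>(i := Suc (\<gamma> i))"
    have "ladder (?u i) * mroot d \<gamma> ^ n \<le> mroot d ?u * mroot d ?u ^ n"
      using mroot_ge_1[of d \<gamma>] mlen_up[OF i, of \<gamma>]
      by (intro mult_mono ladder_le_mroot i power_mono) (auto simp: mroot_def)
    then have "norm (a ?u) * (ladder (?u i) * mroot d \<gamma> ^ n) \<le> norm (a ?u) * mroot d ?u ^ Suc n"
      by (intro mult_left_mono) auto
    also have "\<dots> \<le> C" using C upd_in_mi[OF i \<gamma>] by blast
    finally show ?thesis unfolding raise_idx_def by (simp add: norm_mult ac_simps)
  qed
  then show "\<exists>C. \<forall>\<gamma>\<in>mi d. norm (raise_idx i a \<gamma>) * mroot d \<gamma> ^ n \<le> C" by blast
qed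

lemma rapid_lower_idx:
  assumes i: "i < d" and a: "rapid d a" shows "rapid d (lower_idx i a)"
  unfolding rapid_def
proof
  fix n
  obtain C where C: "\<And>\<gamma>. \<gamma> \<in> mi d \<Longrightarrow> norm (a \<gamma>) * mroot d \<gamma> ^ Suc n \<le> C"
    using a unfolding rapid_def by metis
  have "norm (lower_idx i a \<gamma>) * mroot d \<gamma> ^ n \<le> 2 ^ Suc n * C" if \<gamma>: "\<gamma> \<in> mi d" for \<gamma>
  proof (cases "\<gamma> i = 0")
    case True
    have "0 \<le> norm (a \<gamma>) * mroot d \<gamma> ^ Suc n" using mroot_ge_1[of d \<gamma>] by simp
    also have "\<dots> \<le> C" using C \<gamma> by blast
    finally show ?thesis using True by (simp add: lower_idx_def)
  next
    case False
    let ?u = "\<gamma>(i := \<gamma> i - 1)"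
    have m: "mroot d \<gamma> \<le> 2 * mroot d ?u"
    proof -
      have "mroot d \<gamma> = sqrt (1 + real (Suc (mlen d ?u)))" unfolding mroot_def using mlen_down[OF i, of \<gamma>] False by simp
      also have "\<dots> \<le> sqrt (4 * (1 + real (mlen d ?u)))" by (intro real_sqrt_le_mono) simp
      also have "\<dots> = 2 * mroot d ?u" unfolding mroot_def real_sqrt_mult by simp
      finally show ?thesis .
    qed
    have "ladder (\<gamma> i) * mroot d \<gamma> ^ n \<le> mroot d \<gamma> ^ Suc n"
      using mroot_ge_1[of d \<gamma>] ladder_le_mroot[OF i, of \<gamma>] by (simp add: mult_right_mono)
    also have "\<dots> \<le> (2 * mroot d ?u) ^ Suc n" using mroot_ge_1[of d \<gamma>] by (intro power_mono m) auto
    finally have "norm (a ?u) * (ladder (\<gamma> i) * mroot d \<gamma> ^ n) \<le> norm (a ?u) * (2 * mroot d ?u) ^ Suc n"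
      by (intro mult_left_mono) auto
    also have "\<dots> = 2 ^ Suc n * (norm (a ?u) * mroot d ?u ^ Suc n)"
      by (simp only: power_mult_distrib) (simp only: ac_simps)
    also have "\<dots> \<le> 2 ^ Suc n * C" by (intro mult_left_mono C upd_in_mi[OF i \<gamma>]) auto
    finally show ?thesis unfolding lower_idx_def by (simp add: norm_mult ac_simps)
  qed
  then show "\<exists>C. \<forall>\<gamma>\<in>mi d. norm (lower_idx i a \<gamma>) * mroot d \<gamma> ^ n \<le> C" by blast
qed

lemma rapid_shift_op: "i < d \<Longrightarrow> rapid d a \<Longrightarrow> rapid d (shift_op b i a)"
  unfolding shift_op_def[abs_def] by (intro rapid_add rapid_cmult rapid_raise_idx rapid_lower_idx)

lemma series_has_sum: "hsummable d a \<Longrightarrow> ((\<lambda>\<gamma>. a \<gamma> * complex_of_real (hprod d \<gamma> x)) has_sum series d a x) (mi d)"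
  unfolding series_def using series_summable by (rule has_sum_infsum)

lemma series_add:
  "hsummable d a \<Longrightarrow> hsummable d b \<Longrightarrow> series d (\<lambda>\<gamma>. a \<gamma> + b \<gamma>) x = series d a x + series d b x"
  unfolding series_def distrib_right by (intro infsum_add series_summable)

lemma series_cmult: "series d (\<lambda>\<gamma>. c * a \<gamma>) x = c * series d a x"
  unfolding series_def mult.assoc by (rule infsum_cmult_right')

lemma series_shift_op:
  assumes "i < d" "rapid d a"
  shows "series d (shift_op b i a) x = series d (raise_idx i a) x + (if b then 1 else - 1) * series d (lower_idx i a) x"
  unfolding shift_op_def[abs_def] series_cmult[symmetric]
  by (rule series_add) (intro rapid_hsummable rapid_cmult rapid_raise_idx rapid_lower_idx assms)+

lemma series_ladder_terms:
  assumes i: "i < d" and a: "rapid d a"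
  shows "((\<lambda>\<gamma>. a \<gamma> * (of_real (ladder (\<gamma> i)) * of_real (hprod d (\<gamma>(i := \<gamma> i - 1)) x)
           + c * (of_real (ladder (Suc (\<gamma> i))) * of_real (hprod d (\<gamma>(i := Suc (\<gamma> i))) x)))) has_sum
         series d (raise_idx i a) x + c * series d (lower_idx i a) x) (mi d)"
proof -
  have 1: "((\<lambda>\<gamma>. a \<gamma> * (of_real (ladder (\<gamma> i)) * of_real (hprod d (\<gamma>(i := \<gamma> i - 1)) x))) has_sum
         series d (raise_idx i a) x) (mi d)"
    by (rule has_sum_raise_idx[OF i series_has_sum]) (intro rapid_hsummable rapid_raise_idx i a)
  have 2: "((\<lambda>\<gamma>. a \<gamma> * (of_real (ladder (Suc (\<gamma> i))) * of_real (hprod d (\<gamma>(i := Suc (\<gamma> i))) x))) has_sum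
         series d (lower_idx i a) x) (mi d)"
    by (rule has_sum_lower_idx[OF i series_has_sum]) (intro rapid_hsummable rapid_lower_idx i a)
  show ?thesis
    using has_sum_add[OF 1 has_sum_cmult_right[OF 2, of c]] by (simp add: algebra_simps)
qed

lemma series_mult:
  assumes i: "i < d" and a: "rapid d a"
  shows "of_real (x i) * series d a x = series d (shift_op True i a) x"
proof -
  have "((\<lambda>\<gamma>. of_real (x i) * (a \<gamma> * complex_of_real (hprod d \<gamma> x))) has_sum of_real (x i) * series d a x) (mi d)"
    by (intro has_sum_cmult_right series_has_sum rapid_hsummable a)
  moreover have "complex_of_real (x i) * (a \<gamma> * of_real (hprod d \<gamma> x)) =
     a \<gamma> * (of_real (ladder (\<gamma> i)) * of_real (hprod d (\<gamma>(i := \<gamma> i - 1)) x)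
       + 1 * (of_real (ladder (Suc (\<gamma> i))) * of_real (hprod d (\<gamma>(i := Suc (\<gamma> i))) x)))" for \<gamma>
  proof -
    have "complex_of_real (x i) * (a \<gamma> * of_real (hprod d \<gamma> x)) = a \<gamma> * of_real (x i * hprod d \<gamma> x)" by simp
    then show ?thesis unfolding hprod_mult[OF i] by simp
  qed
  ultimately show ?thesis
    using series_ladder_terms[OF i a, of x 1] has_sum_unique unfolding series_shift_op[OF i a] by fastforce
qed

lemma series_has_derivative:
  assumes i: "i < d" and a: "rapid d a"
  shows "((\<lambda>t. series d a (x(i := t))) has_vector_derivative series d (shift_op False i a) (x(i := t))) (at t)"
proof -
  let ?u' = "\<lambda>\<gamma> t. a \<gamma> * (of_real (ladder (\<gamma> i)) * of_real (hprod d (\<gamma>(i := \<gamma> i - 1)) (x(i := t)))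
           + (- 1) * (of_real (ladder (Suc (\<gamma> i))) * of_real (hprod d (\<gamma>(i := Suc (\<gamma> i))) (x(i := t)))))"
  let ?M1 = "\<lambda>\<gamma>. norm (a \<gamma>) * (ladder (\<gamma> i) * hbound d (\<gamma>(i := \<gamma> i - 1)))"
  let ?M2 = "\<lambda>\<gamma>. norm (a \<gamma>) * (ladder (Suc (\<gamma> i)) * hbound d (\<gamma>(i := Suc (\<gamma> i))))"
  have hr: "(\<lambda>\<gamma>. raise_idx i (\<lambda>\<gamma>. norm (a \<gamma>)) \<gamma> * hbound d \<gamma>) summable_on mi d"
    using rapid_hsummable[OF rapid_raise_idx[OF i a]] unfolding hsummable_def raise_idx_def by (simp add: norm_mult)
  have hl: "(\<lambda>\<gamma>. lower_idx i (\<lambda>\<gamma>. norm (a \<gamma>)) \<gamma> * hbound d \<gamma>) summable_on mi d"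
    using rapid_hsummable[OF rapid_lower_idx[OF i a]] unfolding hsummable_def lower_idx_def by (simp add: norm_mult)
  have M: "(\<lambda>\<gamma>. ?M1 \<gamma> + ?M2 \<gamma>) summable_on mi d"
    using has_sum_raise_idx[OF i has_sum_infsum[OF hr]] has_sum_lower_idx[OF i has_sum_infsum[OF hl]]
    by (intro summable_on_add) (auto simp: has_sum_imp_summable)
  have "((\<lambda>t. \<Sum>\<^sub>\<infinity>\<gamma>\<in>mi d. a \<gamma> * complex_of_real (hprod d \<gamma> (x(i := t)))) has_vector_derivative (\<Sum>\<^sub>\<infinity>\<gamma>\<in>mi d. ?u' \<gamma> t)) (at t)"
  proof (rule infsum_has_vector_derivative[where M = "\<lambda>\<gamma>. norm (a \<gamma>) * hbound d \<gamma>" and M' = "\<lambda>\<gamma>. ?M1 \<gamma> + ?M2 \<gamma>"])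
    fix \<gamma> t
    show "((\<lambda>t. a \<gamma> * complex_of_real (hprod d \<gamma> (x(i := t)))) has_vector_derivative ?u' \<gamma> t) (at t)"
    proof -
      have "((\<lambda>t. complex_of_real (hprod d \<gamma> (x(i := t)))) has_vector_derivative
        of_real (ladder (\<gamma> i) * hprod d (\<gamma>(i := \<gamma> i - 1)) (x(i := t))
          - ladder (Suc (\<gamma> i)) * hprod d (\<gamma>(i := Suc (\<gamma> i))) (x(i := t)))) (at t)"
        using hprod_deriv[OF i, of \<gamma> x t]
        by (intro has_vector_derivative_of_real) (simp add: has_real_derivative_iff_has_vector_derivative)
      from has_vector_derivative_mult[OF has_vector_derivative_const[of "a \<gamma>"] this] show ?thesis by simp
    qed
    have "norm (?u' \<gamma> t) = norm (a \<gamma>) * norm (ladder (\<gamma> i) * hprod d (\<gamma>(i := \<gamma> i - 1)) (x(i := t))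
          - ladder (Suc (\<gamma> i)) * hprod d (\<gamma>(i := Suc (\<gamma> i))) (x(i := t)))"
    proof -
      have "?u' \<gamma> t = a \<gamma> * of_real (ladder (\<gamma> i) * hprod d (\<gamma>(i := \<gamma> i - 1)) (x(i := t))
          - ladder (Suc (\<gamma> i)) * hprod d (\<gamma>(i := Suc (\<gamma> i))) (x(i := t)))" by simp
      then show ?thesis by (simp only: norm_mult norm_of_real real_norm_def)
    qed
    also have "\<dots> \<le> norm (a \<gamma>) * (ladder (\<gamma> i) * hbound d (\<gamma>(i := \<gamma> i - 1)) + ladder (Suc (\<gamma> i)) * hbound d (\<gamma>(i := Suc (\<gamma> i))))"
      by (intro mult_left_mono norm_triangle_le_diff)
         (auto simp: abs_mult intro!: add_mono mult_left_mono hprod_bound)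
    finally show "norm (?u' \<gamma> t) \<le> ?M1 \<gamma> + ?M2 \<gamma>" by (simp add: algebra_simps)
  qed (use M norm_term_le rapid_hsummable[OF a] in \<open>auto simp: hsummable_def\<close>)
  moreover have "(\<Sum>\<^sub>\<infinity>\<gamma>\<in>mi d. ?u' \<gamma> t) = series d (shift_op False i a) (x(i := t))"
    using infsumI[OF series_ladder_terms[OF i a, of "x(i := t)" "- 1"]] unfolding series_shift_op[OF i a] by simp
  ultimately show ?thesis unfolding series_def[abs_def] by simp
qed

lemma pdiff_series:
  assumes "i < d" "rapid d a"
  shows "pdiff i (series d a) = series d (shift_op False i a)"
proof
  fix x
  have "((\<lambda>t. series d a (x(i := t))) has_vector_derivative series d (shift_op False i a) (x(i := x i))) (at (x i))"
    by (rule series_has_derivative[OF assms])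
  then show "pdiff i (series d a) x = series d (shift_op False i a) x"
    unfolding pdiff_def by (simp add: vector_derivative_at)
qed

text \<open>A word in the operators \<open>x_i\<close> and \<open>\<partial>_i\<close>, acting on coefficients.\<close>

definition word_op :: "(bool \<times> nat) list \<Rightarrow> ((nat \<Rightarrow> nat) \<Rightarrow> complex) \<Rightarrow> (nat \<Rightarrow> nat) \<Rightarrow> complex" where
  "word_op ws a = foldr (\<lambda>(b, i). shift_op b i) ws a"

lemma word_op_simps [simp]:
  "word_op [] a = a" "word_op ((b, i) # ws) a = shift_op b i (word_op ws a)"
  "word_op (us @ ws) a = word_op us (word_op ws a)"
  by (simp_all add: word_op_def)

lemma rapid_word_op: "snd ` set ws \<subseteq> {..<d} \<Longrightarrow> rapid d a \<Longrightarrow> rapid d (word_op ws a)"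
  by (induction ws) (auto intro!: rapid_shift_op)

lemma foldr_pdiff_series:
  "set js \<subseteq> {..<d} \<Longrightarrow> rapid d a \<Longrightarrow> foldr pdiff js (series d a) = series d (word_op (map (Pair False) js) a)"
proof (induction js)
  case (Cons j js)
  have "rapid d (word_op (map (Pair False) js) a)" using Cons.prems by (intro rapid_word_op) auto
  with Cons show ?case by (simp add: pdiff_series)
qed simp

lemma series_smooth:
  assumes a: "rapid d a" shows "smooth_fun d (series d a)"
  unfolding smooth_fun_def
proof (intro conjI allI impI)
  show "cylinder d (series d a)" by (rule series_cylinder)
  fix js assume js: "set js \<subseteq> {..<d}"
  have r: "rapid d (word_op (map (Pair False) js) a)" using js a by (intro rapid_word_op) auto
  show "continuous_on UNIV (foldr pdiff js (series d a))"
    unfolding foldr_pdiff_series[OF js a] by (intro series_continuous rapid_hsummable r)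
  fix i x assume "i < d"
  from series_has_derivative[OF this r]
  show "(\<lambda>t. foldr pdiff js (series d a) (x(i := t))) differentiable at (x i)"
    unfolding foldr_pdiff_series[OF js a] by (rule differentiableI_vector)
qed

definition diff_word :: "nat \<Rightarrow> (nat \<Rightarrow> nat) \<Rightarrow> (bool \<times> nat) list" where
  "diff_word d \<alpha> = concat (map (\<lambda>i. replicate (\<alpha> i) (False, i)) [0..<d])"

definition mult_word :: "nat \<Rightarrow> (nat \<Rightarrow> nat) \<Rightarrow> (bool \<times> nat) list" where
  "mult_word d \<beta> = concat (map (\<lambda>i. replicate (\<beta> i) (True, i)) [0..<d])"

lemma pdiff_pow_series:
  "i < d \<Longrightarrow> rapid d a \<Longrightarrow> (pdiff i ^^ k) (series d a) = series d (word_op (replicate k (False, i)) a)"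
  by (induction k) (auto simp: pdiff_series intro!: pdiff_series rapid_word_op)

lemma mdiff_series:
  assumes a: "rapid d a" shows "mdiff d \<alpha> (series d a) = series d (word_op (diff_word d \<alpha>) a)"
proof -
  have "set is \<subseteq> {..<d} \<Longrightarrow> foldr (\<lambda>i. pdiff i ^^ \<alpha> i) is (series d a) =
      series d (word_op (concat (map (\<lambda>i. replicate (\<alpha> i) (False, i)) is)) a)" for "is"
  proof (induction "is")
    case (Cons i "is")
    have "rapid d (word_op (concat (map (\<lambda>i. replicate (\<alpha> i) (False, i)) is)) a)"
      using Cons.prems by (intro rapid_word_op a) auto
    with Cons show ?case by (simp add: pdiff_pow_series)
  qed simp
  from this[of "[0..<d]"] show ?thesis unfolding mdiff_def diff_word_def by (simp add: atLeast0LessThan)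
qed

lemma mult_pow_series:
  assumes "i < d" "rapid d a"
  shows "of_real (x i) ^ k * series d a x = series d (word_op (replicate k (True, i)) a) x"
proof (induction k)
  case (Suc k)
  have "rapid d (word_op (replicate k (True, i)) a)" using assms by (intro rapid_word_op) auto
  then show ?case using Suc assms(1) by (simp add: mult.assoc series_mult)
qed simp

lemma monomial_series:
  assumes a: "rapid d a" shows "of_real (monomial d \<beta> x) * series d a x = series d (word_op (mult_word d \<beta>) a) x"
proof -
  have "set is \<subseteq> {..<d} \<Longrightarrow> of_real (\<Prod>i\<leftarrow>is. x i ^ \<beta> i) * series d a x =
      series d (word_op (concat (map (\<lambda>i. replicate (\<beta> i) (True, i)) is)) a) x" for "is"
  proof (induction "is")
    case (Cons i "is")
    have "rapid d (word_op (concat (map (\<lambda>i. replicate (\<beta> i) (True, i)) is)) a)"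
      using Cons.prems by (intro rapid_word_op a) auto
    with Cons show ?case by (simp add: mult_pow_series[symmetric] mult.assoc)
  qed simp
  from this[of "[0..<d]"] show ?thesis unfolding monomial_def mult_word_def
    using prod.distinct_set_conv_list[of "[0..<d]" "\<lambda>i. x i ^ \<beta> i"] by (simp add: atLeast0LessThan del: of_real_prod)
qed

lemma length_words [simp]:
  "length (diff_word d \<alpha>) = mlen d \<alpha>" "length (mult_word d \<beta>) = mlen d \<beta>"
  by (simp_all add: diff_word_def mult_word_def mlen_def length_concat comp_def interv_sum_list_conv_sum_set_nat atLeast0LessThan)

lemma set_words: "snd ` set (diff_word d \<alpha>) \<subseteq> {..<d}" "snd ` set (mult_word d \<beta>) \<subseteq> {..<d}"
  by (auto simp: diff_word_def mult_word_def)

lemma monomial_mdiff_series: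
  assumes a: "rapid d a"
  shows "of_real (monomial d \<beta> x) * mdiff d \<alpha> (series d a) x = series d (word_op (mult_word d \<beta> @ diff_word d \<alpha>) a) x"
  unfolding mdiff_series[OF a] by (subst monomial_series) (auto intro!: rapid_word_op a set_words)

subsection \<open>The Hermite expansion\<close>

text \<open>The product of the series with all \<open>1 + x_i^2\<close> is again a Hermite series with rapidly decreasing
  coefficients, hence bounded.\<close>

lemma series_quad_decay:
  assumes a: "rapid d a" shows "series d a \<in> quad_decay d"
proof -
  have "set is \<subseteq> {..<d} \<Longrightarrow> \<exists>b. rapid d b \<and> (\<forall>x. of_real (\<Prod>i\<leftarrow>is. 1 + (x i)\<^sup>2) * series d a x = series d b x)" for "is"
  proof (induction "is")
    case Nil then show ?case using a by auto
  next
    case (Cons i "is")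
    then obtain b where b: "rapid d b" "\<And>x. of_real (\<Prod>i\<leftarrow>is. 1 + (x i)\<^sup>2) * series d a x = series d b x" by auto
    let ?c = "\<lambda>\<gamma>. b \<gamma> + word_op [(True, i), (True, i)] b \<gamma>"
    have r2: "rapid d (word_op [(True, i), (True, i)] b)" using Cons.prems b by (intro rapid_word_op) auto
    have "of_real (\<Prod>i\<leftarrow>i # is. 1 + (x i)\<^sup>2) * series d a x = series d ?c x" for x
    proof -
      have "of_real (\<Prod>i\<leftarrow>i # is. 1 + (x i)\<^sup>2) * series d a x = (1 + of_real (x i) ^ 2) * series d b x"
        using b(2)[of x] by (simp add: mult.assoc)
      also have "\<dots> = series d b x + series d (word_op [(True, i), (True, i)] b) x"
        using mult_pow_series[of i d b x 2] Cons.prems b(1) by (simp add: algebra_simps numeral_2_eq_2)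
      also have "\<dots> = series d ?c x" by (rule series_add[symmetric]) (intro rapid_hsummable b r2)+
      finally show ?thesis .
    qed
    then show ?case using rapid_add[OF b(1) r2] by blast
  qed
  from this[of "[0..<d]"] obtain b where b: "rapid d b"
    "\<And>x. of_real (\<Prod>i\<leftarrow>[0..<d]. 1 + (x i)\<^sup>2) * series d a x = series d b x"
    by (auto simp: atLeast0LessThan)
  define C where "C = (\<Sum>\<^sub>\<infinity>\<gamma>\<in>mi d. norm (b \<gamma>) * hbound d \<gamma>)"
  have "norm (series d a x) \<le> C * decay_weight d x" for x
  proof -
    let ?P = "\<Prod>i<d. 1 + (x i)\<^sup>2"
    have P: "?P > 0" by (intro prod_pos) (auto simp: add_pos_nonneg)
    have "(\<Prod>i\<leftarrow>[0..<d]. 1 + (x i)\<^sup>2) = ?P"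
      using prod.distinct_set_conv_list[of "[0..<d]" "\<lambda>i. 1 + (x i)\<^sup>2"] by (simp add: atLeast0LessThan)
    then have "?P * norm (series d a x) = norm (series d b x)" using b(2)[of x, symmetric] P by (simp add: norm_mult del: of_real_prod)
    also have "\<dots> \<le> C" unfolding C_def by (intro series_norm_le rapid_hsummable b)
    finally have "norm (series d a x) \<le> C / ?P" using P by (simp add: field_simps)
    also have "\<dots> = C * decay_weight d x" unfolding decay_weight_def by (simp add: prod_dividef)
    finally show ?thesis .
  qed
  then show ?thesis unfolding quad_decay_def
    using series_cylinder series_continuous[OF rapid_hsummable[OF a]] by blast
qed

lemma coef_diff:
  assumes "f \<in> quad_decay d" "g \<in> quad_decay d"
  shows "coef d (\<lambda>x. f x - g x) \<gamma> = coef d f \<gamma> - coef d g \<gamma>"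
  unfolding coef_def left_diff_distrib
  by (rule Bochner_Integration.integral_diff) (intro integrable_times_hprod assms)+

text \<open>Both sides have the same coefficients.\<close>

lemma hermite_expansion:
  assumes f: "f \<in> quad_decay d" and c: "rapid d (coef d f)"
  shows "series d (coef d f) = f"
proof
  fix x
  let ?s = "series d (coef d f)"
  have s: "?s \<in> quad_decay d" by (rule series_quad_decay[OF c])
  obtain C where C: "\<And>x. norm (f x) \<le> C * decay_weight d x" using quad_decayD(4)[OF f] by auto
  obtain D where D: "\<And>x. norm (?s x) \<le> D * decay_weight d x" using quad_decayD(4)[OF s] by auto
  have "?s x - f x = 0"
  proof (rule coef_complete[where f = "\<lambda>x. ?s x - f x"])
    have "norm (?s x - f x) \<le> (D + C) * decay_weight d x" for x
      using norm_triangle_ineq4[of "?s x" "f x"] C[of x] D[of x] by (simp add: algebra_simps)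
    moreover have "cylinder d (\<lambda>x. ?s x - f x)"
      using quad_decayD(1)[OF f] quad_decayD(1)[OF s] unfolding cylinder_def by metis
    ultimately show "(\<lambda>x. ?s x - f x) \<in> quad_decay d"
      unfolding quad_decay_def using quad_decayD(2)[OF f] quad_decayD(2)[OF s] by (auto intro!: continuous_intros)
    fix \<gamma>
    have "coef d (\<lambda>x. ?s x - f x) \<gamma> = coef d ?s \<gamma> - coef d f \<gamma>" by (rule coef_diff[OF s f])
    also have "coef d ?s \<gamma> = coef d f \<gamma>"
      using coef_series[OF rapid_hsummable[OF c] mi_take_in[of d \<gamma>]] by (simp add: coef_mi_take)
    finally show "coef d (\<lambda>x. ?s x - f x) \<gamma> = 0" by simp
  qed
  then show "?s x = f x" by simp
qed

section \<open>Weighted function spaces and weighted sequence spaces\<close>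

text \<open>Each letter moves the index by one step up or down, with a factor of at most
  \<open>sqrt (|\<gamma>| + n)\<close>. So a word of length n leads from \<open>\<gamma>\<close> along \<open>2^n\<close> paths to indices of length at
  least \<open>|\<gamma>| - n\<close>.\<close>

lemma word_op_bound:
  fixes \<phi> :: "nat \<Rightarrow> real"
  assumes mono: "\<And>m n. m \<le> n \<Longrightarrow> \<phi> n \<le> \<phi> m" and nonneg: "\<And>m. 0 \<le> \<phi> m"
    and a: "\<And>\<gamma>. \<gamma> \<in> mi d \<Longrightarrow> norm (a \<gamma>) \<le> \<phi> (mlen d \<gamma>)"
  shows "snd ` set ws \<subseteq> {..<d} \<Longrightarrow> \<gamma> \<in> mi d \<Longrightarrow>
    norm (word_op ws a \<gamma>) \<le> 2 ^ length ws * sqrt (real (mlen d \<gamma> + length ws)) ^ length ws * \<phi> (mlen d \<gamma> - length ws)"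
proof (induction ws arbitrary: \<gamma>)
  case Nil
  then show ?case using a by simp
next
  case (Cons x ws)
  obtain b i where x: "x = (b, i)" by (cases x)
  have i: "i < d" and ws: "snd ` set ws \<subseteq> {..<d}" using Cons.prems x by auto
  let ?n = "length ws" and ?m = "mlen d \<gamma>" and ?a = "word_op ws a"
  let ?T = "2 ^ ?n * sqrt (real (?m + Suc ?n)) ^ Suc ?n * \<phi> (?m - Suc ?n)"
  have raise: "norm (raise_idx i ?a \<gamma>) \<le> ?T"
  proof -
    have "norm (?a (\<gamma>(i := Suc (\<gamma> i)))) \<le> 2 ^ ?n * sqrt (real (Suc ?m + ?n)) ^ ?n * \<phi> (Suc ?m - ?n)"
      unfolding mlen_up[OF i, symmetric] by (rule Cons.IH[OF ws]) (intro upd_in_mi i Cons.prems(2))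
    also have "Suc ?m + ?n = ?m + Suc ?n" by simp
    also have "2 ^ ?n * sqrt (real (?m + Suc ?n)) ^ ?n * \<phi> (Suc ?m - ?n) \<le> 2 ^ ?n * sqrt (real (?m + Suc ?n)) ^ ?n * \<phi> (?m - Suc ?n)"
      by (intro mult_left_mono mono) auto
    finally have 1: "norm (?a (\<gamma>(i := Suc (\<gamma> i)))) \<le> 2 ^ ?n * sqrt (real (?m + Suc ?n)) ^ ?n * \<phi> (?m - Suc ?n)" .
    have 2: "ladder (Suc (\<gamma> i)) \<le> sqrt (real (?m + Suc ?n))"
      unfolding ladder_def using le_mlen[OF i, of \<gamma>] by (intro real_sqrt_le_mono) simp
    have "norm (raise_idx i ?a \<gamma>) = ladder (Suc (\<gamma> i)) * norm (?a (\<gamma>(i := Suc (\<gamma> i))))"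
      by (simp add: raise_idx_def norm_mult)
    also have "\<dots> \<le> sqrt (real (?m + Suc ?n)) * (2 ^ ?n * sqrt (real (?m + Suc ?n)) ^ ?n * \<phi> (?m - Suc ?n))"
      by (intro mult_mono 1 2) auto
    finally show ?thesis by (simp add: ac_simps)
  qed
  have lower: "norm (lower_idx i ?a \<gamma>) \<le> ?T"
  proof (cases "\<gamma> i = 0")
    case True
    then show ?thesis using nonneg by (simp add: lower_idx_def)
  next
    case False
    have m: "Suc (mlen d (\<gamma>(i := \<gamma> i - 1))) = ?m" using mlen_down[OF i] False by simp
    have "norm (?a (\<gamma>(i := \<gamma> i - 1))) \<le> 2 ^ ?n * sqrt (real (mlen d (\<gamma>(i := \<gamma> i - 1)) + ?n)) ^ ?n * \<phi> (mlen d (\<gamma>(i := \<gamma> i - 1)) - ?n)"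
      by (rule Cons.IH[OF ws]) (intro upd_in_mi i Cons.prems(2))
    also have "\<dots> \<le> 2 ^ ?n * sqrt (real (?m + Suc ?n)) ^ ?n * \<phi> (?m - Suc ?n)"
      using m nonneg by (intro mult_mono mono power_mono real_sqrt_le_mono) auto
    finally have 1: "norm (?a (\<gamma>(i := \<gamma> i - 1))) \<le> 2 ^ ?n * sqrt (real (?m + Suc ?n)) ^ ?n * \<phi> (?m - Suc ?n)" .
    have 2: "ladder (\<gamma> i) \<le> sqrt (real (?m + Suc ?n))"
      unfolding ladder_def using le_mlen[OF i, of \<gamma>] by (intro real_sqrt_le_mono) simp
    have "norm (lower_idx i ?a \<gamma>) = ladder (\<gamma> i) * norm (?a (\<gamma>(i := \<gamma> i - 1)))"
      by (simp add: lower_idx_def norm_mult)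
    also have "\<dots> \<le> sqrt (real (?m + Suc ?n)) * (2 ^ ?n * sqrt (real (?m + Suc ?n)) ^ ?n * \<phi> (?m - Suc ?n))"
      by (intro mult_mono 1 2) auto
    finally show ?thesis by (simp add: ac_simps)
  qed
  have "norm (word_op (x # ws) a \<gamma>) \<le> norm (raise_idx i ?a \<gamma>) + norm (lower_idx i ?a \<gamma>)"
    unfolding x word_op_simps shift_op_def
    by (rule order_trans[OF norm_triangle_ineq]) (simp add: norm_mult)
  also have "\<dots> \<le> ?T + ?T" by (intro add_mono raise lower)
  finally show ?case by (simp add: ac_simps)
qed

lemma weighted_bound_nonneg:
  assumes "\<And>\<gamma> n. \<gamma> \<in> mi d \<Longrightarrow> norm (a \<gamma>) * mroot d \<gamma> ^ n \<le> w n"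
  shows "0 \<le> w n"
proof -
  have "0 \<le> norm (a (mi_take d (\<lambda>_. 0))) * mroot d (mi_take d (\<lambda>_. 0)) ^ n"
    using mroot_ge_1[of d "mi_take d (\<lambda>_. 0)"] by simp
  also have "\<dots> \<le> w n" by (rule assms[OF mi_take_in])
  finally show ?thesis .
qed

text \<open>This is \<open>word_op_bound\<close> for the minimum \<open>\<phi>\<close> of the bounds that the hypothesis gives for the
  exponents K and \<open>n + K\<close>. With \<open>u = |\<gamma>| - n\<close> the factor \<open>sqrt (|\<gamma>| + n)\<close> is at most \<open>sqrt 2\<close> times
  the larger of \<open>sqrt (1 + u)\<close> and \<open>sqrt (2 * n)\<close>. In the first case its n-th power is absorbed by
  the bound with exponent \<open>n + K\<close>, in the second case it is estimated by \<open>sqrt (2 * n) ^ n\<close>.\<close>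

lemma word_series_bound:
  assumes a: "\<And>\<gamma> n. \<gamma> \<in> mi d \<Longrightarrow> norm (a \<gamma>) * mroot d \<gamma> ^ n \<le> w n"
    and ws: "snd ` set ws \<subseteq> {..<d}" and n: "n = length ws" and \<gamma>: "\<gamma> \<in> mi d"
  shows "norm (word_op ws a \<gamma>) * mroot d \<gamma> ^ K \<le>
     2 ^ n * sqrt 2 ^ n * sqrt (1 + real n) ^ K * (w (n + K) + sqrt (2 * real n) ^ n * w K)"
proof -
  define r where "r = (\<lambda>t::nat. sqrt (1 + real t))"
  have r1: "r t \<ge> 1" for t by (simp add: r_def)
  have w0: "w k \<ge> 0" for k by (rule weighted_bound_nonneg[where a = a and w = w, OF a])
  define \<phi> where "\<phi> = (\<lambda>t. min (w K / r t ^ K) (w (n + K) / r t ^ (n + K)))"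
  have div_mono: "w k / r t ^ k \<le> w k / r u ^ k" if "u \<le> t" for k t u
    using r1[of u] r1[of t] w0 that by (intro divide_left_mono power_mono mult_pos_pos zero_less_power) (auto simp: r_def)
  have nb: "norm (word_op ws a \<gamma>) \<le> 2 ^ n * sqrt (real (mlen d \<gamma> + n)) ^ n * \<phi> (mlen d \<gamma> - n)"
    unfolding n
  proof (rule word_op_bound[OF _ _ _ ws \<gamma>])
    show "\<phi> t \<le> \<phi> u" if "u \<le> t" for t u unfolding \<phi>_def by (intro min.mono div_mono that)
    show "0 \<le> \<phi> m" for m unfolding \<phi>_def using w0 r1[of m] by (simp)
    show "norm (a \<delta>) \<le> \<phi> (mlen d \<delta>)" if "\<delta> \<in> mi d" for \<delta>
      using a[OF that, of K] a[OF that, of "n + K"] mroot_ge_1[of d \<delta>]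
      unfolding \<phi>_def r_def mroot_def by (auto simp: pos_le_divide_eq)
  qed
  define u where "u = mlen d \<gamma> - n"
  have mu: "mlen d \<gamma> \<le> u + n" unfolding u_def by simp
  have 1: "sqrt (real (mlen d \<gamma> + n)) ^ n \<le> sqrt 2 ^ n * (r u ^ n + sqrt (2 * real n) ^ n)"
  proof -
    have "sqrt (real (mlen d \<gamma> + n)) \<le> sqrt (2 * max (1 + real u) (2 * real n))"
    proof (rule real_sqrt_le_mono)
      have "real (mlen d \<gamma>) \<le> real u + real n" using mu by linarith
      then show "real (mlen d \<gamma> + n) \<le> 2 * max (1 + real u) (2 * real n)" by (auto simp: max_def)
    qed
    also have "\<dots> = sqrt 2 * max (r u) (sqrt (2 * real n))"
    proof -
      have "sqrt (max a b) = max (sqrt a) (sqrt b)" for a b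
        by (rule max_of_mono[symmetric]) (auto intro: monoI)
      then show ?thesis unfolding real_sqrt_mult[of 2 "max _ _"] r_def by simp
    qed
    finally have "sqrt (real (mlen d \<gamma> + n)) ^ n \<le> (sqrt 2 * max (r u) (sqrt (2 * real n))) ^ n"
      by (intro power_mono) auto
    also have "\<dots> = sqrt 2 ^ n * max (r u) (sqrt (2 * real n)) ^ n" by (simp add: power_mult_distrib)
    also have "\<dots> \<le> sqrt 2 ^ n * (r u ^ n + sqrt (2 * real n) ^ n)"
      using r1[of u] by (intro mult_left_mono) (auto simp: max_def)
    finally show ?thesis .
  qed
  have 2: "mroot d \<gamma> ^ K \<le> r u ^ K * sqrt (1 + real n) ^ K"
  proof -
    have "real (mlen d \<gamma>) \<le> real u + real n" using mu by linarith
    moreover have "0 \<le> real u * real n" by simp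
    ultimately have "1 + real (mlen d \<gamma>) \<le> 1 + real u + real n + real u * real n" by linarith
    then have "1 + real (mlen d \<gamma>) \<le> (1 + real u) * (1 + real n)" by (simp add: algebra_simps)
    then have "mroot d \<gamma> \<le> r u * sqrt (1 + real n)"
      unfolding mroot_def r_def real_sqrt_mult[symmetric] by (rule real_sqrt_le_mono)
    then show ?thesis unfolding power_mult_distrib[symmetric] using mroot_ge_1[of d \<gamma>] by (intro power_mono) auto
  qed
  have 3: "\<phi> u \<ge> 0" unfolding \<phi>_def using w0 r1[of u] by simp
  have "norm (word_op ws a \<gamma>) * mroot d \<gamma> ^ K \<le>
     (2 ^ n * (sqrt 2 ^ n * (r u ^ n + sqrt (2 * real n) ^ n)) * \<phi> u) * (r u ^ K * sqrt (1 + real n) ^ K)"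
  proof (rule mult_mono)
    have "2 ^ n * sqrt (real (mlen d \<gamma> + n)) ^ n * \<phi> u \<le> 2 ^ n * (sqrt 2 ^ n * (r u ^ n + sqrt (2 * real n) ^ n)) * \<phi> u"
      by (intro mult_right_mono mult_left_mono 1 3) auto
    with nb show "norm (word_op ws a \<gamma>) \<le> 2 ^ n * (sqrt 2 ^ n * (r u ^ n + sqrt (2 * real n) ^ n)) * \<phi> u"
      unfolding u_def by linarith
    show "0 \<le> 2 ^ n * (sqrt 2 ^ n * (r u ^ n + sqrt (2 * real n) ^ n)) * \<phi> u" using 3 r1[of u] by simp
    show "0 \<le> mroot d \<gamma> ^ K" using mroot_ge_1[of d \<gamma>] by simp
  qed (rule 2)
  also have "\<dots> = 2 ^ n * sqrt 2 ^ n * sqrt (1 + real n) ^ K * (r u ^ (n + K) * \<phi> u + sqrt (2 * real n) ^ n * (r u ^ K * \<phi> u))"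
    by (simp add: power_add algebra_simps)
  also have "\<dots> \<le> 2 ^ n * sqrt 2 ^ n * sqrt (1 + real n) ^ K * (w (n + K) + sqrt (2 * real n) ^ n * w K)"
  proof (intro mult_left_mono add_mono)
    have "r u ^ k * (w k / r u ^ k) = w k" for k using r1[of u] by simp
    moreover have "r u ^ k * \<phi> u \<le> r u ^ k * (w k / r u ^ k)" if "k = K \<or> k = n + K" for k
      using that r1[of u] unfolding \<phi>_def by (intro mult_left_mono) auto
    ultimately show "r u ^ (n + K) * \<phi> u \<le> w (n + K)" "r u ^ K * \<phi> u \<le> w K" by (metis, metis)
  qed auto
  finally show ?thesis .
qed

text \<open>From \<open>n^n \<le> e^n n!\<close>.\<close>

lemma sqrt_power_le_sqrt_fact: "sqrt (2 * real n) ^ n \<le> 4 ^ n * sqrt (fact n)"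
proof -
  have "real n ^ n / fact n \<le> exp (real n)" by (rule power_div_fact_le_exp) simp
  also have "\<dots> = exp 1 ^ n" by (simp add: exp_of_nat_mult[symmetric])
  also have "\<dots> \<le> 3 ^ n" using exp_le by (intro power_mono) auto
  finally have "real n ^ n \<le> 3 ^ n * fact n" by (simp add: field_simps)
  then have "(2 * real n) ^ n \<le> 2 ^ n * (3 ^ n * fact n)" by (simp add: power_mult_distrib)
  also have "\<dots> \<le> (4 ^ n)\<^sup>2 * fact n"
  proof -
    have "(2::real) ^ n * 3 ^ n = 6 ^ n" by (simp add: power_mult_distrib[symmetric])
    also have "\<dots> \<le> 16 ^ n" by (intro power_mono) auto
    also have "\<dots> = (4 ^ n)\<^sup>2" by (simp add: power2_eq_square power_mult_distrib[symmetric])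
    finally show ?thesis by (simp add: mult.assoc[symmetric] mult_right_mono)
  qed
  finally have "sqrt ((2 * real n) ^ n) \<le> sqrt ((4 ^ n)\<^sup>2 * fact n)" by (rule real_sqrt_le_mono)
  moreover have "sqrt ((4 ^ n)\<^sup>2 * fact n) = 4 ^ n * sqrt (fact n)"
    unfolding real_sqrt_mult real_sqrt_abs by simp
  ultimately show ?thesis by (simp only: real_sqrt_power)
qed

definition weighted_space :: "(nat \<Rightarrow> real) set \<Rightarrow> nat \<Rightarrow> seq_fun set" where
  "weighted_space W d = {f. smooth_fun d f \<and> (\<exists>w\<in>W. (\<forall>n. 0 \<le> w n) \<and>
     (\<forall>\<alpha> \<beta> x. \<bar>monomial d \<beta> x\<bar> * norm (mdiff d \<alpha> f x) \<le> w (mlen d \<alpha> + mlen d \<beta>)))}"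

definition weighted_seqs :: "(nat \<Rightarrow> real) set \<Rightarrow> nat \<Rightarrow> ((nat \<Rightarrow> nat) \<Rightarrow> complex) set" where
  "weighted_seqs W d = {a. \<exists>w\<in>W. \<forall>\<gamma>\<in>mi d. \<forall>n. norm (a \<gamma>) * mroot d \<gamma> ^ n \<le> w n}"

lemma weighted_seqsI:
  "w \<in> W \<Longrightarrow> (\<And>\<gamma> n. \<gamma> \<in> mi d \<Longrightarrow> norm (a \<gamma>) * mroot d \<gamma> ^ n \<le> w n) \<Longrightarrow> a \<in> weighted_seqs W d"
  unfolding weighted_seqs_def by blast

lemma weighted_seqs_rapid: "a \<in> weighted_seqs W d \<Longrightarrow> rapid d a"
  unfolding weighted_seqs_def rapid_def by blast

text \<open>The closure properties that the two directions of the characterisation and the factorization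
  require of a set of weights: \<open>sqrt_fact\<close> makes room for the Hermite functions themselves,
  \<open>saturate\<close> for the commutators of \<open>x_i\<close> and \<open>\<partial>_i\<close>, and \<open>halve\<close> says that the square root of an
  admissible sequence of coefficients is admissible.\<close>

locale weight_class =
  fixes W :: "(nat \<Rightarrow> real) set"
  assumes dominated: "\<And>v w. w \<in> W \<Longrightarrow> (\<And>n. v n \<le> w n) \<Longrightarrow> v \<in> W"
    and add: "\<And>v w. v \<in> W \<Longrightarrow> w \<in> W \<Longrightarrow> (\<lambda>n. v n + w n) \<in> W"
    and scale: "\<And>w c r. w \<in> W \<Longrightarrow> c > 0 \<Longrightarrow> r > 0 \<Longrightarrow> (\<lambda>n. c * r ^ n * w n) \<in> W"
    and shift: "\<And>w. w \<in> W \<Longrightarrow> (\<lambda>n. w (Suc n)) \<in> W"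
    and halve: "\<And>w. w \<in> W \<Longrightarrow> (\<lambda>n. sqrt (w (2 * n))) \<in> W"
    and sqrt_fact: "(\<lambda>n. sqrt (fact n)) \<in> W"
    and saturate: "\<And>w. w \<in> W \<Longrightarrow> (\<And>n. 0 \<le> w n) \<Longrightarrow>
      \<exists>v\<in>W. (\<forall>n. w n \<le> v n) \<and> (\<forall>n. real (n + 2) * v n \<le> v (n + 2))"
begin

lemma shift_add: "w \<in> W \<Longrightarrow> (\<lambda>n. w (n + k)) \<in> W"
proof (induction k)
  case (Suc k)
  then show ?case using shift[of "\<lambda>n. w (n + k)"] by simp
qed simp

lemma const_in: "(\<lambda>n. c) \<in> W"
proof (rule dominated[OF scale[OF sqrt_fact, of "\<bar>c\<bar> + 1" 1]])
  fix n
  have "(\<bar>c\<bar> + 1) * 1 \<le> (\<bar>c\<bar> + 1) * sqrt (fact n)" by (intro mult_left_mono) auto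
  then show "c \<le> (\<bar>c\<bar> + 1) * 1 ^ n * sqrt (fact n)" by simp
qed auto

lemma finite_sum: "finite I \<Longrightarrow> (\<And>i. i \<in> I \<Longrightarrow> w i \<in> W) \<Longrightarrow> (\<lambda>n. \<Sum>i\<in>I. w i n) \<in> W"
  by (induction I rule: finite_induct) (auto intro: const_in add)

text \<open>In \<open>word_series_bound\<close> the choice \<open>K = 6 * d\<close> makes the sum over all indices converge. What remains are
  shifts of the weight, exponential factors and \<open>sqrt (fact n)\<close>.\<close>

lemma series_in_weighted_space:
  assumes a: "a \<in> weighted_seqs W d" shows "series d a \<in> weighted_space W d"
proof -
  obtain w where w: "w \<in> W" "\<And>\<gamma> n. \<gamma> \<in> mi d \<Longrightarrow> norm (a \<gamma>) * mroot d \<gamma> ^ n \<le> w n"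
    using a unfolding weighted_seqs_def by auto
  have r: "rapid d a" by (rule weighted_seqs_rapid[OF a])
  have w0: "w k \<ge> 0" for k by (rule weighted_bound_nonneg[where a = a and w = w, OF w(2)])
  define K where "K = 6 * d"
  define B where "B = 2 ^ d * (\<Sum>\<^sub>\<infinity>\<gamma>\<in>mi d. inv_sq_prod d \<gamma>)"
  have B0: "B \<ge> 0" unfolding B_def by (intro mult_nonneg_nonneg infsum_nonneg) (auto simp: inv_sq_prod_def prod_nonneg)
  define v where "v = (\<lambda>n. (B + 1) * (2 * sqrt 2 * 2 ^ K) ^ n * (w (n + K) + ((w K + 1) * 4 ^ n * sqrt (fact n))))"
  have vW: "v \<in> W" unfolding v_def
    by (rule scale[OF add[OF shift_add[OF w(1)] scale[OF sqrt_fact]]]) (use B0 w0[of K] in auto)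
  have v0: "0 \<le> v n" for n unfolding v_def using B0 w0[of K] w0[of "n + K"] by simp
  have bound: "norm (series d (word_op ws a) x) \<le> v (length ws)" if ws: "snd ` set ws \<subseteq> {..<d}" for ws x
  proof -
    define n where "n = length ws"
    let ?E = "2 ^ n * sqrt 2 ^ n * sqrt (1 + real n) ^ K * (w (n + K) + sqrt (2 * real n) ^ n * w K)"
    note b = word_series_bound[OF w(2) ws n_def]
    have "norm (series d (word_op ws a) x) \<le> (\<Sum>\<^sub>\<infinity>\<gamma>\<in>mi d. norm (word_op ws a \<gamma>) * hbound d \<gamma>)"
      by (intro series_norm_le rapid_hsummable rapid_word_op ws r)
    also have "\<dots> \<le> ?E * 2 ^ d * (\<Sum>\<^sub>\<infinity>\<gamma>\<in>mi d. inv_sq_prod d \<gamma>)"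
      by (rule hsummable_bound(2)) (use b[of _ K] in \<open>auto simp: K_def\<close>)
    also have "\<dots> = B * ?E" by (simp add: B_def)
    also have "\<dots> \<le> (B + 1) * ((2 * sqrt 2 * 2 ^ K) ^ n * (w (n + K) + ((w K + 1) * 4 ^ n * sqrt (fact n))))"
    proof (rule mult_mono)
      have s: "sqrt (1 + real n) \<le> 2 ^ n"
      proof (rule real_le_lsqrt)
        have "1 + real n \<le> 2 ^ n" using Bernoulli_inequality[of 1 n] by simp
        also have "\<dots> \<le> (2 ^ n)\<^sup>2" by (simp add: power2_eq_square)
        finally show "1 + real n \<le> (2 ^ n)\<^sup>2" .
      qed auto
      have "sqrt (1 + real n) ^ K \<le> (2 ^ n) ^ K" by (intro power_mono s) auto
      also have "\<dots> = (2 ^ K) ^ n" by (simp add: power_mult[symmetric] mult.commute)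
      finally have "2 ^ n * sqrt 2 ^ n * sqrt (1 + real n) ^ K \<le> (2 * sqrt 2 * 2 ^ K) ^ n"
        unfolding power_mult_distrib by (intro mult_left_mono) auto
      moreover have "sqrt (2 * real n) ^ n * w K \<le> (w K + 1) * 4 ^ n * sqrt (fact n)"
      proof -
        have "sqrt (2 * real n) ^ n * w K \<le> (4 ^ n * sqrt (fact n)) * (w K + 1)"
          using w0[of K] by (intro mult_mono sqrt_power_le_sqrt_fact) auto
        then show ?thesis by (simp add: ac_simps)
      qed
      ultimately show "?E \<le> (2 * sqrt 2 * 2 ^ K) ^ n * (w (n + K) + ((w K + 1) * 4 ^ n * sqrt (fact n)))"
        using w0[of K] w0[of "n + K"] by (rule_tac mult_mono) auto
    qed (use B0 w0[of K] w0[of "n + K"] in auto)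
    also have "\<dots> = v n" by (simp add: v_def mult.assoc)
    finally show ?thesis by (simp add: n_def)
  qed
  have "\<bar>monomial d \<beta> x\<bar> * norm (mdiff d \<alpha> (series d a) x) \<le> v (mlen d \<alpha> + mlen d \<beta>)" for \<alpha> \<beta> x
  proof -
    have "\<bar>monomial d \<beta> x\<bar> * norm (mdiff d \<alpha> (series d a) x) = norm (of_real (monomial d \<beta> x) * mdiff d \<alpha> (series d a) x)"
      by (simp add: norm_mult)
    also have "\<dots> \<le> v (length (mult_word d \<beta> @ diff_word d \<alpha>))"
      unfolding monomial_mdiff_series[OF r] by (intro bound) (simp add: image_Un set_words)
    finally show ?thesis by (simp add: add.commute)
  qed
  then show ?thesis unfolding weighted_space_def using series_smooth[OF r] vW v0 by blast
qed

end

subsection \<open>Coefficient decay\<close>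

text \<open>The Hermite functions are eigenfunctions of the harmonic oscillator in the variable i.\<close>

lemma shift_op_oscillator:
  "shift_op True i (shift_op True i c) \<gamma> - shift_op False i (shift_op False i c) \<gamma> = of_real (2 * real (\<gamma> i) + 1) * c \<gamma>"
proof -
  let ?u = "\<gamma>(i := Suc (\<gamma> i))" and ?l = "\<gamma>(i := \<gamma> i - 1)"
  have RL: "raise_idx i (lower_idx i c) \<gamma> = of_real (ladder (Suc (\<gamma> i)) * ladder (Suc (\<gamma> i))) * c \<gamma>"
    by (simp add: raise_idx_def lower_idx_def)
  have LR: "lower_idx i (raise_idx i c) \<gamma> = of_real (ladder (\<gamma> i) * ladder (\<gamma> i)) * c \<gamma>"
  proof (cases "\<gamma> i")
    case (Suc k)
    then have "\<gamma>(i := Suc k) = \<gamma>" by auto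
    with Suc show ?thesis by (simp add: raise_idx_def lower_idx_def)
  qed (simp add: raise_idx_def lower_idx_def)
  have "shift_op True i (shift_op True i c) \<gamma> - shift_op False i (shift_op False i c) \<gamma>
     = 2 * (raise_idx i (lower_idx i c) \<gamma> + lower_idx i (raise_idx i c) \<gamma>)"
    by (simp add: shift_op_def raise_idx_def lower_idx_def algebra_simps)
  also have "\<dots> = of_real (2 * real (\<gamma> i) + 1) * c \<gamma>"
    unfolding RL LR ladder_sq by (simp add: algebra_simps)
  finally show ?thesis .
qed

lemma shift_op_linear:
  "shift_op b i (\<lambda>\<gamma>. u * a \<gamma> + v * c \<gamma>) \<gamma> = u * shift_op b i a \<gamma> + v * shift_op b i c \<gamma>"
  by (simp add: shift_op_def raise_idx_def lower_idx_def algebra_simps)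

lemma coef_linear:
  assumes "f \<in> quad_decay d" "g \<in> quad_decay d"
  shows "coef d (\<lambda>x. u * f x + v * g x) \<gamma> = u * coef d f \<gamma> + v * coef d g \<gamma>"
proof -
  have "(u * f x + v * g x) * of_real (hprod d \<gamma> x) = u * (f x * of_real (hprod d \<gamma> x)) + v * (g x * of_real (hprod d \<gamma> x))" for x
    by (simp add: algebra_simps)
  then show ?thesis unfolding coef_def using integrable_times_hprod[OF assms(1)] integrable_times_hprod[OF assms(2)]
    by simp
qed

lemma quad_decay_linear:
  assumes f: "f \<in> quad_decay d" and g: "g \<in> quad_decay d"
  shows "(\<lambda>x. u * f x + v * g x) \<in> quad_decay d"
proof -
  obtain C where C: "\<And>x. norm (f x) \<le> C * decay_weight d x" using quad_decayD(4)[OF f] by auto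
  obtain D where D: "\<And>x. norm (g x) \<le> D * decay_weight d x" using quad_decayD(4)[OF g] by auto
  have "norm (u * f x + v * g x) \<le> (norm u * C + norm v * D) * decay_weight d x" for x
  proof -
    have "norm (u * f x + v * g x) \<le> norm u * norm (f x) + norm v * norm (g x)"
      by (rule order_trans[OF norm_triangle_ineq]) (simp add: norm_mult)
    also have "\<dots> \<le> norm u * (C * decay_weight d x) + norm v * (D * decay_weight d x)"
      by (intro add_mono mult_left_mono C D) auto
    finally show ?thesis by (simp add: algebra_simps)
  qed
  moreover have "cylinder d (\<lambda>x. u * f x + v * g x)"
    using quad_decayD(1)[OF f] quad_decayD(1)[OF g] unfolding cylinder_def by metis
  moreover have "continuous_on UNIV (\<lambda>x. u * f x + v * g x)"
    by (intro continuous_intros quad_decayD(2)[OF f] quad_decayD(2)[OF g])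
  ultimately show ?thesis unfolding quad_decay_def by blast
qed

lemma mdiff_single: "i < d \<Longrightarrow> mdiff d (\<lambda>j. if j = i then q else 0) f = (pdiff i ^^ q) f"
proof -
  assume i: "i < d"
  have "distinct is \<Longrightarrow> foldr (\<lambda>j. pdiff j ^^ (if j = i then q else 0)) is f = (if i \<in> set is then (pdiff i ^^ q) f else f)" for "is"
    by (induction "is") auto
  from this[of "[0..<d]"] show ?thesis using i unfolding mdiff_def by simp
qed

lemma pdiff_pow_eq_foldr: "(pdiff i ^^ q) f = foldr pdiff (replicate q i) f"
  by (induction q) auto

lemma cylinder_pdiff:
  assumes "cylinder d f" "i < d" shows "cylinder d (pdiff i f)"
  unfolding cylinder_def pdiff_def
proof (intro allI impI)
  fix x y :: "nat \<Rightarrow> real" assume xy: "\<forall>i<d. x i = y i"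
  then have "f (x(i := t)) = f (y(i := t))" for t using assms(1) unfolding cylinder_def by auto
  then show "vector_derivative (\<lambda>t. f (x(i := t))) (at (x i)) = vector_derivative (\<lambda>t. f (y(i := t))) (at (y i))"
    using xy assms(2) by simp
qed

lemma cylinder_pdiff_pow: "cylinder d f \<Longrightarrow> i < d \<Longrightarrow> cylinder d ((pdiff i ^^ q) f)"
  by (induction q) (auto intro: cylinder_pdiff)

lemma smooth_pdiff_pow:
  assumes "smooth_fun d f" "i < d"
  shows "cylinder d ((pdiff i ^^ q) f)" "continuous_on UNIV ((pdiff i ^^ q) f)"
    "(\<lambda>t. (pdiff i ^^ q) f (x(i := t))) differentiable (at (x i))"
proof -
  have s: "set (replicate q i) \<subseteq> {..<d}" using assms(2) by auto
  show "continuous_on UNIV ((pdiff i ^^ q) f)" "(\<lambda>t. (pdiff i ^^ q) f (x(i := t))) differentiable (at (x i))"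
    using assms s unfolding smooth_fun_def pdiff_pow_eq_foldr by blast+
  show "cylinder d ((pdiff i ^^ q) f)" using assms unfolding smooth_fun_def by (intro cylinder_pdiff_pow) auto
qed

lemma monomial_upd: "i < d \<Longrightarrow> monomial d (\<beta>(i := \<beta> i + p)) x = monomial d \<beta> x * x i ^ p"
  unfolding monomial_def by (subst (1 2) prod.remove[of _ i]) (auto simp: power_add intro!: prod.cong)

text \<open>Take \<open>\<beta>_i = 2\<close> where \<open>|x_i| > 1\<close>, and \<open>\<beta>_i = 0\<close> elsewhere.\<close>

lemma decay_weight_monomial: "\<exists>\<beta>. mlen d \<beta> \<le> 2 * d \<and> 1 \<le> 2 ^ d * \<bar>monomial d \<beta> x\<bar> * decay_weight d x"
proof (intro exI conjI)
  let ?\<beta> = "\<lambda>j. if \<bar>x j\<bar> > 1 then 2 else 0 :: nat"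
  have "mlen d ?\<beta> \<le> (\<Sum>j<d. 2)" unfolding mlen_def by (intro sum_mono) auto
  then show "mlen d ?\<beta> \<le> 2 * d" by simp
  have "2 ^ d * \<bar>monomial d ?\<beta> x\<bar> * decay_weight d x = (\<Prod>i<d. 2 * \<bar>x i\<bar> ^ ?\<beta> i * (1 / (1 + (x i)\<^sup>2)))"
  proof -
    have 1: "2 ^ d = (\<Prod>i<d. 2 :: real)" by simp
    have 2: "\<bar>\<Prod>i<d. x i ^ ?\<beta> i\<bar> = (\<Prod>i<d. \<bar>x i\<bar> ^ ?\<beta> i)" by (simp only: abs_prod power_abs)
    show ?thesis unfolding monomial_def decay_weight_def 1 2 by (simp only: prod.distrib)
  qed
  also have "\<dots> \<ge> (\<Prod>i<d. 1)"
  proof (intro prod_mono conjI)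
    fix i
    have "1 + (x i)\<^sup>2 \<le> 2 * \<bar>x i\<bar> ^ ?\<beta> i"
    proof (cases "\<bar>x i\<bar> > 1")
      case True
      then have "1 \<le> \<bar>x i\<bar> ^ 2" by (intro one_le_power) auto
      then show ?thesis using True by simp
    next
      case False
      then have "\<bar>x i\<bar> ^ 2 \<le> 1" by (intro power_le_one) auto
      then show ?thesis using False by simp
    qed
    moreover have "0 < 1 + (x i)\<^sup>2" by (simp add: add_pos_nonneg)
    ultimately show "1 \<le> 2 * \<bar>x i\<bar> ^ ?\<beta> i * (1 / (1 + (x i)\<^sup>2))" by (simp add: pos_le_divide_eq)
  qed auto
  finally show "1 \<le> 2 ^ d * \<bar>monomial d ?\<beta> x\<bar> * decay_weight d x" by simp
qed

lemma decay_weight_dominates: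
  assumes "\<And>\<beta>. mlen d \<beta> \<le> 2 * d \<Longrightarrow> \<bar>monomial d \<beta> x\<bar> * g \<le> M" "0 \<le> g"
  shows "g \<le> 2 ^ d * M * decay_weight d x"
proof -
  obtain \<beta> where \<beta>: "mlen d \<beta> \<le> 2 * d" "1 \<le> 2 ^ d * \<bar>monomial d \<beta> x\<bar> * decay_weight d x"
    using decay_weight_monomial by blast
  have "g \<le> (2 ^ d * \<bar>monomial d \<beta> x\<bar> * decay_weight d x) * g"
    using mult_right_mono[OF \<beta>(2) assms(2)] by simp
  also have "\<dots> = (2 ^ d * decay_weight d x) * (\<bar>monomial d \<beta> x\<bar> * g)" by (simp add: ac_simps)
  also have "\<dots> \<le> (2 ^ d * decay_weight d x) * M"
    using decay_weight_pos[of d x] by (intro mult_left_mono assms(1) \<beta>(1)) auto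
  finally show ?thesis by (simp add: ac_simps)
qed

lemma mdiff_zero: "mdiff d (\<lambda>_. 0) f = f"
proof -
  have "foldr (\<lambda>i. pdiff i ^^ 0) xs f = f" for xs by (induction xs) auto
  then show ?thesis unfolding mdiff_def .
qed

lemma weighted_bound_single:
  assumes i: "i < d"
    and w: "\<And>\<alpha> \<beta> x. \<bar>monomial d \<beta> x\<bar> * norm (mdiff d \<alpha> f x) \<le> w (mlen d \<alpha> + mlen d \<beta>)"
    and w0: "\<And>n. 0 \<le> w n"
  shows "norm (of_real (x i) ^ p * (pdiff i ^^ q) f x) \<le> 2 ^ d * (\<Sum>k\<le>2 * d. w (p + q + k)) * decay_weight d x"
proof (rule decay_weight_dominates)
  fix \<beta> assume \<beta>: "mlen d \<beta> \<le> 2 * d"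
  let ?g = "norm (of_real (x i) ^ p * (pdiff i ^^ q) f x)"
  have "\<bar>monomial d \<beta> x\<bar> * ?g = \<bar>monomial d (\<beta>(i := \<beta> i + p)) x\<bar> * norm (mdiff d (\<lambda>j. if j = i then q else 0) f x)"
    unfolding monomial_upd[OF i] mdiff_single[OF i] by (simp add: norm_mult norm_power abs_mult power_abs)
  also have "\<dots> \<le> w (mlen d (\<lambda>j. if j = i then q else 0) + mlen d (\<beta>(i := \<beta> i + p)))" by (rule w)
  also have "mlen d (\<lambda>j. if j = i then q else 0) = q" unfolding mlen_def using i by simp
  also have "mlen d (\<beta>(i := \<beta> i + p)) = mlen d \<beta> + p" using mlen_upd[OF i, of \<beta> "\<beta> i + p"] by simp
  also have "w (q + (mlen d \<beta> + p)) = w (p + q + mlen d \<beta>)" by (simp add: ac_simps)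
  also have "\<dots> \<le> (\<Sum>k\<le>2 * d. w (p + q + k))"
    using \<beta> w0 by (intro member_le_sum[of "mlen d \<beta>" _ "\<lambda>k. w (p + q + k)"]) auto
  finally show "\<bar>monomial d \<beta> x\<bar> * ?g \<le> (\<Sum>k\<le>2 * d. w (p + q + k))" .
qed simp

text \<open>With \<open>D = \<partial>_i\<close> and \<open>x = x_i\<close>, this is the operator identity
  \<open>(x^2 - D^2) x^p D^q = x^(p+2) D^q - x^p D^(q+2) - 2 p x^(p-1) D^(q+1) - p (p-1) x^(p-2) D^q\<close>,
  read on coefficients.\<close>

lemma coef_oscillator_recursion:
  fixes f :: seq_fun
  assumes sm: "smooth_fun d f" and i: "i < d"
    and qd: "\<And>p q. (\<lambda>x. of_real (x i) ^ p * (pdiff i ^^ q) f x) \<in> quad_decay d"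
  defines "c \<equiv> \<lambda>p q. coef d (\<lambda>x. of_real (x i) ^ p * (pdiff i ^^ q) f x)"
  shows "of_real (2 * real (\<gamma> i) + 1) * c p q \<gamma> = c (p + 2) q \<gamma> - c p (q + 2) \<gamma>
     - of_nat (2 * p) * c (p - 1) (q + 1) \<gamma> - of_nat (p * (p - 1)) * c (p - 2) q \<gamma>"
proof -
  let ?g = "\<lambda>p q x. of_real (x i) ^ p * (pdiff i ^^ q) f x"
  have X: "c (Suc p) q = shift_op True i (c p q)" for p q
  proof
    fix \<gamma>
    have "c (Suc p) q \<gamma> = coef d (\<lambda>x. of_real (x i) * ?g p q x) \<gamma>" unfolding c_def by (simp add: mult.assoc)
    also have "\<dots> = shift_op True i (c p q) \<gamma>"
      unfolding coef_mult[OF qd i] c_def shift_op_def raise_idx_def lower_idx_def by simp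
    finally show "c (Suc p) q \<gamma> = shift_op True i (c p q) \<gamma>" .
  qed
  have vd: "((\<lambda>t. ?g p q (x(i := t))) has_vector_derivative
        (of_nat p * ?g (p - 1) q (x(i := t)) + 1 * ?g p (Suc q) (x(i := t)))) (at t)" for p q x t
  proof -
    have 1: "((\<lambda>t. complex_of_real t ^ p) has_vector_derivative of_nat p * of_real t ^ (p - 1)) (at t)"
      using has_vector_derivative_of_real[OF DERIV_pow[of p t], where 'a = complex] by simp
    have 2: "((\<lambda>t. (pdiff i ^^ q) f (x(i := t))) has_vector_derivative (pdiff i ^^ Suc q) f (x(i := t))) (at t)"
      using pdiff_has_vector_derivative[where f = "(pdiff i ^^ q) f" and i = i and x = x and t = t, OF smooth_pdiff_pow(3)[OF sm i]]
      by simp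
    show ?thesis using has_vector_derivative_mult[OF 1 2] by (simp add: algebra_simps)
  qed
  have pd: "pdiff i (?g p q) = (\<lambda>x. of_nat p * ?g (p - 1) q x + 1 * ?g p (Suc q) x)" for p q
  proof
    fix x
    from vd[where p = p and q = q and x = x and t = "x i"] have "((\<lambda>t. ?g p q (x(i := t))) has_vector_derivative
        (of_nat p * ?g (p - 1) q x + 1 * ?g p (Suc q) x)) (at (x i))" by simp
    then show "pdiff i (?g p q) x = of_nat p * ?g (p - 1) q x + 1 * ?g p (Suc q) x"
      unfolding pdiff_def by (rule vector_derivative_at)
  qed
  have D: "shift_op False i (c p q) = (\<lambda>\<gamma>. of_nat p * c (p - 1) q \<gamma> + 1 * c p (Suc q) \<gamma>)" for p q
  proof
    fix \<gamma>
    have lin: "coef d (pdiff i (?g p q)) \<gamma> = of_nat p * c (p - 1) q \<gamma> + 1 * c p (Suc q) \<gamma>"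
      unfolding pd c_def by (rule coef_linear[OF qd qd])
    have "coef d (pdiff i (?g p q)) \<gamma> = ladder (Suc (\<gamma> i)) * c p q (\<gamma>(i := Suc (\<gamma> i)))
           - ladder (\<gamma> i) * c p q (\<gamma>(i := \<gamma> i - 1))"
      unfolding c_def
    proof (rule coef_pdiff[OF qd i])
      show "pdiff i (?g p q) \<in> quad_decay d"
        unfolding pd by (rule quad_decay_linear[OF qd qd])
      show "(\<lambda>t. ?g p q (x(i := t))) differentiable at (x i)" for x
        using vd differentiableI_vector by blast
    qed
    with lin show "shift_op False i (c p q) \<gamma> = of_nat p * c (p - 1) q \<gamma> + 1 * c p (Suc q) \<gamma>"
      by (simp add: shift_op_def raise_idx_def lower_idx_def)
  qed
  have "of_real (2 * real (\<gamma> i) + 1) * c p q \<gamma> = c (Suc (Suc p)) q \<gamma> - shift_op False i (shift_op False i (c p q)) \<gamma>"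
    unfolding shift_op_oscillator[symmetric] X by simp
  also have "shift_op False i (shift_op False i (c p q)) \<gamma> =
     of_nat p * (of_nat (p - 1) * c (p - 1 - 1) q \<gamma> + 1 * c (p - 1) (Suc q) \<gamma>) +
     1 * (of_nat p * c (p - 1) (Suc q) \<gamma> + 1 * c p (Suc (Suc q)) \<gamma>)"
    by (simp only: D shift_op_linear)
  finally show ?thesis unfolding of_nat_mult by (simp add: algebra_simps numeral_2_eq_2)
qed

context weight_class
begin

text \<open>Iterating \<open>coef_oscillator_recursion\<close> N times bounds \<open>(2 \<gamma>_i + 1)^N |c(\<gamma>)|\<close> by \<open>5^N V(2 N)\<close> for a
  weight V that grows fast enough to absorb the factors p. The index i of the largest entry of \<open>\<gamma>\<close> turns
  this into decay in \<open>|\<gamma>|\<close>.\<close>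

lemma weighted_space_coef:
  assumes f: "f \<in> weighted_space W d"
  shows "f \<in> quad_decay d" "coef d f \<in> weighted_seqs W d"
proof -
  obtain w where w: "w \<in> W" "\<And>n. 0 \<le> w n"
    "\<And>\<alpha> \<beta> x. \<bar>monomial d \<beta> x\<bar> * norm (mdiff d \<alpha> f x) \<le> w (mlen d \<alpha> + mlen d \<beta>)"
    and sm: "smooth_fun d f" using f unfolding weighted_space_def by auto
  have fc: "cylinder d f" "continuous_on UNIV f"
  proof -
    show "cylinder d f" using sm unfolding smooth_fun_def by simp
    have "continuous_on UNIV (foldr pdiff [] f)" using sm unfolding smooth_fun_def by (metis empty_subsetI empty_set)
    then show "continuous_on UNIV f" by simp
  qed
  have qf: "f \<in> quad_decay d"
  proof -
    have "norm (f x) \<le> 2 ^ d * (\<Sum>k\<le>2 * d. w k) * decay_weight d x" for x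
    proof (rule decay_weight_dominates)
      fix \<beta> assume \<beta>: "mlen d \<beta> \<le> 2 * d"
      have "\<bar>monomial d \<beta> x\<bar> * norm (f x) \<le> w (mlen d \<beta>)"
        using w(3)[of \<beta> x "\<lambda>_. 0"] unfolding mdiff_zero by (simp add: mlen_def)
      also have "\<dots> \<le> (\<Sum>k\<le>2 * d. w k)" using \<beta> w(2) by (intro member_le_sum) auto
      finally show "\<bar>monomial d \<beta> x\<bar> * norm (f x) \<le> (\<Sum>k\<le>2 * d. w k)" .
    qed simp
    then show ?thesis unfolding quad_decay_def using fc by blast
  qed
  then show "f \<in> quad_decay d" .
  define I where "I = (\<integral>x. decay_weight d x \<partial>leb d)"
  have I0: "I \<ge> 0" unfolding I_def using decay_weight_pos[of d] by (intro Bochner_Integration.integral_nonneg) (auto simp: less_imp_le)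
  define w1 where "w1 = (\<lambda>n. \<Sum>k\<le>2 * d. w (n + k))"
  have w1: "w1 \<in> W" "\<And>n. 0 \<le> w1 n" unfolding w1_def by (auto intro!: finite_sum shift_add w sum_nonneg)
  define w2 where "w2 = (\<lambda>n. (2 ^ d * (I + 1)) * 1 ^ n * w1 n)"
  have w2: "w2 \<in> W" unfolding w2_def by (rule scale[OF w1(1)]) (use I0 in auto)
  have w20: "\<And>n. 0 \<le> w2 n" unfolding w2_def using I0 w1(2) by simp
  obtain V where V: "V \<in> W" "\<And>n. w2 n \<le> V n" "\<And>n. real (n + 2) * V n \<le> V (n + 2)"
    using saturate[OF w2 w20] by blast
  have V0: "V n \<ge> 0" for n using w20[of n] V(2)[of n] by linarith
  have coefb: "norm (coef d g \<gamma>) \<le> hbound d \<gamma> * V n"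
    if g: "g \<in> quad_decay d" and b: "\<And>x. norm (g x) \<le> 2 ^ d * w1 n * decay_weight d x" for g \<gamma> n
  proof -
    have "(\<integral>x. norm (g x) \<partial>leb d) \<le> (\<integral>x. 2 ^ d * w1 n * decay_weight d x \<partial>leb d)"
      using quad_decay_integrable[OF g] decay_weight_integrable b by (intro integral_mono) auto
    also have "\<dots> = 2 ^ d * w1 n * I" by (simp add: I_def)
    also have "\<dots> \<le> w2 n" unfolding w2_def using w1(2)[of n] by (simp add: algebra_simps)
    also have "\<dots> \<le> V n" by (rule V)
    finally have "(\<integral>x. norm (g x) \<partial>leb d) \<le> V n" .
    then have "hbound d \<gamma> * (\<integral>x. norm (g x) \<partial>leb d) \<le> hbound d \<gamma> * V n" by (intro mult_left_mono) auto
    with coef_norm_le[OF quad_decay_integrable[OF g], of \<gamma>] show ?thesis by linarith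
  qed
  \<comment> \<open>The terms of \<open>coef_oscillator_recursion\<close> contribute 1, 1, 2 and 1 to the factor 5, because each
    factor p is absorbed by the growth of V.\<close>
  have osc: "(2 * real (\<gamma> i) + 1) ^ N * norm (coef d f \<gamma>) \<le> 5 ^ N * V (2 * N) * hbound d \<gamma>" if i: "i < d" for i N \<gamma>
  proof -
    let ?g = "\<lambda>p q x. of_real (x i) ^ p * (pdiff i ^^ q) f x"
    have gb: "norm (?g p q x) \<le> 2 ^ d * w1 (p + q) * decay_weight d x" for p q x
      unfolding w1_def by (rule weighted_bound_single[OF i w(3) w(2)])
    have gq: "?g p q \<in> quad_decay d" for p q
    proof -
      have "cylinder d (?g p q)" using smooth_pdiff_pow(1)[OF sm i, of q] i unfolding cylinder_def by metis
      moreover have "continuous_on UNIV (?g p q)" using smooth_pdiff_pow(2)[OF sm i, of q]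
        by (intro continuous_intros) auto
      ultimately show ?thesis unfolding quad_decay_def using gb by blast
    qed
    define c where "c = (\<lambda>p q. coef d (?g p q))"
    have rec: "of_real (2 * real (\<gamma> i) + 1) * c p q \<gamma> = c (p + 2) q \<gamma> - c p (q + 2) \<gamma>
     - of_nat (2 * p) * c (p - 1) (q + 1) \<gamma> - of_nat (p * (p - 1)) * c (p - 2) q \<gamma>" for p q
      unfolding c_def by (rule coef_oscillator_recursion[OF sm i gq])
    have "(2 * real (\<gamma> i) + 1) ^ N * norm (c p q \<gamma>) \<le> 5 ^ N * V (p + q + 2 * N) * hbound d \<gamma>" for p q
    proof (induction N arbitrary: p q)
      case 0
      show ?case using coefb[OF gq gb, of p q \<gamma>] by (simp add: c_def mult.commute)
    next
      case (Suc N)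
      let ?L = "2 * real (\<gamma> i) + 1" and ?h = "hbound d \<gamma>" and ?m = "p + q + 2 * N"
      have L0: "?L ^ N \<ge> 0" by simp
      have "norm (of_real ?L * c p q \<gamma>) \<le> norm (c (p + 2) q \<gamma>) + norm (c p (q + 2) \<gamma>)
          + real (2 * p) * norm (c (p - 1) (q + 1) \<gamma>) + real (p * (p - 1)) * norm (c (p - 2) q \<gamma>)"
        unfolding rec
        by (intro order_trans[OF norm_triangle_ineq4] add_mono) (simp_all add: norm_mult)
      then have "?L ^ N * norm (of_real ?L * c p q \<gamma>) \<le> ?L ^ N * (norm (c (p + 2) q \<gamma>) + norm (c p (q + 2) \<gamma>)
          + real (2 * p) * norm (c (p - 1) (q + 1) \<gamma>) + real (p * (p - 1)) * norm (c (p - 2) q \<gamma>))"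
        by (intro mult_left_mono L0)
      also have "\<dots> = ?L ^ N * norm (c (p + 2) q \<gamma>) + ?L ^ N * norm (c p (q + 2) \<gamma>)
          + real (2 * p) * (?L ^ N * norm (c (p - 1) (q + 1) \<gamma>)) + real (p * (p - 1)) * (?L ^ N * norm (c (p - 2) q \<gamma>))"
        by (simp add: algebra_simps)
      also have "\<dots> \<le> 5 ^ N * V (p + 2 + q + 2 * N) * ?h + 5 ^ N * V (p + (q + 2) + 2 * N) * ?h
          + real (2 * p) * (5 ^ N * V (p - 1 + (q + 1) + 2 * N) * ?h)
          + real (p * (p - 1)) * (5 ^ N * V (p - 2 + q + 2 * N) * ?h)"
        by (intro add_mono mult_left_mono Suc) auto
      also have "\<dots> = 5 ^ N * ?h * (2 * V (?m + 2) + 2 * (real p * V (p - 1 + (q + 1) + 2 * N))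
          + real (p * (p - 1)) * V (p - 2 + q + 2 * N))"
        by (simp add: algebra_simps)
      also have "\<dots> \<le> 5 ^ N * ?h * (2 * V (?m + 2) + 2 * V (?m + 2) + V (?m + 2))"
      proof (intro mult_left_mono add_mono)
        show "real p * V (p - 1 + (q + 1) + 2 * N) \<le> V (?m + 2)"
        proof (cases p)
          case (Suc k)
          have "real p * V ?m \<le> real (?m + 2) * V ?m" by (intro mult_right_mono V0) auto
          also have "\<dots> \<le> V (?m + 2)" by (rule V(3))
          finally show ?thesis using Suc by (simp add: add.commute add.left_commute)
        qed (use V0 in simp)
        show "real (p * (p - 1)) * V (p - 2 + q + 2 * N) \<le> V (?m + 2)"
        proof (cases "p \<ge> 2")
          case True
          define m' where "m' = p - 2 + q + 2 * N"
          have m: "?m = m' + 2" unfolding m'_def using True by simp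
          have "real p * V m' \<le> real (m' + 2) * V m'"
            using True unfolding m'_def by (intro mult_right_mono V0) auto
          also have "\<dots> \<le> V ?m" unfolding m by (rule V(3))
          finally have 1: "real p * V m' \<le> V ?m" .
          have "real (p * (p - 1)) * V m' = real (p - 1) * (real p * V m')" by simp
          also have "\<dots> \<le> real (p - 1) * V ?m" by (intro mult_left_mono 1) auto
          also have "\<dots> \<le> real (?m + 2) * V ?m" by (intro mult_right_mono V0) auto
          also have "\<dots> \<le> V (?m + 2)" by (rule V(3))
          finally show ?thesis unfolding m'_def .
        next
          case False
          then have "p = 0 \<or> p = 1" by auto
          then show ?thesis using V0 by auto
        qed
      qed (auto)
      finally have "?L ^ N * norm (of_real ?L * c p q \<gamma>) \<le> 5 ^ Suc N * V (?m + 2) * ?h"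
        by (simp add: algebra_simps)
      then show ?case by (simp add: norm_mult ac_simps del: of_real_add of_real_mult)
    qed
    from this[of 0 0] show ?thesis by (simp add: c_def)
  qed
  \<comment> \<open>5 comes from the oscillator estimate, and \<open>d + 1\<close> from \<open>1 + |\<gamma>| \<le> (d + 1) (2 \<gamma>_i + 1)\<close> for the
    largest entry \<open>\<gamma>_i\<close>. The term \<open>V 0\<close> covers \<open>d = 0\<close>, where there is no oscillator.\<close>
  define A where "A = 5 * (real d + 1)"
  define v where "v = (\<lambda>n. (2 ^ d * A ^ (3 * d)) * A ^ n * (V (n + 6 * d) + V (n + Suc (6 * d))) + V 0)"
  have A1: "A \<ge> 1" by (simp add: A_def)
  have vW: "v \<in> W" unfolding v_def
    by (rule add[OF scale[OF add[OF shift_add[OF V(1)] shift_add[OF V(1)]]] const_in]) (use A1 in auto)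
  have "norm (coef d f \<gamma>) * mroot d \<gamma> ^ n \<le> v n" if \<gamma>: "\<gamma> \<in> mi d" for \<gamma> n
  proof (cases "d = 0")
    case True
    have "norm (coef d f \<gamma>) \<le> hbound d \<gamma> * V 0"
    proof (rule coefb[OF qf])
      fix x
      have "\<bar>monomial d (\<lambda>_. 0) x\<bar> * norm (mdiff d (\<lambda>_. 0) f x) \<le> w (mlen d (\<lambda>_. 0) + mlen d (\<lambda>_. 0))" by (rule w)
      then show "norm (f x) \<le> 2 ^ d * w1 0 * decay_weight d x"
        using True by (simp add: w1_def decay_weight_def monomial_def mdiff_def mlen_def)
    qed
    moreover have "0 \<le> A ^ n * (V n + V (Suc n))" using A1 V0 by simp
    ultimately show ?thesis using True by (simp add: hbound_def mroot_def mlen_def v_def)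
  next
    case False
    \<comment> \<open>The oscillator gives even powers of \<open>mroot\<close> only; the extra \<open>3 * d\<close> steps below compensate the
      factor \<open>hbound d \<gamma>\<close>, which the trivial bound of a coefficient costs.\<close>
    define N where "N = (n + 1) div 2"
    have N: "n \<le> 2 * N" "2 * N = n \<or> 2 * N = Suc n" "N \<le> n" unfolding N_def by auto
    obtain i where i: "i < d" "\<And>j. j < d \<Longrightarrow> \<gamma> j \<le> \<gamma> i"
    proof -
      have ne: "\<gamma> ` {..<d} \<noteq> {}" "finite (\<gamma> ` {..<d})" using False by auto
      obtain i where "i < d" "\<gamma> i = Max (\<gamma> ` {..<d})" using Max_in[OF ne(2,1)] by auto
      then show thesis using that ne by simp
    qed
    let ?L = "2 * real (\<gamma> i) + 1"
    have "mlen d \<gamma> \<le> d * \<gamma> i" unfolding mlen_def using sum_bounded_above[of "{..<d}" \<gamma> "\<gamma> i"] i by simp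
    then have "real (mlen d \<gamma>) \<le> real d * real (\<gamma> i)" by (simp only: of_nat_mult[symmetric] of_nat_le_iff)
    then have m2: "mroot d \<gamma> ^ 2 \<le> (real d + 1) * ?L" unfolding mroot_sq by (simp add: algebra_simps)
    have "norm (coef d f \<gamma>) * mroot d \<gamma> ^ (2 * N + 6 * d) = norm (coef d f \<gamma>) * (mroot d \<gamma> ^ 2) ^ (N + 3 * d)"
      by (simp add: power_mult[symmetric] algebra_simps)
    also have "\<dots> \<le> norm (coef d f \<gamma>) * ((real d + 1) * ?L) ^ (N + 3 * d)"
      by (intro mult_left_mono power_mono m2) auto
    also have "\<dots> = (real d + 1) ^ (N + 3 * d) * (?L ^ (N + 3 * d) * norm (coef d f \<gamma>))"
      by (simp add: power_mult_distrib)
    also have "\<dots> \<le> (real d + 1) ^ (N + 3 * d) * (5 ^ (N + 3 * d) * V (2 * (N + 3 * d)) * hbound d \<gamma>)"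
      by (intro mult_left_mono osc[OF i(1)]) auto
    also have "\<dots> = A ^ (N + 3 * d) * V (2 * N + 6 * d) * hbound d \<gamma>"
    proof -
      have "A ^ (N + 3 * d) = 5 ^ (N + 3 * d) * (real d + 1) ^ (N + 3 * d)"
        unfolding A_def by (rule power_mult_distrib)
      moreover have "2 * (N + 3 * d) = 2 * N + 6 * d" by simp
      ultimately show ?thesis by (simp only: ac_simps)
    qed
    also have "\<dots> \<le> A ^ (N + 3 * d) * V (2 * N + 6 * d) * (2 ^ d * mroot d \<gamma> ^ (6 * d))"
    proof (intro mult_left_mono mult_nonneg_nonneg V0)
      have "inv_sq_prod d \<gamma> \<le> 1" unfolding inv_sq_prod_def by (intro prod_le_1) (auto simp: field_simps)
      then have "2 ^ d * mroot d \<gamma> ^ (6 * d) * inv_sq_prod d \<gamma> \<le> 2 ^ d * mroot d \<gamma> ^ (6 * d) * 1"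
        using mroot_ge_1[of d \<gamma>] by (intro mult_left_mono) auto
      with hbound_le[of d \<gamma>] show "hbound d \<gamma> \<le> 2 ^ d * mroot d \<gamma> ^ (6 * d)" by linarith
    qed (use A1 in auto)
    finally have "(norm (coef d f \<gamma>) * mroot d \<gamma> ^ (2 * N)) * mroot d \<gamma> ^ (6 * d) \<le>
        (2 ^ d * A ^ (N + 3 * d) * V (2 * N + 6 * d)) * mroot d \<gamma> ^ (6 * d)"
      by (simp only: power_add[of "mroot d \<gamma>"] ac_simps)
    then have "norm (coef d f \<gamma>) * mroot d \<gamma> ^ (2 * N) \<le> 2 ^ d * A ^ (N + 3 * d) * V (2 * N + 6 * d)"
      using mroot_ge_1[of d \<gamma>] by (subst (asm) mult_le_cancel_right_pos) auto
    moreover have "norm (coef d f \<gamma>) * mroot d \<gamma> ^ n \<le> norm (coef d f \<gamma>) * mroot d \<gamma> ^ (2 * N)"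
      using N(1) mroot_ge_1[of d \<gamma>] by (intro mult_left_mono power_increasing) auto
    moreover have "2 ^ d * A ^ (N + 3 * d) * V (2 * N + 6 * d) \<le> 2 ^ d * A ^ (n + 3 * d) * (V (n + 6 * d) + V (n + Suc (6 * d)))"
      using N A1 V0 by (intro mult_mono mult_left_mono power_increasing) (auto intro!: mult_nonneg_nonneg)
    ultimately have "norm (coef d f \<gamma>) * mroot d \<gamma> ^ n \<le> 2 ^ d * A ^ (n + 3 * d) * (V (n + 6 * d) + V (n + Suc (6 * d)))"
      by (meson order_trans)
    also have "2 ^ d * A ^ (n + 3 * d) = 2 ^ d * A ^ (3 * d) * A ^ n" by (simp only: power_add ac_simps)
    finally show ?thesis unfolding v_def using V0[of 0] by (rule add_increasing2[rotated])
  qed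
  then show "coef d f \<in> weighted_seqs W d" unfolding weighted_seqs_def using vW by blast
qed

lemma weighted_space_expansion:
  assumes "f \<in> weighted_space W d" shows "series d (coef d f) = f"
  using weighted_space_coef[OF assms] weighted_seqs_rapid by (intro hermite_expansion) auto

end

section \<open>The Schwartz space and the Gelfand-Shilov spaces as weighted spaces\<close>

lemma fact_add_le: "(fact (a + b) :: real) \<le> 2 ^ (a + b) * fact a * fact b"
proof -
  have "(fact (a + b) :: real) = real ((a + b) choose a) * fact a * fact b"
    using binomial_fact_lemma[of a "a + b", THEN arg_cong[where f = real]] by (simp add: ac_simps)
  also have "real ((a + b) choose a) \<le> 2 ^ (a + b)"
    using binomial_le_pow2[of "a + b" a] by (metis of_nat_le_iff of_nat_numeral of_nat_power)
  finally show ?thesis by (simp add: mult_right_mono)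
qed

lemma fact_mult_le: "(fact a * fact b :: real) \<le> fact (a + b)"
proof -
  have "fact a * fact b dvd (fact (a + b) :: nat)" by (rule fact_fact_dvd_fact)
  then have "fact a * fact b \<le> (fact (a + b) :: nat)" by (rule dvd_imp_le) simp
  then show ?thesis by (metis of_nat_fact of_nat_le_iff of_nat_mult)
qed

lemma fact_mlen_le: "fact (mlen d \<alpha>) \<le> (2 ^ d) ^ mlen d \<alpha> * mfact d \<alpha>"
proof (induction d)
  case (Suc d)
  have "fact (mlen (Suc d) \<alpha>) \<le> (2 ^ (mlen d \<alpha> + \<alpha> d) * fact (mlen d \<alpha>) * fact (\<alpha> d) :: real)"
    unfolding mlen_def using fact_add_le by simp
  also have "\<dots> \<le> 2 ^ (mlen d \<alpha> + \<alpha> d) * ((2 ^ d) ^ mlen d \<alpha> * mfact d \<alpha>) * fact (\<alpha> d)"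
    by (intro mult_right_mono mult_left_mono Suc) auto
  also have "\<dots> \<le> 2 ^ (mlen d \<alpha> + \<alpha> d) * ((2 ^ d) ^ (mlen d \<alpha> + \<alpha> d) * mfact d \<alpha>) * fact (\<alpha> d)"
    by (intro mult_right_mono mult_left_mono power_increasing) (auto simp: mfact_def prod_nonneg)
  also have "\<dots> = (2 ^ Suc d) ^ mlen (Suc d) \<alpha> * mfact (Suc d) \<alpha>"
    unfolding mlen_def mfact_def by (simp add: power_mult_distrib ac_simps)
  finally show ?case .
qed (simp add: mlen_def mfact_def)

lemma mfact_ge_1: "mfact d \<alpha> \<ge> 1"
  unfolding mfact_def by (rule prod_ge_1) simp

lemma mfact_le: "mfact d \<alpha> \<le> fact (mlen d \<alpha>)"
proof (induction d)
  case (Suc d)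
  have "mfact (Suc d) \<alpha> \<le> fact (mlen d \<alpha>) * fact (\<alpha> d)"
    using Suc unfolding mfact_def by simp
  also have "\<dots> \<le> fact (mlen (Suc d) \<alpha>)" unfolding mlen_def using fact_mult_le by simp
  finally show ?case .
qed (simp add: mlen_def mfact_def)

lemma mfact_mult_le: "mfact d \<alpha> * mfact d \<beta> \<le> fact (mlen d \<alpha> + mlen d \<beta>)"
  by (rule order_trans[OF mult_mono[OF mfact_le mfact_le] fact_mult_le])
     (use mfact_ge_1[of d] in \<open>auto intro: order_trans[OF zero_le_one]\<close>)

lemma fact_le_mfact_mult:
  "fact (mlen d \<alpha> + mlen d \<beta>) \<le> (2 ^ Suc d) ^ (mlen d \<alpha> + mlen d \<beta>) * (mfact d \<alpha> * mfact d \<beta>)"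
proof -
  let ?a = "mlen d \<alpha>" and ?b = "mlen d \<beta>"
  have "fact (?a + ?b) \<le> 2 ^ (?a + ?b) * (fact ?a * fact ?b :: real)" using fact_add_le[of ?a ?b] by (simp add: ac_simps)
  also have "\<dots> \<le> 2 ^ (?a + ?b) * (((2 ^ d) ^ ?a * mfact d \<alpha>) * ((2 ^ d) ^ ?b * mfact d \<beta>))"
    using mfact_ge_1[of d \<alpha>] by (intro mult_left_mono mult_mono fact_mlen_le) auto
  also have "\<dots> = (2 ^ Suc d) ^ (?a + ?b) * (mfact d \<alpha> * mfact d \<beta>)"
    by (simp add: power_add power_mult_distrib ac_simps)
  finally show ?thesis .
qed

subsection \<open>Factorial growth classes\<close>

definition growth :: "real \<Rightarrow> real \<Rightarrow> (nat \<Rightarrow> real) \<Rightarrow> bool" where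
  "growth s h w \<longleftrightarrow> (\<exists>C. \<forall>n. w n \<le> C * h ^ n * fact n powr s)"

definition some_growth :: "real \<Rightarrow> (nat \<Rightarrow> real) set" where
  "some_growth s = {w. \<exists>h>0. growth s h w}"

definition every_growth :: "real \<Rightarrow> (nat \<Rightarrow> real) set" where
  "every_growth s = {w. \<forall>h>0. growth s h w}"

lemma growthE:
  assumes "growth s h w" "h > 0"
  obtains C where "C \<ge> 0" "\<And>n. w n \<le> C * h ^ n * fact n powr s"
proof -
  obtain C where C: "\<And>n. w n \<le> C * h ^ n * fact n powr s" using assms unfolding growth_def by auto
  have "w n \<le> \<bar>C\<bar> * h ^ n * fact n powr s" for n
    by (rule order_trans[OF C]) (intro mult_right_mono, use assms in auto)
  then show thesis using that[of "\<bar>C\<bar>"] by simp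
qed

lemma growth_dominated: "growth s h w \<Longrightarrow> (\<And>n. v n \<le> w n) \<Longrightarrow> growth s h v"
  unfolding growth_def by (meson order_trans)

lemma growth_mono: assumes "growth s h w" "0 < h" "h \<le> h'" shows "growth s h' w"
proof -
  obtain C where C: "C \<ge> 0" "\<And>n. w n \<le> C * h ^ n * fact n powr s" using growthE[OF assms(1,2)] by blast
  have "w n \<le> C * h' ^ n * fact n powr s" for n
    by (rule order_trans[OF C(2)]) (intro mult_right_mono mult_left_mono power_mono, use assms C in auto)
  then show ?thesis unfolding growth_def by blast
qed

lemma growth_add: "growth s h v \<Longrightarrow> growth s h w \<Longrightarrow> growth s h (\<lambda>n. v n + w n)"
proof -
  assume "growth s h v" "growth s h w"
  then obtain C D where "\<And>n. v n \<le> C * h ^ n * fact n powr s" "\<And>n. w n \<le> D * h ^ n * fact n powr s"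
    unfolding growth_def by auto
  then have "v n + w n \<le> (C + D) * h ^ n * fact n powr s" for n
    by (simp add: distrib_right add_mono)
  then show ?thesis unfolding growth_def by blast
qed

lemma growth_scale: assumes "growth s h w" "c > 0" "r > 0" shows "growth s (r * h) (\<lambda>n. c * r ^ n * w n)"
proof -
  obtain C where C: "\<And>n. w n \<le> C * h ^ n * fact n powr s" using assms(1) unfolding growth_def by auto
  have "c * r ^ n * w n \<le> (c * C) * (r * h) ^ n * fact n powr s" for n
  proof -
    have "c * r ^ n * w n \<le> c * r ^ n * (C * h ^ n * fact n powr s)"
      using assms C by (intro mult_left_mono) auto
    then show ?thesis by (simp add: power_mult_distrib ac_simps)
  qed
  then show ?thesis unfolding growth_def by blast
qed

lemma power_powr_swap: "((x :: real) ^ n) powr s = (x powr s) ^ n"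
  by (induction n) (simp_all add: powr_mult)

lemma growth_shift:
  assumes "growth s h w" "h > 0" "s \<ge> 0" shows "growth s (2 powr s * h) (\<lambda>n. w (Suc n))"
proof -
  obtain C where C: "C \<ge> 0" "\<And>n. w n \<le> C * h ^ n * fact n powr s" using growthE[OF assms(1,2)] by blast
  have "w (Suc n) \<le> (C * h) * (2 powr s * h) ^ n * fact n powr s" for n
  proof -
    have "1 + real n \<le> 2 ^ n" using Bernoulli_inequality[of 1 n] by simp
    then have "(1 + real n) powr s \<le> (2 ^ n) powr s" using assms by (intro powr_mono2) auto
    also have "\<dots> = (2 powr s) ^ n" by (simp add: powr_realpow[symmetric] powr_powr mult.commute)
    finally have 1: "(1 + real n) powr s \<le> (2 powr s) ^ n" .
    have "(fact (Suc n) :: real) powr s = (1 + real n) powr s * fact n powr s"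
      by (simp add: powr_mult add.commute)
    then have 2: "(fact (Suc n) :: real) powr s \<le> (2 powr s) ^ n * fact n powr s"
      using 1 by (simp add: mult_right_mono)
    have "w (Suc n) \<le> C * h ^ Suc n * fact (Suc n) powr s" by (rule C)
    also have "\<dots> \<le> C * h ^ Suc n * ((2 powr s) ^ n * fact n powr s)"
      using C assms by (intro mult_left_mono 2) auto
    finally show ?thesis by (simp add: power_mult_distrib ac_simps)
  qed
  then show ?thesis unfolding growth_def by blast
qed

lemma growth_halve:
  assumes "growth s h w" "h > 0" "s \<ge> 0" shows "growth s (2 powr s * h) (\<lambda>n. sqrt (w (2 * n)))"
proof -
  obtain C where C: "C \<ge> 0" "\<And>n. w n \<le> C * h ^ n * fact n powr s" using growthE[OF assms(1,2)] by blast
  have "sqrt (w (2 * n)) \<le> sqrt C * (2 powr s * h) ^ n * fact n powr s" for n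
  proof -
    have "(fact (2 * n) :: real) \<le> (2 ^ n * fact n)\<^sup>2"
      unfolding mult_2 using fact_add_le[of n n] by (simp add: power_add power2_eq_square ac_simps)
    then have "(fact (2 * n) :: real) powr s \<le> ((2 ^ n * fact n)\<^sup>2) powr s" using assms by (intro powr_mono2) auto
    also have "\<dots> = ((2 powr s) ^ n * fact n powr s)\<^sup>2"
      by (simp add: powr_realpow[symmetric] powr_powr powr_mult mult.commute power2_eq_square)
    finally have f: "(fact (2 * n) :: real) powr s \<le> ((2 powr s) ^ n * fact n powr s)\<^sup>2" .
    have "w (2 * n) \<le> C * h ^ (2 * n) * fact (2 * n) powr s" by (rule C)
    also have "\<dots> \<le> C * h ^ (2 * n) * ((2 powr s) ^ n * fact n powr s)\<^sup>2"
      using C assms by (intro mult_left_mono f) auto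
    also have "\<dots> = (sqrt C * (2 powr s * h) ^ n * fact n powr s)\<^sup>2"
      using C by (simp add: power_mult_distrib power_mult[symmetric] mult.commute)
    finally show ?thesis using C assms by (intro real_le_lsqrt) auto
  qed
  then show ?thesis unfolding growth_def by blast
qed

lemma growth_sqrt_fact_1:
  assumes "s \<ge> 1 / 2" shows "growth s 1 (\<lambda>n. sqrt (fact n))"
  unfolding growth_def
proof (intro exI allI)
  fix n
  have "sqrt (fact n) = fact n powr (1 / 2)" by (simp add: powr_half_sqrt)
  also have "\<dots> \<le> fact n powr s" using assms by (intro powr_mono) auto
  finally show "sqrt (fact n) \<le> 1 * 1 ^ n * fact n powr s" by simp
qed

text \<open>For \<open>s > 1/2\<close> the factor \<open>n!^(s - 1/2)\<close> beats every exponential.\<close>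

lemma growth_sqrt_fact:
  assumes s: "s > 1 / 2" and h: "h > 0" shows "growth s h (\<lambda>n. sqrt (fact n))"
proof -
  define \<delta> where "\<delta> = s - 1 / 2"
  define y where "y = (1 / h) powr (1 / \<delta>)"
  have \<delta>: "\<delta> > 0" using s by (simp add: \<delta>_def)
  have y: "y > 0" using h by (simp add: y_def)
  have "sqrt (fact n) \<le> exp y powr \<delta> * h ^ n * fact n powr s" for n
  proof -
    have "y ^ n / fact n \<le> exp y" using y by (intro power_div_fact_le_exp) auto
    then have "y ^ n \<le> exp y * fact n" by (simp add: field_simps)
    then have "(y ^ n) powr \<delta> \<le> (exp y * fact n) powr \<delta>" using \<delta> y by (intro powr_mono2) auto
    also have "(y ^ n) powr \<delta> = (1 / h) ^ n"
      using \<delta> h y by (simp add: y_def powr_realpow[symmetric] powr_powr)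
    also have "(exp y * fact n) powr \<delta> = exp y powr \<delta> * fact n powr \<delta>" by (simp add: powr_mult)
    finally have "1 \<le> exp y powr \<delta> * fact n powr \<delta> * h ^ n"
      using h by (simp add: power_divide pos_divide_le_eq)
    then have "sqrt (fact n) * 1 \<le> sqrt (fact n) * (exp y powr \<delta> * fact n powr \<delta> * h ^ n)"
      by (intro mult_left_mono) auto
    also have "\<dots> = exp y powr \<delta> * h ^ n * (fact n powr (1 / 2) * fact n powr \<delta>)"
      by (simp add: powr_half_sqrt ac_simps)
    also have "fact n powr (1 / 2) * fact n powr \<delta> = (fact n :: real) powr s"
      unfolding powr_add[symmetric] \<delta>_def by simp
    finally show ?thesis by simp
  qed
  then show ?thesis unfolding growth_def by blast
qed

fun saturated :: "(nat \<Rightarrow> real) \<Rightarrow> nat \<Rightarrow> real" where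
  "saturated w 0 = w 0"
| "saturated w (Suc 0) = w 1"
| "saturated w (Suc (Suc n)) = w (Suc (Suc n)) + real (n + 2) * saturated w n"

lemma saturated_ge:
  assumes "\<And>n. 0 \<le> w n"
  shows "w n \<le> saturated w n" "real (n + 2) * saturated w n \<le> saturated w (n + 2)"
proof -
  have 1: "w n \<le> saturated w n \<and> 0 \<le> saturated w n" for n
    by (induction n rule: induct_nat_012) (use assms in \<open>auto intro!: add_nonneg_nonneg mult_nonneg_nonneg\<close>)
  then show "w n \<le> saturated w n" by simp
  show "real (n + 2) * saturated w n \<le> saturated w (n + 2)" using assms[of "Suc (Suc n)"] by simp
qed

text \<open>Over two steps \<open>n!^s\<close> grows by the factor \<open>((n + 2) (n + 1))^s\<close>. From N on, this factor times
  \<open>h^2\<close> is at least twice the factor \<open>n + 2\<close> of the recursion, so the recursive term takes at most half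
  of the bound, which leaves the other half for w. The finitely many earlier values are put into the constant.\<close>

lemma growth_saturated:
  assumes g: "growth s h w" and h: "h > 0" and w: "\<And>n. 0 \<le> w n"
    and large: "\<And>n. n \<ge> N \<Longrightarrow> 2 * real (n + 2) \<le> h\<^sup>2 * (real (n + 2) * real (n + 1)) powr s"
  shows "growth s h (saturated w)"
proof -
  obtain C where C: "C \<ge> 0" "\<And>n. w n \<le> C * h ^ n * fact n powr s" using growthE[OF g h] by blast
  let ?G = "\<lambda>n. h ^ n * fact n powr s"
  have G: "?G n > 0" for n using h by simp
  have s0: "saturated w n \<ge> 0" for n using saturated_ge(1)[where w = w and n = n, OF w] w[of n] by linarith
  define D where "D = 2 * C + (\<Sum>k<N + 2. saturated w k / ?G k)"
  have "(\<Sum>k<N + 2. saturated w k / ?G k) \<ge> 0" by (intro sum_nonneg divide_nonneg_pos s0 G)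
  then have D: "2 * C \<le> D" "D \<ge> 0" unfolding D_def using C by linarith+
  have "saturated w n \<le> D * ?G n" for n
  proof (induction n rule: less_induct)
    case (less n)
    show ?case
    proof (cases "n < N + 2")
      case True
      have "saturated w n / ?G n \<le> (\<Sum>k<N + 2. saturated w k / ?G k)"
        using True by (intro member_le_sum divide_nonneg_pos s0 G) auto
      also have "\<dots> \<le> D" unfolding D_def using C by simp
      finally show ?thesis using G[of n] by (simp add: pos_divide_le_eq)
    next
      case False
      define m where "m = n - 2"
      have m: "n = Suc (Suc m)" "m \<ge> N" using False unfolding m_def by auto
      have G2: "?G n = h\<^sup>2 * (real (m + 2) * real (m + 1)) powr s * ?G m"
      proof -
        have "(fact n :: real) = (real (m + 2) * real (m + 1)) * fact m" unfolding m by (simp add: algebra_simps)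
        then have "(fact n :: real) powr s = (real (m + 2) * real (m + 1)) powr s * fact m powr s" by (simp add: powr_mult)
        then show ?thesis unfolding m(1) by (simp add: power2_eq_square ac_simps)
      qed
      have "real (m + 2) * saturated w m \<le> real (m + 2) * (D * ?G m)"
        using less[of m] m by (intro mult_left_mono) auto
      also have "\<dots> = D / 2 * (2 * real (m + 2) * ?G m)" by simp
      also have "\<dots> \<le> D / 2 * (h\<^sup>2 * (real (m + 2) * real (m + 1)) powr s * ?G m)"
        using D G[of m] large[OF m(2)] by (intro mult_left_mono mult_right_mono) auto
      also have "\<dots> = D / 2 * ?G n" unfolding G2 ..
      finally have "real (m + 2) * saturated w m \<le> D / 2 * ?G n" .
      moreover have "w n \<le> D / 2 * ?G n"
      proof -
        have "w n \<le> C * ?G n" using C(2)[of n] by (simp add: mult.assoc)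
        also have "\<dots> \<le> D / 2 * ?G n" using D G[of n] by (intro mult_right_mono) auto
        finally show ?thesis .
      qed
      ultimately show ?thesis unfolding m(1) by (simp add: field_simps)
    qed
  qed
  then show ?thesis unfolding growth_def by (metis mult.assoc)
qed

lemma powr_product_ge:
  assumes "s \<ge> 0" shows "real (n + 2) powr (2 * s) / 2 powr s \<le> (real (n + 2) * real (n + 1)) powr s"
proof -
  have "real (n + 2) powr (2 * s) / 2 powr s = (real (n + 2) * real (n + 2) / 2) powr s"
    by (simp add: powr_divide powr_mult powr_add[symmetric])
  also have "\<dots> \<le> (real (n + 2) * real (n + 1)) powr s"
    using assms by (intro powr_mono2) (auto simp: field_simps)
  finally show ?thesis .
qed

lemma weight_class_some_growth:
  assumes s: "s \<ge> 1 / 2" shows "weight_class (some_growth s)"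
proof
  fix w assume "w \<in> some_growth s"
  then obtain h where h: "h > 0" "growth s h w" unfolding some_growth_def by auto
  show "v \<in> some_growth s" if "\<And>n. v n \<le> w n" for v
    unfolding some_growth_def using h growth_dominated[OF h(2) that] by auto
  show "(\<lambda>n. c * r ^ n * w n) \<in> some_growth s" if "c > 0" "r > 0" for c r
    unfolding some_growth_def using h growth_scale[OF h(2) that] that by (auto intro!: exI[of _ "r * h"])
  show "(\<lambda>n. w (Suc n)) \<in> some_growth s"
    unfolding some_growth_def using h growth_shift[OF h(2,1)] s by (auto intro!: exI[of _ "2 powr s * h"])
  show "(\<lambda>n. sqrt (w (2 * n))) \<in> some_growth s"
    unfolding some_growth_def using h growth_halve[OF h(2,1)] s by (auto intro!: exI[of _ "2 powr s * h"])
  show "(\<lambda>n. w n + v n) \<in> some_growth s" if v: "v \<in> some_growth s" for v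
  proof -
    obtain h' where h': "h' > 0" "growth s h' v" using v unfolding some_growth_def by auto
    have "growth s (max h h') w" "growth s (max h h') v" using h h' growth_mono by auto
    then have "growth s (max h h') (\<lambda>n. w n + v n)" by (rule growth_add)
    then show ?thesis unfolding some_growth_def using h by (auto intro!: exI[of _ "max h h'"])
  qed
  show "\<exists>v\<in>some_growth s. (\<forall>n. w n \<le> v n) \<and> (\<forall>n. real (n + 2) * v n \<le> v (n + 2))" if w0: "\<And>n. 0 \<le> w n"
  proof (rule bexI[of _ "saturated w"])
    \<comment> \<open>For \<open>s = 1/2\<close> both sides of the hypothesis \<open>large\<close> of \<open>growth_saturated\<close> grow linearly
      in n, so it holds only for large h.\<close>
    define h' where "h' = max h (2 * 2 powr s)"
    have h': "h' > 0" "growth s h' w" unfolding h'_def using h growth_mono[OF h(2,1)] by auto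
    have "growth s h' (saturated w)"
    proof (rule growth_saturated[where w = w and h = h' and N = 0, OF h'(2,1) w0])
      fix n
      have "2 * real (n + 2) \<le> (2 * 2 powr s)\<^sup>2 * (real (n + 2) powr 1 / 2 powr s)"
      proof -
        have e: "(2 * 2 powr s)\<^sup>2 * (real (n + 2) powr 1 / 2 powr s) = 2 * real (n + 2) * (2 * 2 powr s)"
          by (simp add: power2_eq_square field_simps)
        have "2 * real (n + 2) * 1 \<le> 2 * real (n + 2) * (2 * 2 powr s)"
          using s ge_one_powr_ge_zero[of 2 s] by (intro mult_left_mono) auto
        then show ?thesis unfolding e by simp
      qed
      also have "\<dots> \<le> h'\<^sup>2 * (real (n + 2) powr (2 * s) / 2 powr s)"
      proof (intro mult_mono divide_right_mono power_mono)
        show "real (n + 2) powr 1 \<le> real (n + 2) powr (2 * s)" using s by (intro powr_mono) auto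
      qed (auto simp: h'_def)
      also have "\<dots> \<le> h'\<^sup>2 * (real (n + 2) * real (n + 1)) powr s"
        using s by (intro mult_left_mono powr_product_ge) auto
      finally show "2 * real (n + 2) \<le> h'\<^sup>2 * (real (n + 2) * real (n + 1)) powr s" .
    qed
    then show "saturated w \<in> some_growth s" unfolding some_growth_def using h' by auto
  qed (use saturated_ge[where w = w, OF w0] in auto)
next
  show "(\<lambda>n. sqrt (fact n)) \<in> some_growth s"
    unfolding some_growth_def using growth_sqrt_fact_1[OF s] by (auto intro!: exI[of _ 1])
qed

lemma weight_class_every_growth:
  assumes s: "s > 1 / 2" shows "weight_class (every_growth s)"
proof
  fix w assume w: "w \<in> every_growth s"
  show "v \<in> every_growth s" if "\<And>n. v n \<le> w n" for v
    using w that growth_dominated unfolding every_growth_def by blast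
  show "(\<lambda>n. c * r ^ n * w n) \<in> every_growth s" if "c > 0" "r > 0" for c r
    unfolding every_growth_def
  proof (clarify)
    fix h :: real assume "h > 0"
    then have "growth s (h / r) w" using w that unfolding every_growth_def by auto
    from growth_scale[OF this that] that show "growth s h (\<lambda>n. c * r ^ n * w n)" by simp
  qed
  have down: "growth s (h / 2 powr s) w" "h / 2 powr s > 0" "2 powr s * (h / 2 powr s) = h" if "h > 0" for h
    using w that unfolding every_growth_def by auto
  show "(\<lambda>n. w (Suc n)) \<in> every_growth s" unfolding every_growth_def
    using growth_shift[OF down(1,2)] down(3) s by auto
  show "(\<lambda>n. sqrt (w (2 * n))) \<in> every_growth s" unfolding every_growth_def
    using growth_halve[OF down(1,2)] down(3) s by auto
  show "(\<lambda>n. w n + v n) \<in> every_growth s" if "v \<in> every_growth s" for v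
    using w that growth_add unfolding every_growth_def by auto
  show "\<exists>v\<in>every_growth s. (\<forall>n. w n \<le> v n) \<and> (\<forall>n. real (n + 2) * v n \<le> v (n + 2))" if w0: "\<And>n. 0 \<le> w n"
  proof (rule bexI[of _ "saturated w"])
    show "saturated w \<in> every_growth s" unfolding every_growth_def
    proof (clarify)
      fix h :: real assume h: "h > 0"
      have "filterlim (\<lambda>n. real (n + 2) powr (2 * s - 1)) at_top sequentially"
        using s by real_asymp
      then have "\<forall>\<^sub>F n in sequentially. 2 * 2 powr s / h\<^sup>2 \<le> real (n + 2) powr (2 * s - 1)"
        unfolding filterlim_at_top by blast
      then obtain n0 where n0: "\<And>n. n \<ge> n0 \<Longrightarrow> 2 * 2 powr s / h\<^sup>2 \<le> real (n + 2) powr (2 * s - 1)"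
        unfolding eventually_sequentially by blast
      have gw: "growth s h w" using w h unfolding every_growth_def by auto
      show "growth s h (saturated w)"
      proof (rule growth_saturated[where w = w and h = h and N = n0, OF gw h w0])
        fix n assume "n \<ge> n0"
        from n0[OF this] have "2 * 2 powr s \<le> h\<^sup>2 * real (n + 2) powr (2 * s - 1)"
          using h by (simp add: pos_divide_le_eq mult.commute)
        then have "2 * 2 powr s * real (n + 2) \<le> h\<^sup>2 * real (n + 2) powr (2 * s - 1) * real (n + 2) powr 1"
          by (simp add: mult_right_mono)
        also have "\<dots> = h\<^sup>2 * real (n + 2) powr (2 * s)" unfolding mult.assoc powr_add[symmetric] by simp
        finally have "2 * real (n + 2) \<le> h\<^sup>2 * (real (n + 2) powr (2 * s) / 2 powr s)"
          by (simp add: field_simps)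
        also have "\<dots> \<le> h\<^sup>2 * (real (n + 2) * real (n + 1)) powr s"
          using s by (intro mult_left_mono powr_product_ge) auto
        finally show "2 * real (n + 2) \<le> h\<^sup>2 * (real (n + 2) * real (n + 1)) powr s" .
      qed
    qed
  qed (use saturated_ge[where w = w, OF w0] in auto)
next
  show "(\<lambda>n. sqrt (fact n)) \<in> every_growth s"
    unfolding every_growth_def using growth_sqrt_fact[OF s] by auto
qed

lemma weight_class_UNIV: "weight_class UNIV"
proof
  fix w :: "nat \<Rightarrow> real" assume "\<And>n. 0 \<le> w n"
  from saturated_ge[where w = w, OF this] show "\<exists>v\<in>UNIV. (\<forall>n. w n \<le> v n) \<and> (\<forall>n. real (n + 2) * v n \<le> v (n + 2))" by blast
qed auto

subsection \<open>Identification of the spaces\<close>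

text \<open>The smallest admissible weight of f. The element 0 matters if \<open>d = 0\<close> and \<open>n > 0\<close>, when there is
  no multi-index of length n.\<close>

definition sup_weight :: "nat \<Rightarrow> seq_fun \<Rightarrow> nat \<Rightarrow> real" where
  "sup_weight d f n = Sup (insert 0 {\<bar>monomial d \<beta> x\<bar> * norm (mdiff d \<alpha> f x) | \<alpha> \<beta> x. mlen d \<alpha> + mlen d \<beta> = n})"

lemma sup_weight_le:
  assumes "0 \<le> C" "\<And>\<alpha> \<beta> x. mlen d \<alpha> + mlen d \<beta> = n \<Longrightarrow> \<bar>monomial d \<beta> x\<bar> * norm (mdiff d \<alpha> f x) \<le> C"
  shows "sup_weight d f n \<le> C"
  unfolding sup_weight_def using assms by (intro cSup_least) auto

lemma weighted_spaceI:
  assumes sm: "smooth_fun d f" and W: "sup_weight d f \<in> W"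
    and b: "\<And>n. \<exists>C. \<forall>\<alpha> \<beta> x. mlen d \<alpha> + mlen d \<beta> = n \<longrightarrow> \<bar>monomial d \<beta> x\<bar> * norm (mdiff d \<alpha> f x) \<le> C"
  shows "f \<in> weighted_space W d"
proof -
  have bdd: "bdd_above (insert 0 {\<bar>monomial d \<beta> x\<bar> * norm (mdiff d \<alpha> f x) | \<alpha> \<beta> x. mlen d \<alpha> + mlen d \<beta> = n})" for n
  proof -
    obtain C where "\<forall>\<alpha> \<beta> x. mlen d \<alpha> + mlen d \<beta> = n \<longrightarrow> \<bar>monomial d \<beta> x\<bar> * norm (mdiff d \<alpha> f x) \<le> C" using b[of n] by blast
    then show ?thesis by (intro bdd_aboveI[of _ "max C 0"]) (auto simp: le_max_iff_disj)
  qed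
  have "\<bar>monomial d \<beta> x\<bar> * norm (mdiff d \<alpha> f x) \<le> sup_weight d f (mlen d \<alpha> + mlen d \<beta>)" for \<alpha> \<beta> x
    unfolding sup_weight_def by (rule cSup_upper[OF _ bdd]) blast
  moreover have "0 \<le> sup_weight d f n" for n unfolding sup_weight_def by (rule cSup_upper[OF _ bdd]) simp
  ultimately show ?thesis unfolding weighted_space_def using sm W by blast
qed

lemma finite_mi_le: "finite {\<gamma> \<in> mi d. mlen d \<gamma> \<le> n}"
proof (rule finite_subset)
  show "{\<gamma> \<in> mi d. mlen d \<gamma> \<le> n} \<subseteq> {\<gamma>. \<forall>i. (i \<in> {..<d} \<longrightarrow> \<gamma> i \<in> {..n}) \<and> (i \<notin> {..<d} \<longrightarrow> \<gamma> i = 0)}"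
    by (auto simp: mi_def intro: order_trans[OF le_mlen])
  show "finite {\<gamma> :: nat \<Rightarrow> nat. \<forall>i. (i \<in> {..<d} \<longrightarrow> \<gamma> i \<in> {..n}) \<and> (i \<notin> {..<d} \<longrightarrow> \<gamma> i = 0)}"
    by (rule finite_set_of_finite_funs) auto
qed

lemma mi_take_simps:
  "monomial d (mi_take d \<beta>) x = monomial d \<beta> x" "mdiff d (mi_take d \<alpha>) f = mdiff d \<alpha> f"
  "mlen d (mi_take d \<alpha>) = mlen d \<alpha>"
proof -
  show "monomial d (mi_take d \<beta>) x = monomial d \<beta> x" "mlen d (mi_take d \<alpha>) = mlen d \<alpha>"
    unfolding monomial_def mlen_def mi_take_def by auto
  show "mdiff d (mi_take d \<alpha>) f = mdiff d \<alpha> f"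
    unfolding mdiff_def mi_take_def by (intro foldr_cong) auto
qed

lemma schwartz_eq: "schwartz d = weighted_space UNIV d"
proof
  show "schwartz d \<subseteq> weighted_space UNIV d"
  proof
    fix f assume "f \<in> schwartz d"
    then have sm: "smooth_fun d f" and b: "\<And>\<alpha> \<beta>. \<exists>C. \<forall>x. \<bar>monomial d \<beta> x\<bar> * norm (mdiff d \<alpha> f x) \<le> C"
      unfolding schwartz_def bdd_above_def by auto
    define C where "C = (\<lambda>\<alpha> \<beta>. SOME C. \<forall>x. \<bar>monomial d \<beta> x\<bar> * norm (mdiff d \<alpha> f x) \<le> C)"
    have C: "\<bar>monomial d \<beta> x\<bar> * norm (mdiff d \<alpha> f x) \<le> C \<alpha> \<beta>" for \<alpha> \<beta> x
      using someI_ex[OF b[of \<beta> \<alpha>]] unfolding C_def by blast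
    show "f \<in> weighted_space UNIV d"
    proof (rule weighted_spaceI[OF sm])
      fix n
      let ?F = "{\<gamma> \<in> mi d. mlen d \<gamma> \<le> n}"
      have "\<bar>monomial d \<beta> x\<bar> * norm (mdiff d \<alpha> f x) \<le> (\<Sum>\<alpha>\<in>?F. \<Sum>\<beta>\<in>?F. \<bar>C \<alpha> \<beta>\<bar>)"
        if "mlen d \<alpha> + mlen d \<beta> = n" for \<alpha> \<beta> x
      proof -
        have tk: "mi_take d \<alpha> \<in> ?F" "mi_take d \<beta> \<in> ?F" using that by (auto simp: mi_take_simps)
        have "\<bar>monomial d \<beta> x\<bar> * norm (mdiff d \<alpha> f x) \<le> C (mi_take d \<alpha>) (mi_take d \<beta>)"
          using C[of "mi_take d \<beta>" x "mi_take d \<alpha>"] by (simp add: mi_take_simps)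
        also have "\<dots> \<le> (\<Sum>\<beta>\<in>?F. \<bar>C (mi_take d \<alpha>) \<beta>\<bar>)"
          using tk finite_mi_le by (intro order_trans[OF abs_ge_self member_le_sum[where f = "\<lambda>\<beta>. \<bar>C (mi_take d \<alpha>) \<beta>\<bar>"]]) auto
        also have "\<dots> \<le> (\<Sum>\<alpha>\<in>?F. \<Sum>\<beta>\<in>?F. \<bar>C \<alpha> \<beta>\<bar>)"
          using tk finite_mi_le by (intro member_le_sum[where f = "\<lambda>\<alpha>. \<Sum>\<beta>\<in>?F. \<bar>C \<alpha> \<beta>\<bar>"]) (auto intro: sum_nonneg)
        finally show ?thesis .
      qed
      then show "\<exists>C. \<forall>\<alpha> \<beta> x. mlen d \<alpha> + mlen d \<beta> = n \<longrightarrow> \<bar>monomial d \<beta> x\<bar> * norm (mdiff d \<alpha> f x) \<le> C" by blast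
    qed simp
  qed
  show "weighted_space UNIV d \<subseteq> schwartz d"
    unfolding weighted_space_def schwartz_def bdd_above_def by fast
qed

lemma gs_step_bound:
  assumes f: "f \<in> gs_step s h d" and h: "h > 0" and s: "s \<ge> 0"
  shows "\<exists>C\<ge>0. \<forall>\<alpha> \<beta> x. \<bar>monomial d \<beta> x\<bar> * norm (mdiff d \<alpha> f x) \<le>
     C * h ^ (mlen d \<alpha> + mlen d \<beta>) * fact (mlen d \<alpha> + mlen d \<beta>) powr s"
proof -
  obtain M where M: "\<And>\<alpha> \<beta> x. gs_quot s h d f (\<alpha>, \<beta>, x) \<le> M" using f unfolding gs_step_def bdd_above_def by auto
  have "\<bar>monomial d \<beta> x\<bar> * norm (mdiff d \<alpha> f x) \<le> max M 0 * h ^ (mlen d \<alpha> + mlen d \<beta>) * fact (mlen d \<alpha> + mlen d \<beta>) powr s"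
    for \<alpha> \<beta> x
  proof -
    let ?m = "mfact d \<alpha> * mfact d \<beta>" and ?n = "mlen d \<alpha> + mlen d \<beta>"
    have m: "?m > 0" using mfact_ge_1[of d \<alpha>] mfact_ge_1[of d \<beta>] by (intro mult_pos_pos) linarith+
    have "h ^ ?n * ?m powr s > 0" using h m by (metis less_irrefl mult_pos_pos powr_gt_zero zero_less_power)
    then have "\<bar>monomial d \<beta> x\<bar> * norm (mdiff d \<alpha> f x) \<le> M * (h ^ ?n * ?m powr s)"
      using M[of \<alpha> \<beta> x] unfolding gs_quot_def by (simp only: split pos_divide_le_eq)
    also have "\<dots> \<le> max M 0 * (h ^ ?n * fact ?n powr s)"
      using h m s mfact_mult_le[of d \<alpha> \<beta>] by (intro mult_mono mult_left_mono powr_mono2) auto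
    finally show ?thesis by (simp add: mult.assoc)
  qed
  then show ?thesis by (intro exI[of _ "max M 0"]) auto
qed

text \<open>The factor on h comes from \<open>fact_le_mfact_mult\<close>, which compares \<open>(|\<alpha>| + |\<beta>|)!\<close> with \<open>\<alpha>! \<beta>!\<close>.\<close>

lemma gs_stepI:
  assumes sm: "smooth_fun d f" and g: "growth s h w" "h > 0" and s: "s \<ge> 0"
    and w: "\<And>\<alpha> \<beta> x. \<bar>monomial d \<beta> x\<bar> * norm (mdiff d \<alpha> f x) \<le> w (mlen d \<alpha> + mlen d \<beta>)"
  shows "f \<in> gs_step s ((2 ^ Suc d) powr s * h) d"
proof -
  obtain C where C: "C \<ge> 0" "\<And>n. w n \<le> C * h ^ n * fact n powr s" using growthE[OF g] by blast
  have "gs_quot s ((2 ^ Suc d) powr s * h) d f (\<alpha>, \<beta>, x) \<le> C" for \<alpha> \<beta> x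
  proof -
    let ?m = "mfact d \<alpha> * mfact d \<beta>" and ?n = "mlen d \<alpha> + mlen d \<beta>"
    have m: "?m > 0" using mfact_ge_1[of d \<alpha>] mfact_ge_1[of d \<beta>] by (intro mult_pos_pos) linarith+
    have "(fact ?n :: real) powr s \<le> ((2 ^ Suc d) ^ ?n * ?m) powr s"
      using s by (intro powr_mono2 fact_le_mfact_mult) auto
    also have "\<dots> = ((2 ^ Suc d) powr s) ^ ?n * ?m powr s"
      unfolding powr_mult power_powr_swap ..
    finally have 1: "(fact ?n :: real) powr s \<le> ((2 ^ Suc d) powr s) ^ ?n * ?m powr s" .
    have "\<bar>monomial d \<beta> x\<bar> * norm (mdiff d \<alpha> f x) \<le> C * h ^ ?n * fact ?n powr s" by (rule order_trans[OF w C(2)])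
    also have "\<dots> \<le> C * h ^ ?n * (((2 ^ Suc d) powr s) ^ ?n * ?m powr s)"
      using C g(2) by (intro mult_left_mono 1) auto
    also have "\<dots> = C * (((2 ^ Suc d) powr s * h) ^ ?n * ?m powr s)"
      by (simp add: power_mult_distrib ac_simps del: power_Suc)
    finally have "\<bar>monomial d \<beta> x\<bar> * norm (mdiff d \<alpha> f x) \<le> C * (((2 ^ Suc d) powr s * h) ^ ?n * ?m powr s)" .
    moreover have "((2 ^ Suc d) powr s * h) ^ ?n * ?m powr s > 0"
    proof (intro mult_pos_pos zero_less_power g(2))
      show "?m powr s > 0" using m by (metis less_irrefl powr_gt_zero)
    qed (simp del: power_Suc)
    ultimately show ?thesis unfolding gs_quot_def by (simp only: split pos_divide_le_eq)
  qed
  then show ?thesis unfolding gs_step_def bdd_above_def using sm by auto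
qed

lemma gs_step_sup_weight:
  assumes f: "f \<in> gs_step s h d" and h: "h > 0" and s: "s \<ge> 0"
  shows "growth s h (sup_weight d f)"
    "\<exists>C. \<forall>\<alpha> \<beta> x. mlen d \<alpha> + mlen d \<beta> = n \<longrightarrow> \<bar>monomial d \<beta> x\<bar> * norm (mdiff d \<alpha> f x) \<le> C"
proof -
  obtain C where C: "C \<ge> 0" "\<And>\<alpha> \<beta> x. \<bar>monomial d \<beta> x\<bar> * norm (mdiff d \<alpha> f x) \<le>
     C * h ^ (mlen d \<alpha> + mlen d \<beta>) * fact (mlen d \<alpha> + mlen d \<beta>) powr s" using gs_step_bound[OF assms] by blast
  have "sup_weight d f n \<le> C * h ^ n * fact n powr s" for n
    using C h by (intro sup_weight_le) auto
  then show "growth s h (sup_weight d f)" unfolding growth_def by blast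
  show "\<exists>C. \<forall>\<alpha> \<beta> x. mlen d \<alpha> + mlen d \<beta> = n \<longrightarrow> \<bar>monomial d \<beta> x\<bar> * norm (mdiff d \<alpha> f x) \<le> C"
    using C(2) by metis
qed

lemma gs_eq: assumes s: "s \<ge> 1 / 2" shows "gs s d = weighted_space (some_growth s) d"
proof
  have s0: "s \<ge> 0" using s by simp
  show "gs s d \<subseteq> weighted_space (some_growth s) d"
  proof
    fix f assume "f \<in> gs s d"
    then obtain h where h: "h > 0" "f \<in> gs_step s h d" unfolding gs_def by auto
    show "f \<in> weighted_space (some_growth s) d"
      using h gs_step_sup_weight[OF h(2,1) s0]
      by (intro weighted_spaceI) (auto simp: gs_step_def some_growth_def)
  qed
  show "weighted_space (some_growth s) d \<subseteq> gs s d"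
  proof
    fix f assume "f \<in> weighted_space (some_growth s) d"
    then obtain w h where "h > 0" "growth s h w" "smooth_fun d f"
      "\<And>\<alpha> \<beta> x. \<bar>monomial d \<beta> x\<bar> * norm (mdiff d \<alpha> f x) \<le> w (mlen d \<alpha> + mlen d \<beta>)"
      unfolding weighted_space_def some_growth_def by auto
    then have "f \<in> gs_step s ((2 ^ Suc d) powr s * h) d" "(2 ^ Suc d) powr s * h > 0"
      using gs_stepI[OF _ _ _ s0] by auto
    then show "f \<in> gs s d" unfolding gs_def by blast
  qed
qed

lemma gs_proj_eq: assumes s: "s > 1 / 2" shows "gs_proj s d = weighted_space (every_growth s) d"
proof
  have s0: "s \<ge> 0" using s by simp
  show "gs_proj s d \<subseteq> weighted_space (every_growth s) d"
  proof
    fix f assume "f \<in> gs_proj s d"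
    then have f: "f \<in> gs_step s h d" if "h > 0" for h using that unfolding gs_proj_def by auto
    show "f \<in> weighted_space (every_growth s) d"
    proof (rule weighted_spaceI)
      show "smooth_fun d f" using f[of 1] unfolding gs_step_def by simp
      show "sup_weight d f \<in> every_growth s" unfolding every_growth_def
        using gs_step_sup_weight(1)[OF f _ s0] by blast
    qed (rule gs_step_sup_weight(2)[OF f[of 1] _ s0], auto)
  qed
  show "weighted_space (every_growth s) d \<subseteq> gs_proj s d"
  proof
    fix f assume "f \<in> weighted_space (every_growth s) d"
    then obtain w where w: "\<And>h. h > 0 \<Longrightarrow> growth s h w" "smooth_fun d f"
      "\<And>\<alpha> \<beta> x. \<bar>monomial d \<beta> x\<bar> * norm (mdiff d \<alpha> f x) \<le> w (mlen d \<alpha> + mlen d \<beta>)"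
      unfolding weighted_space_def every_growth_def by auto
    have "f \<in> gs_step s h d" if h: "h > 0" for h
    proof -
      let ?c = "(2 ^ Suc d) powr s :: real"
      have c: "?c > 0" by (simp del: power_Suc)
      have hc: "h / ?c > 0" using h c by (rule divide_pos_pos)
      from gs_stepI[OF w(2) w(1)[OF hc] hc s0 w(3)] show ?thesis using c by (simp del: power_Suc)
    qed
    then show "f \<in> gs_proj s d" unfolding gs_proj_def by auto
  qed
qed

section \<open>Test functions, distributions and continuous operators\<close>

context weight_class
begin

lemma weighted_seqs_linear:
  assumes "a \<in> weighted_seqs W d" "b \<in> weighted_seqs W d"
  shows "(\<lambda>\<gamma>. u * a \<gamma> + v * b \<gamma>) \<in> weighted_seqs W d"
proof -
  obtain w w' where w: "w \<in> W" "\<And>\<gamma> n. \<gamma> \<in> mi d \<Longrightarrow> norm (a \<gamma>) * mroot d \<gamma> ^ n \<le> w n"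
    and w': "w' \<in> W" "\<And>\<gamma> n. \<gamma> \<in> mi d \<Longrightarrow> norm (b \<gamma>) * mroot d \<gamma> ^ n \<le> w' n"
    using assms unfolding weighted_seqs_def by auto
  let ?M = "norm u + norm v + 1"
  have "norm (u * a \<gamma> + v * b \<gamma>) * mroot d \<gamma> ^ n \<le> ?M * 1 ^ n * (w n + w' n)" if \<gamma>: "\<gamma> \<in> mi d" for \<gamma> n
  proof -
    have r: "mroot d \<gamma> ^ n \<ge> 0" using mroot_ge_1[of d \<gamma>] by simp
    have "norm (u * a \<gamma> + v * b \<gamma>) * mroot d \<gamma> ^ n \<le> (norm u * norm (a \<gamma>) + norm v * norm (b \<gamma>)) * mroot d \<gamma> ^ n"
      by (intro mult_right_mono r order_trans[OF norm_triangle_ineq]) (simp add: norm_mult)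
    also have "\<dots> = norm u * (norm (a \<gamma>) * mroot d \<gamma> ^ n) + norm v * (norm (b \<gamma>) * mroot d \<gamma> ^ n)"
      by (simp add: algebra_simps)
    also have "\<dots> \<le> ?M * (norm (a \<gamma>) * mroot d \<gamma> ^ n) + ?M * (norm (b \<gamma>) * mroot d \<gamma> ^ n)"
      using r by (intro add_mono mult_right_mono) auto
    also have "\<dots> \<le> ?M * w n + ?M * w' n"
      using w(2)[OF \<gamma>] w'(2)[OF \<gamma>] by (intro add_mono mult_left_mono) auto
    finally show ?thesis by (simp add: algebra_simps)
  qed
  moreover have "(\<lambda>n. ?M * 1 ^ n * (w n + w' n)) \<in> W"
    by (rule scale[OF add[OF w(1) w'(1)]]) (auto intro: add_nonneg_pos)
  ultimately show ?thesis by (intro weighted_seqsI)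
qed

lemma weighted_space_iff:
  "f \<in> weighted_space W d \<longleftrightarrow> f \<in> quad_decay d \<and> coef d f \<in> weighted_seqs W d"
proof
  assume "f \<in> quad_decay d \<and> coef d f \<in> weighted_seqs W d"
  then have "series d (coef d f) = f" "series d (coef d f) \<in> weighted_space W d"
    using hermite_expansion weighted_seqs_rapid series_in_weighted_space by blast+
  then show "f \<in> weighted_space W d" by simp
qed (use weighted_space_coef in blast)

lemma weighted_space_linear:
  assumes "f \<in> weighted_space W d" "g \<in> weighted_space W d"
  shows "(\<lambda>x. u * f x + v * g x) \<in> weighted_space W d"
proof -
  have "coef d (\<lambda>x. u * f x + v * g x) = (\<lambda>\<gamma>. u * coef d f \<gamma> + v * coef d g \<gamma>)"
    using assms by (intro ext coef_linear) (auto simp: weighted_space_iff)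
  then show ?thesis using assms by (simp add: weighted_space_iff quad_decay_linear weighted_seqs_linear)
qed

lemma weighted_seqs_cnj: "a \<in> weighted_seqs W d \<Longrightarrow> (\<lambda>\<gamma>. cnj (a \<gamma>)) \<in> weighted_seqs W d"
  unfolding weighted_seqs_def by simp

end

lemma coef_cnj: "coef d (\<lambda>x. cnj (f x)) \<gamma> = cnj (coef d f \<gamma>)"
proof -
  have "coef d (\<lambda>x. cnj (f x)) \<gamma> = (\<integral>x. cnj (f x * of_real (hprod d \<gamma> x)) \<partial>leb d)"
    unfolding coef_def by simp
  then show ?thesis unfolding coef_def by (simp only: Bochner_Integration.integral_cnj)
qed

lemma quad_decay_cnj: "f \<in> quad_decay d \<Longrightarrow> (\<lambda>x. cnj (f x)) \<in> quad_decay d"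
  unfolding quad_decay_def cylinder_def by (auto intro!: continuous_intros)

lemma (in weight_class) weighted_space_cnj:
  "f \<in> weighted_space W d \<Longrightarrow> (\<lambda>x. cnj (f x)) \<in> weighted_space W d"
  unfolding weighted_space_iff
  using weighted_seqs_cnj[of "coef d f" d] by (auto simp: quad_decay_cnj coef_cnj[abs_def])

subsection \<open>Tensor products and slices of Hermite series\<close>

definition seq_tensor :: "nat \<Rightarrow> ((nat \<Rightarrow> nat) \<Rightarrow> complex) \<Rightarrow> ((nat \<Rightarrow> nat) \<Rightarrow> complex) \<Rightarrow> (nat \<Rightarrow> nat) \<Rightarrow> complex" where
  "seq_tensor n a b \<gamma> = a (mi_take n \<gamma>) * b (mi_drop n \<gamma>)"

lemma mroot_append_mono: "mroot n \<alpha> \<le> mroot (n + m) (mi_append n \<alpha> \<beta>)" "mroot m \<beta> \<le> mroot (n + m) (mi_append n \<alpha> \<beta>)"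
  unfolding mroot_def mlen_append by (auto intro!: real_sqrt_le_mono)

lemma mi_eq_append:
  assumes "\<gamma> \<in> mi (n + m)"
  obtains \<alpha> \<beta> where "\<gamma> = mi_append n \<alpha> \<beta>" "\<alpha> \<in> mi n" "\<beta> \<in> mi m"
  using that[of "mi_take n \<gamma>" "mi_drop n \<gamma>"] mi_drop_in[OF assms] by simp

lemma (in weight_class) seq_tensor_in:
  assumes "a \<in> weighted_seqs W n" "b \<in> weighted_seqs W m"
  shows "seq_tensor n a b \<in> weighted_seqs W (n + m)"
proof -
  obtain w w' where w: "w \<in> W" "\<And>\<gamma> n'. \<gamma> \<in> mi n \<Longrightarrow> norm (a \<gamma>) * mroot n \<gamma> ^ n' \<le> w n'"
    and w': "w' \<in> W" "\<And>\<gamma> n'. \<gamma> \<in> mi m \<Longrightarrow> norm (b \<gamma>) * mroot m \<gamma> ^ n' \<le> w' n'"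
    using assms unfolding weighted_seqs_def by auto
  have w0: "w k \<ge> 0" "w' k \<ge> 0" for k
    using weighted_bound_nonneg[where a = a and w = w, OF w(2)] weighted_bound_nonneg[where a = b and w = w', OF w'(2)] by auto
  have "norm (seq_tensor n a b \<gamma>) * mroot (n + m) \<gamma> ^ k \<le> (w' 0 + 1) * sqrt 2 ^ k * w k + (w 0 + 1) * sqrt 2 ^ k * w' k"
    if \<gamma>: "\<gamma> \<in> mi (n + m)" for \<gamma> k
  proof -
    obtain \<alpha> \<beta> where g: "\<gamma> = mi_append n \<alpha> \<beta>" "\<alpha> \<in> mi n" "\<beta> \<in> mi m" using mi_eq_append[OF \<gamma>] .
    define A where "A = mroot n \<alpha>"
    define B where "B = mroot m \<beta>"
    have AB: "A \<ge> 1" "B \<ge> 1" unfolding A_def B_def using mroot_ge_1 by auto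
    have "mroot (n + m) \<gamma> \<le> sqrt (2 * max (1 + real (mlen n \<alpha>)) (1 + real (mlen m \<beta>)))"
      unfolding mroot_def g mlen_append by (intro real_sqrt_le_mono) (simp add: max_def)
    also have "\<dots> = sqrt 2 * max A B"
    proof -
      have "sqrt (max x y) = max (sqrt x) (sqrt y)" for x y
        by (rule max_of_mono[symmetric]) (auto intro: monoI)
      then show ?thesis unfolding real_sqrt_mult A_def B_def mroot_def by simp
    qed
    finally have "mroot (n + m) \<gamma> ^ k \<le> (sqrt 2 * max A B) ^ k"
      using mroot_ge_1[of "n + m" \<gamma>] by (intro power_mono) auto
    also have "\<dots> \<le> sqrt 2 ^ k * (A ^ k + B ^ k)"
      unfolding power_mult_distrib using AB by (intro mult_left_mono) (auto simp: max_def)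
    finally have r: "mroot (n + m) \<gamma> ^ k \<le> sqrt 2 ^ k * (A ^ k + B ^ k)" .
    have n: "norm (seq_tensor n a b \<gamma>) = norm (a \<alpha>) * norm (b \<beta>)"
      unfolding seq_tensor_def g(1) by (simp add: mi_take_append[OF g(2)] norm_mult)
    have "norm (seq_tensor n a b \<gamma>) * mroot (n + m) \<gamma> ^ k \<le> (norm (a \<alpha>) * norm (b \<beta>)) * (sqrt 2 ^ k * (A ^ k + B ^ k))"
      unfolding n by (intro mult_left_mono r) auto
    also have "\<dots> = sqrt 2 ^ k * ((norm (b \<beta>) * B ^ 0) * (norm (a \<alpha>) * A ^ k) + (norm (a \<alpha>) * A ^ 0) * (norm (b \<beta>) * B ^ k))"
      by (simp add: algebra_simps)
    also have "\<dots> \<le> sqrt 2 ^ k * ((w' 0 + 1) * w k + (w 0 + 1) * w' k)"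
      unfolding A_def B_def using w0 w(2)[OF g(2)] w'(2)[OF g(3)] mroot_ge_1
      by (intro mult_left_mono add_mono mult_mono order_trans[OF w(2)[OF g(2)]] order_trans[OF w'(2)[OF g(3)]]
            mult_nonneg_nonneg zero_le_power) (auto intro: order_trans[OF zero_le_one])
    finally show ?thesis by (simp add: algebra_simps)
  qed
  moreover have "(\<lambda>k. (w' 0 + 1) * sqrt 2 ^ k * w k + (w 0 + 1) * sqrt 2 ^ k * w' k) \<in> W"
    by (intro add scale w(1) w'(1)) (use w0[of 0] in auto)
  ultimately show ?thesis by (intro weighted_seqsI)
qed

lemma infsum_mi_append:
  assumes "F abs_summable_on mi (n + m)"
  shows "(\<Sum>\<^sub>\<infinity>\<gamma>\<in>mi (n + m). F \<gamma>) = (\<Sum>\<^sub>\<infinity>\<alpha>\<in>mi n. \<Sum>\<^sub>\<infinity>\<beta>\<in>mi m. (F (mi_append n \<alpha> \<beta>) :: complex))"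
    "(\<Sum>\<^sub>\<infinity>\<gamma>\<in>mi (n + m). F \<gamma>) = (\<Sum>\<^sub>\<infinity>\<beta>\<in>mi m. \<Sum>\<^sub>\<infinity>\<alpha>\<in>mi n. (F (mi_append n \<alpha> \<beta>) :: complex))"
proof -
  have s: "(\<lambda>(\<alpha>, \<beta>). F (mi_append n \<alpha> \<beta>)) summable_on mi n \<times> mi m"
    using Infinite_Sum.abs_summable_summable[OF assms] summable_on_reindex_bij_betw[OF bij_mi_append[of n m], of F]
    by (simp add: case_prod_unfold)
  have "(\<Sum>\<^sub>\<infinity>\<gamma>\<in>mi (n + m). F \<gamma>) = (\<Sum>\<^sub>\<infinity>(\<alpha>, \<beta>)\<in>mi n \<times> mi m. F (mi_append n \<alpha> \<beta>))"
    using infsum_reindex_bij_betw[OF bij_mi_append[of n m], of F] by (simp add: case_prod_unfold)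
  also have "\<dots> = (\<Sum>\<^sub>\<infinity>\<alpha>\<in>mi n. \<Sum>\<^sub>\<infinity>\<beta>\<in>mi m. F (mi_append n \<alpha> \<beta>))"
    using infsum_Sigma_banach[OF s] by simp
  finally show 1: "(\<Sum>\<^sub>\<infinity>\<gamma>\<in>mi (n + m). F \<gamma>) = (\<Sum>\<^sub>\<infinity>\<alpha>\<in>mi n. \<Sum>\<^sub>\<infinity>\<beta>\<in>mi m. F (mi_append n \<alpha> \<beta>))" .
  show "(\<Sum>\<^sub>\<infinity>\<gamma>\<in>mi (n + m). F \<gamma>) = (\<Sum>\<^sub>\<infinity>\<beta>\<in>mi m. \<Sum>\<^sub>\<infinity>\<alpha>\<in>mi n. F (mi_append n \<alpha> \<beta>))"
    unfolding 1 by (rule infsum_swap_banach[OF s])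
qed

lemma tensor_series:
  assumes a: "hsummable n a" and b: "hsummable m b" and ab: "hsummable (n + m) (seq_tensor n a b)"
  shows "tensor n (series n a) (series m b) = series (n + m) (seq_tensor n a b)"
proof
  fix w
  have "series (n + m) (seq_tensor n a b) w = (\<Sum>\<^sub>\<infinity>\<alpha>\<in>mi n. \<Sum>\<^sub>\<infinity>\<beta>\<in>mi m. seq_tensor n a b (mi_append n \<alpha> \<beta>) * of_real (hprod (n + m) (mi_append n \<alpha> \<beta>) w))"
    unfolding series_def by (rule infsum_mi_append(1)[OF series_abs_summable[OF ab]])
  also have "\<dots> = (\<Sum>\<^sub>\<infinity>\<alpha>\<in>mi n. \<Sum>\<^sub>\<infinity>\<beta>\<in>mi m. (a \<alpha> * of_real (hprod n \<alpha> w)) * (b \<beta> * of_real (hprod m \<beta> (drop_pt n w))))"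
    by (intro infsum_cong) (simp add: seq_tensor_def mi_take_append hprod_append mult.assoc mult.commute mult.left_commute)
  also have "\<dots> = (\<Sum>\<^sub>\<infinity>\<alpha>\<in>mi n. (a \<alpha> * of_real (hprod n \<alpha> w)) * series m b (drop_pt n w))"
    unfolding series_def by (simp add: infsum_cmult_right')
  also have "\<dots> = series n a w * series m b (drop_pt n w)"
    unfolding series_def[of n] by (simp add: infsum_cmult_left')
  finally show "tensor n (series n a) (series m b) w = series (n + m) (seq_tensor n a b) w"
    unfolding tensor_def by simp
qed

text \<open>The coefficients, with respect to the last variables, of a Hermite series whose first n variables
  are fixed at x.\<close>

definition slice_fst :: "nat \<Rightarrow> ((nat \<Rightarrow> nat) \<Rightarrow> complex) \<Rightarrow> (nat \<Rightarrow> real) \<Rightarrow> (nat \<Rightarrow> nat) \<Rightarrow> complex" where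
  "slice_fst n c x \<beta> = series n (\<lambda>\<alpha>. c (mi_append n \<alpha> \<beta>)) x"

text \<open>The coefficients, with respect to the first n variables, of a Hermite series whose last m variables
  are fixed at y.\<close>

definition slice_snd :: "nat \<Rightarrow> nat \<Rightarrow> ((nat \<Rightarrow> nat) \<Rightarrow> complex) \<Rightarrow> (nat \<Rightarrow> real) \<Rightarrow> (nat \<Rightarrow> nat) \<Rightarrow> complex" where
  "slice_snd n m c y \<alpha> = series m (\<lambda>\<beta>. c (mi_append n \<alpha> \<beta>)) y"

lemma series_slice_fst:
  assumes "hsummable (n + m) c"
  shows "series (n + m) c w = series m (slice_fst n c w) (drop_pt n w)"
proof -
  have "series (n + m) c w = (\<Sum>\<^sub>\<infinity>\<beta>\<in>mi m. \<Sum>\<^sub>\<infinity>\<alpha>\<in>mi n. c (mi_append n \<alpha> \<beta>) * of_real (hprod (n + m) (mi_append n \<alpha> \<beta>) w))"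
    unfolding series_def by (rule infsum_mi_append(2)[OF series_abs_summable[OF assms]])
  also have "\<dots> = (\<Sum>\<^sub>\<infinity>\<beta>\<in>mi m. \<Sum>\<^sub>\<infinity>\<alpha>\<in>mi n. (c (mi_append n \<alpha> \<beta>) * of_real (hprod n \<alpha> w)) * of_real (hprod m \<beta> (drop_pt n w)))"
    by (intro infsum_cong) (simp add: hprod_append mult.assoc mult.commute mult.left_commute)
  also have "\<dots> = series m (slice_fst n c w) (drop_pt n w)"
    unfolding series_def slice_fst_def by (simp add: infsum_cmult_left')
  finally show ?thesis .
qed

lemma series_slice_snd:
  assumes "hsummable (n + m) c"
  shows "series (n + m) c w = series n (slice_snd n m c (drop_pt n w)) w"
proof -
  have "series (n + m) c w = (\<Sum>\<^sub>\<infinity>\<alpha>\<in>mi n. \<Sum>\<^sub>\<infinity>\<beta>\<in>mi m. c (mi_append n \<alpha> \<beta>) * of_real (hprod (n + m) (mi_append n \<alpha> \<beta>) w))"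
    unfolding series_def by (rule infsum_mi_append(1)[OF series_abs_summable[OF assms]])
  also have "\<dots> = (\<Sum>\<^sub>\<infinity>\<alpha>\<in>mi n. \<Sum>\<^sub>\<infinity>\<beta>\<in>mi m. (c (mi_append n \<alpha> \<beta>) * of_real (hprod m \<beta> (drop_pt n w))) * of_real (hprod n \<alpha> w))"
    by (intro infsum_cong) (simp add: hprod_append mult.assoc mult.commute mult.left_commute)
  also have "\<dots> = series n (slice_snd n m c (drop_pt n w)) w"
    unfolding series_def slice_snd_def by (simp add: infsum_cmult_left')
  finally show ?thesis .
qed

lemma series_cong_pt: "(\<And>i. i < n \<Longrightarrow> x i = y i) \<Longrightarrow> series n a x = series n a y"
  using series_cylinder[of n a] unfolding cylinder_def by blast

lemma slice_fst_append_pt: "slice_fst n c (append_pt n x y) = slice_fst n c x"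
  unfolding slice_fst_def by (intro ext series_cong_pt) (simp add: append_pt_def)

lemma slice_bounds:
  assumes c: "\<And>\<gamma> k. \<gamma> \<in> mi (n + m) \<Longrightarrow> norm (c \<gamma>) * mroot (n + m) \<gamma> ^ k \<le> w k" and \<beta>: "\<beta> \<in> mi m"
  shows "norm (c (mi_append n \<alpha> \<beta>)) * mroot n \<alpha> ^ k \<le> w k" "norm (c (mi_append n \<alpha> \<beta>)) * mroot m \<beta> ^ k \<le> w k"
  using mroot_ge_1[of n \<alpha>] mroot_ge_1[of m \<beta>]
  by (intro order_trans[OF mult_left_mono[OF power_mono] c[OF mi_append_in[OF \<beta>]]] mroot_append_mono; simp)+

context weight_class
begin

text \<open>The summation over the fixed block of n (or m) variables costs \<open>6 * n\<close> (or \<open>6 * m\<close>) powers of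
  \<open>mroot\<close>, that is, a shift of the weight.\<close>

lemma slice_norm_bounds:
  assumes c: "c \<in> weighted_seqs W (n + m)"
  shows "slice_fst n c x \<in> weighted_seqs W m" "slice_snd n m c y \<in> weighted_seqs W n"
proof -
  obtain w where w: "w \<in> W" "\<And>\<gamma> k. \<gamma> \<in> mi (n + m) \<Longrightarrow> norm (c \<gamma>) * mroot (n + m) \<gamma> ^ k \<le> w k"
    using c unfolding weighted_seqs_def by auto
  have r0: "mroot k \<gamma> \<ge> 0" for k \<gamma> using mroot_ge_1[of k \<gamma>] by linarith
  have bound: "norm (c (mi_append n \<alpha> \<beta>)) * (mroot n \<alpha> ^ k * mroot m \<beta> ^ l) \<le> w (k + l)"
    if "\<alpha> \<in> mi n" "\<beta> \<in> mi m" for \<alpha> \<beta> k l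
  proof -
    have "mroot n \<alpha> ^ k * mroot m \<beta> ^ l \<le> mroot (n + m) (mi_append n \<alpha> \<beta>) ^ k * mroot (n + m) (mi_append n \<alpha> \<beta>) ^ l"
      by (intro mult_mono power_mono mroot_append_mono zero_le_power r0)
    then have "norm (c (mi_append n \<alpha> \<beta>)) * (mroot n \<alpha> ^ k * mroot m \<beta> ^ l) \<le> norm (c (mi_append n \<alpha> \<beta>)) * mroot (n + m) (mi_append n \<alpha> \<beta>) ^ (k + l)"
      unfolding power_add by (intro mult_left_mono) auto
    also have "\<dots> \<le> w (k + l)" by (rule w(2)[OF mi_append_in[OF that(2)]])
    finally show ?thesis .
  qed
  have Z: "(\<Sum>\<^sub>\<infinity>\<gamma>\<in>mi d. inv_sq_prod d \<gamma>) \<ge> 0" for d by (intro infsum_nonneg) (auto simp: inv_sq_prod_def prod_nonneg)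
  define E where "E = (\<lambda>d. 2 ^ d * (\<Sum>\<^sub>\<infinity>\<gamma>\<in>mi d. inv_sq_prod d \<gamma>) + 1)"
  have E: "E d > 0" for d unfolding E_def using Z[of d] by (intro add_nonneg_pos mult_nonneg_nonneg) auto
  have w0: "w k \<ge> 0" for k
    by (rule weighted_bound_nonneg[where a = c and w = w, OF w(2)])
  have est: "norm (series d b x) * R \<le> E d * w k"
    if b: "\<And>\<gamma>. \<gamma> \<in> mi d \<Longrightarrow> norm (b \<gamma>) * mroot d \<gamma> ^ (6 * d) \<le> w k / R" and R: "R > 0" for d b x R k
  proof -
    have "norm (series d b x) \<le> w k / R * 2 ^ d * (\<Sum>\<^sub>\<infinity>\<gamma>\<in>mi d. inv_sq_prod d \<gamma>)"
      by (rule order_trans[OF series_norm_le[OF hsummable_bound(1)] hsummable_bound(2)]) (rule b, assumption)+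
    then have "norm (series d b x) * R \<le> w k * (2 ^ d * (\<Sum>\<^sub>\<infinity>\<gamma>\<in>mi d. inv_sq_prod d \<gamma>))"
      using R by (simp add: field_simps)
    also have "\<dots> \<le> w k * E d" unfolding E_def using w0[of k] by (intro mult_left_mono) auto
    finally show ?thesis by (simp add: mult.commute)
  qed
  have "norm (slice_fst n c x \<beta>) * mroot m \<beta> ^ k \<le> E n * 1 ^ k * w (k + 6 * n)" if \<beta>: "\<beta> \<in> mi m" for \<beta> k
  proof -
    have R: "mroot m \<beta> ^ k > 0" using mroot_ge_1[of m \<beta>] by simp
    have "norm (slice_fst n c x \<beta>) * mroot m \<beta> ^ k \<le> E n * w (k + 6 * n)"
      unfolding slice_fst_def
    proof (rule est[OF _ R])
      fix \<alpha> assume "\<alpha> \<in> mi n"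
      from bound[OF this \<beta>, of "6 * n" k] R
      show "norm (c (mi_append n \<alpha> \<beta>)) * mroot n \<alpha> ^ (6 * n) \<le> w (k + 6 * n) / mroot m \<beta> ^ k"
        by (simp add: pos_le_divide_eq mult.assoc add.commute)
    qed
    then show ?thesis by simp
  qed
  moreover have "(\<lambda>k. E n * 1 ^ k * w (k + 6 * n)) \<in> W" by (rule scale[OF shift_add[OF w(1)] E]) simp
  ultimately show "slice_fst n c x \<in> weighted_seqs W m" by (intro weighted_seqsI)
  have "norm (slice_snd n m c y \<alpha>) * mroot n \<alpha> ^ k \<le> E m * 1 ^ k * w (k + 6 * m)" if \<alpha>: "\<alpha> \<in> mi n" for \<alpha> k
  proof -
    have R: "mroot n \<alpha> ^ k > 0" using mroot_ge_1[of n \<alpha>] by simp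
    have "norm (slice_snd n m c y \<alpha>) * mroot n \<alpha> ^ k \<le> E m * w (k + 6 * m)"
      unfolding slice_snd_def
    proof (rule est[OF _ R])
      fix \<beta> assume "\<beta> \<in> mi m"
      from bound[OF \<alpha> this, of k "6 * m"] R
      show "norm (c (mi_append n \<alpha> \<beta>)) * mroot m \<beta> ^ (6 * m) \<le> w (k + 6 * m) / mroot n \<alpha> ^ k"
        by (simp add: pos_le_divide_eq ac_simps)
    qed
    then show ?thesis by simp
  qed
  moreover have "(\<lambda>k. E m * 1 ^ k * w (k + 6 * m)) \<in> W" by (rule scale[OF shift_add[OF w(1)] E]) simp
  ultimately show "slice_snd n m c y \<in> weighted_seqs W n" by (intro weighted_seqsI)
qed

lemma coef_slice_in:
  assumes c: "c \<in> weighted_seqs W (n + m)" and \<beta>: "\<beta> \<in> mi m"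
  shows "(\<lambda>\<alpha>. c (mi_append n \<alpha> \<beta>)) \<in> weighted_seqs W n"
proof -
  obtain w where w: "w \<in> W" "\<And>\<gamma> k. \<gamma> \<in> mi (n + m) \<Longrightarrow> norm (c \<gamma>) * mroot (n + m) \<gamma> ^ k \<le> w k"
    using c unfolding weighted_seqs_def by auto
  show ?thesis by (rule weighted_seqsI[OF w(1) slice_bounds(1)[OF w(2) \<beta>]])
qed

end

subsection \<open>Test functions\<close>

abbreviation "test d \<equiv> gs (1/2) d"
abbreviation "test_seqs d \<equiv> weighted_seqs (some_growth (1/2)) d"

interpretation test: weight_class "some_growth (1/2)"
  by (rule weight_class_some_growth) simp

lemma test_eq: "test d = weighted_space (some_growth (1/2)) d"
  by (rule gs_eq) simp

lemma test_quad_decay: "f \<in> test d \<Longrightarrow> f \<in> quad_decay d"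
  unfolding test_eq by (rule test.weighted_space_coef)

lemma test_coef: "f \<in> test d \<Longrightarrow> coef d f \<in> test_seqs d"
  unfolding test_eq by (rule test.weighted_space_coef)

lemma test_expansion: "f \<in> test d \<Longrightarrow> series d (coef d f) = f"
  unfolding test_eq by (rule test.weighted_space_expansion)

lemma test_series: "a \<in> test_seqs d \<Longrightarrow> series d a \<in> test d"
  unfolding test_eq by (rule test.series_in_weighted_space)

lemma test_seqs_hsummable: "a \<in> test_seqs d \<Longrightarrow> hsummable d a"
  by (intro rapid_hsummable weighted_seqs_rapid)

lemma test_integrable: "f \<in> test d \<Longrightarrow> integrable (leb d) f"
  by (intro quad_decay_integrable test_quad_decay)

lemma test_linear: "f \<in> test d \<Longrightarrow> g \<in> test d \<Longrightarrow> (\<lambda>x. a * f x + b * g x) \<in> test d"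
  unfolding test_eq by (rule test.weighted_space_linear)

lemma test_cnj: "f \<in> test d \<Longrightarrow> (\<lambda>x. cnj (f x)) \<in> test d"
  unfolding test_eq by (rule test.weighted_space_cnj)

lemma test_coef_linear:
  "f \<in> test d \<Longrightarrow> g \<in> test d \<Longrightarrow> coef d (\<lambda>x. a * f x + b * g x) \<gamma> = a * coef d f \<gamma> + b * coef d g \<gamma>"
  by (intro coef_linear test_quad_decay)

lemma test_tensor:
  assumes f: "f \<in> test n" and g: "g \<in> test m"
  shows "tensor n f g \<in> test (n + m)"
    "\<gamma> \<in> mi (n + m) \<Longrightarrow> coef (n + m) (tensor n f g) \<gamma> = coef n f \<gamma> * coef m g (mi_drop n \<gamma>)"
proof -
  let ?c = "seq_tensor n (coef n f) (coef m g)"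
  have c: "?c \<in> test_seqs (n + m)" by (intro test.seq_tensor_in test_coef f g)
  have e: "tensor n f g = series (n + m) ?c"
    using tensor_series[of n "coef n f" m "coef m g"] test_expansion[OF f] test_expansion[OF g]
      test_seqs_hsummable test_coef[OF f] test_coef[OF g] c by metis
  show "tensor n f g \<in> test (n + m)" unfolding e by (rule test_series[OF c])
  assume "\<gamma> \<in> mi (n + m)"
  then show "coef (n + m) (tensor n f g) \<gamma> = coef n f \<gamma> * coef m g (mi_drop n \<gamma>)"
    unfolding e by (simp add: coef_series test_seqs_hsummable[OF c] seq_tensor_def coef_mi_take)
qed

text \<open>The pairing of a test function with a Hermite function in the last variables selects the
  coefficients with the corresponding index.\<close>

lemma test_slice:
  assumes \<phi>: "\<phi> \<in> test (m + k)"
  shows "(\<lambda>y. \<phi> (append_pt m x y)) \<in> test k"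
    "dist_of k (hermite k \<delta>) (\<lambda>y. \<phi> (append_pt m x y)) = series m (\<lambda>\<alpha>. coef (m + k) \<phi> (mi_append m \<alpha> (mi_take k \<delta>))) x"
proof -
  let ?c = "coef (m + k) \<phi>"
  have c: "?c \<in> test_seqs (m + k)" by (rule test_coef[OF \<phi>])
  have s: "slice_fst m ?c x \<in> test_seqs k" by (rule test.slice_norm_bounds(1)[OF c])
  have e: "(\<lambda>y. \<phi> (append_pt m x y)) = series k (slice_fst m ?c x)"
  proof
    fix y
    have "\<phi> (append_pt m x y) = series (m + k) ?c (append_pt m x y)" using test_expansion[OF \<phi>] by simp
    also have "\<dots> = series k (slice_fst m ?c x) y"
      unfolding series_slice_fst[OF test_seqs_hsummable[OF c]] slice_fst_append_pt by simp
    finally show "\<phi> (append_pt m x y) = series k (slice_fst m ?c x) y" .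
  qed
  show t: "(\<lambda>y. \<phi> (append_pt m x y)) \<in> test k" unfolding e by (rule test_series[OF s])
  have "dist_of k (hermite k \<delta>) (\<lambda>y. \<phi> (append_pt m x y)) = coef k (series k (slice_fst m ?c x)) \<delta>"
    using t unfolding dist_of_def e hermite_eq coef_def by (simp add: mult.commute)
  also have "\<dots> = coef k (series k (slice_fst m ?c x)) (mi_take k \<delta>)" by (rule coef_mi_take[symmetric])
  also have "\<dots> = slice_fst m ?c x (mi_take k \<delta>)" by (rule coef_series[OF test_seqs_hsummable[OF s] mi_take_in])
  finally show "dist_of k (hermite k \<delta>) (\<lambda>y. \<phi> (append_pt m x y)) = series m (\<lambda>\<alpha>. ?c (mi_append m \<alpha> (mi_take k \<delta>))) x"
    unfolding slice_fst_def .
qed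

subsection \<open>Continuity from integral bounds\<close>

definition l1 :: "nat \<Rightarrow> seq_fun \<Rightarrow> real" where
  "l1 d f = (\<integral>x. norm (f x) \<partial>leb d)"

lemma l1_nonneg [simp]: "l1 d f \<ge> 0"
  unfolding l1_def by simp

lemma l1_linear_le:
  assumes "integrable (leb d) f" "integrable (leb d) g"
  shows "l1 d (\<lambda>x. a * f x + b * g x) \<le> norm a * l1 d f + norm b * l1 d g"
proof -
  have "l1 d (\<lambda>x. a * f x + b * g x) \<le> (\<integral>x. norm a * norm (f x) + norm b * norm (g x) \<partial>leb d)"
    unfolding l1_def using assms
    by (intro integral_mono) (auto intro!: order_trans[OF norm_triangle_ineq] simp: norm_mult)
  also have "\<dots> = norm a * l1 d f + norm b * l1 d g" unfolding l1_def using assms by simp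
  finally show ?thesis .
qed

lemma l1_cmult: "l1 d (\<lambda>x. a * f x) = norm a * l1 d f"
  unfolding l1_def by (simp add: norm_mult)

text \<open>The multi-indices \<open>\<beta>\<close> with \<open>|\<beta>| \<le> 2 d\<close>, and \<open>\<alpha> = 0\<close>, suffice to bound f by \<open>decay_weight\<close>.\<close>

lemma l1_le_gs_norm:
  assumes h: "h > 0" and s: "s \<ge> 0"
  shows "\<exists>E\<ge>0. \<forall>f\<in>gs_step s h d. l1 d f \<le> E * gs_norm s h d f"
proof -
  define I where "I = (\<integral>x. decay_weight d x \<partial>leb d)"
  have I0: "I \<ge> 0" unfolding I_def using decay_weight_pos[of d] by (intro Bochner_Integration.integral_nonneg) (auto simp: less_imp_le)
  define E where "E = 2 ^ d * (max 1 h ^ (2 * d) * fact (2 * d) powr s)"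
  have E0: "E \<ge> 0" unfolding E_def by simp
  have "l1 d f \<le> E * I * gs_norm s h d f" if f: "f \<in> gs_step s h d" for f
  proof -
    have bdd: "bdd_above (range (gs_quot s h d f))" using f unfolding gs_step_def by simp
    have N: "gs_quot s h d f (\<alpha>, \<beta>, x) \<le> gs_norm s h d f" for \<alpha> \<beta> x
      unfolding gs_norm_def by (rule cSUP_upper[OF _ bdd]) simp
    have q0: "gs_quot s h d f (\<alpha>, \<beta>, x) \<ge> 0" for \<alpha> \<beta> x unfolding gs_quot_def using h by simp
    have N0: "gs_norm s h d f \<ge> 0" using N q0 order_trans by blast
    have "norm (f x) \<le> 2 ^ d * (gs_norm s h d f * (max 1 h ^ (2 * d) * fact (2 * d) powr s)) * decay_weight d x" for x
    proof (rule decay_weight_dominates)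
      fix \<beta> assume \<beta>: "mlen d \<beta> \<le> 2 * d"
      let ?D = "h ^ mlen d \<beta> * mfact d \<beta> powr s"
      have m: "mfact d \<beta> \<noteq> 0" using mfact_ge_1[of d \<beta>] by auto
      have D: "?D > 0" using h m by simp
      have "mlen d (\<lambda>_. 0) = 0" "mfact d (\<lambda>_. 0) = 1" by (simp_all add: mlen_def mfact_def)
      then have "\<bar>monomial d \<beta> x\<bar> * norm (f x) / ?D \<le> gs_norm s h d f"
        using N[of "\<lambda>_. 0" \<beta> x] by (simp add: gs_quot_def mdiff_zero)
      then have "\<bar>monomial d \<beta> x\<bar> * norm (f x) \<le> gs_norm s h d f * ?D" using D by (simp only: pos_divide_le_eq)
      also have "?D \<le> max 1 h ^ (2 * d) * fact (2 * d) powr s"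
      proof (intro mult_mono powr_mono2 s)
        have "h ^ mlen d \<beta> \<le> max 1 h ^ mlen d \<beta>" using h by (intro power_mono) auto
        also have "\<dots> \<le> max 1 h ^ (2 * d)" using \<beta> by (intro power_increasing) auto
        finally show "h ^ mlen d \<beta> \<le> max 1 h ^ (2 * d)" .
        show "mfact d \<beta> \<le> fact (2 * d)" by (rule order_trans[OF mfact_le fact_mono[OF \<beta>]])
      qed (use mfact_ge_1[of d \<beta>] in auto)
      finally show "\<bar>monomial d \<beta> x\<bar> * norm (f x) \<le> gs_norm s h d f * (max 1 h ^ (2 * d) * fact (2 * d) powr s)"
        using N0 by (simp add: mult_left_mono)
    qed simp
    then have "norm (f x) \<le> E * gs_norm s h d f * decay_weight d x" for x by (simp add: E_def ac_simps)
    then have "l1 d f \<le> (\<integral>x. E * gs_norm s h d f * decay_weight d x \<partial>leb d)"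
      unfolding l1_def using decay_weight_integrable E0 N0 decay_weight_pos[of d]
      by (intro integral_mono') (auto simp: less_imp_le)
    also have "\<dots> = E * I * gs_norm s h d f" unfolding I_def by (simp add: ac_simps)
    finally show ?thesis .
  qed
  moreover have "E * I \<ge> 0" using E0 I0 by simp
  ultimately show ?thesis by blast
qed

lemma gs_nbhd_l1:
  assumes \<delta>: "\<delta> > 0" shows "gs_nbhd (1/2) d {f \<in> test d. l1 d f < \<delta>}"
  unfolding gs_nbhd_def
proof (intro conjI ballI allI impI)
  fix f g and a b :: complex
  assume f: "f \<in> {f \<in> test d. l1 d f < \<delta>}" and g: "g \<in> {f \<in> test d. l1 d f < \<delta>}" and ab: "norm a + norm b \<le> 1"
  define M where "M = max (l1 d f) (l1 d g)"
  have "l1 d (\<lambda>x. a * f x + b * g x) \<le> norm a * l1 d f + norm b * l1 d g"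
    using f g by (intro l1_linear_le test_integrable) auto
  also have "\<dots> \<le> norm a * M + norm b * M" unfolding M_def by (intro add_mono mult_left_mono) auto
  also have "\<dots> = (norm a + norm b) * M" by (simp add: algebra_simps)
  also have "\<dots> \<le> 1 * M" by (intro mult_right_mono ab) (simp add: M_def le_max_iff_disj)
  also have "\<dots> < \<delta>" using f g by (simp add: M_def)
  finally show "(\<lambda>x. a * f x + b * g x) \<in> {f \<in> test d. l1 d f < \<delta>}" using f g by (simp add: test_linear)
next
  fix h :: real assume h: "h > 0"
  obtain E where E: "E \<ge> 0" "\<And>f. f \<in> gs_step (1/2) h d \<Longrightarrow> l1 d f \<le> E * gs_norm (1/2) h d f"
    using l1_le_gs_norm[OF h, of "1/2" d] by auto
  show "\<exists>e>0. \<forall>f\<in>gs_step (1/2) h d. gs_norm (1/2) h d f < e \<longrightarrow> f \<in> {f \<in> test d. l1 d f < \<delta>}"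
  proof (intro exI[of _ "\<delta> / (E + 1)"] conjI ballI impI)
    show "\<delta> / (E + 1) > 0" using \<delta> E by simp
    fix f assume f: "f \<in> gs_step (1/2) h d" and n: "gs_norm (1/2) h d f < \<delta> / (E + 1)"
    have "l1 d f \<le> E * gs_norm (1/2) h d f" by (rule E(2)[OF f])
    also have "\<dots> \<le> E * (\<delta> / (E + 1))" using n E(1) by (intro mult_left_mono) auto
    also have "\<dots> < \<delta>" using \<delta> E(1) by (simp add: field_simps)
    finally show "f \<in> {f \<in> test d. l1 d f < \<delta>}" using f h unfolding gs_def by auto
  qed
qed auto

lemma topspace_test: "topspace (gs_topology (1/2) d) = test d"
proof
  show "topspace (gs_topology (1/2) d) \<subseteq> test d"
    unfolding topspace_def openin_gs_topology gs_open_def by blast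
  have "gs_open (1/2) d (test d)" unfolding gs_open_def
  proof (intro conjI ballI)
    fix f assume f: "f \<in> test d"
    show "\<exists>V. gs_nbhd (1/2) d V \<and> (\<forall>g\<in>V. (\<lambda>x. f x + g x) \<in> test d)"
      using gs_nbhd_l1[of 1 d] test_linear[OF f, of _ 1 1] by (intro exI[of _ "{f \<in> test d. l1 d f < 1}"]) auto
  qed simp
  then show "test d \<subseteq> topspace (gs_topology (1/2) d)"
    unfolding openin_gs_topology[symmetric] by (rule openin_subset)
qed

lemma openin_l1_ball: "openin (gs_topology (1/2) d) {f \<in> test d. l1 d f < \<delta>}"
  unfolding openin_gs_topology gs_open_def
proof (intro conjI ballI)
  fix f assume f: "f \<in> {f \<in> test d. l1 d f < \<delta>}"
  show "\<exists>V. gs_nbhd (1/2) d V \<and> (\<forall>g\<in>V. (\<lambda>x. f x + g x) \<in> {f \<in> test d. l1 d f < \<delta>})"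
  proof (intro exI[of _ "{g \<in> test d. l1 d g < \<delta> - l1 d f}"] conjI ballI)
    show "gs_nbhd (1/2) d {g \<in> test d. l1 d g < \<delta> - l1 d f}" using f by (intro gs_nbhd_l1) simp
    fix g assume g: "g \<in> {g \<in> test d. l1 d g < \<delta> - l1 d f}"
    then show "(\<lambda>x. f x + g x) \<in> {f \<in> test d. l1 d f < \<delta>}"
      using f test_linear[of f d g 1 1] l1_linear_le[of d f g 1 1] test_integrable by force
  qed
qed auto

text \<open>The L1 unit ball is a neighbourhood of zero, so it absorbs B.\<close>

lemma gs_bounded_l1:
  assumes "gs_bounded (1/2) d B" shows "\<exists>r>0. \<forall>\<phi>\<in>B. \<phi> \<in> test d \<and> l1 d \<phi> \<le> r"
proof -
  have "(\<lambda>_. 0) \<in> test d" using test_linear[of "series d (\<lambda>_. 0)" d "series d (\<lambda>_. 0)" 0 0] test_series[of "\<lambda>_. 0" d]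
    test.const_in[of 0] by (force simp: weighted_seqs_def)
  then have "(\<lambda>_. 0) \<in> {f \<in> test d. l1 d f < 1}" by (simp add: l1_def)
  then obtain r where r: "r > 0" "\<And>t. t > r \<Longrightarrow> B \<subseteq> (\<lambda>f x. complex_of_real t * f x) ` {f \<in> test d. l1 d f < 1}"
    using assms openin_l1_ball[of d 1] unfolding gs_bounded_def by meson
  have "\<phi> \<in> test d \<and> l1 d \<phi> \<le> r + 1" if "\<phi> \<in> B" for \<phi>
  proof -
    obtain f where f: "f \<in> test d" "l1 d f < 1" "\<phi> = (\<lambda>x. complex_of_real (r + 1) * f x)"
      using r(2)[of "r + 1"] \<open>\<phi> \<in> B\<close> by auto
    have "l1 d \<phi> = (r + 1) * l1 d f" unfolding f(3) l1_cmult using r(1) by (simp del: of_real_add)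
    also have "\<dots> \<le> (r + 1) * 1" using f(2) r(1) by (intro mult_left_mono) auto
    finally show ?thesis using assms \<open>\<phi> \<in> B\<close> unfolding gs_bounded_def by auto
  qed
  then show ?thesis using r(1) by (intro exI[of _ "r + 1"]) auto
qed

lemma gs_dualI:
  assumes lin: "\<And>f g a b. f \<in> test d \<Longrightarrow> g \<in> test d \<Longrightarrow> u (\<lambda>x. a * f x + b * g x) = a * u f + b * u g"
    and off: "\<And>f. f \<notin> test d \<Longrightarrow> u f = 0"
    and bound: "\<And>f. f \<in> test d \<Longrightarrow> norm (u f) \<le> C * l1 d f" and C: "C \<ge> 0"
  shows "u \<in> gs_dual (1/2) d"
proof -
  have "continuous_map (gs_topology (1/2) d) euclidean u"
    unfolding continuous_map_def topspace_test
  proof (intro conjI allI impI)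
    fix U :: "complex set" assume U: "openin euclidean U"
    show "openin (gs_topology (1/2) d) {f \<in> test d. u f \<in> U}"
      unfolding openin_gs_topology gs_open_def
    proof (intro conjI ballI)
      fix f assume f: "f \<in> {f \<in> test d. u f \<in> U}"
      then obtain e where e: "e > 0" "ball (u f) e \<subseteq> U" using U by (auto simp: open_contains_ball)
      show "\<exists>V. gs_nbhd (1/2) d V \<and> (\<forall>g\<in>V. (\<lambda>x. f x + g x) \<in> {f \<in> test d. u f \<in> U})"
      proof (intro exI[of _ "{g \<in> test d. l1 d g < e / (C + 1)}"] conjI ballI)
        show "gs_nbhd (1/2) d {g \<in> test d. l1 d g < e / (C + 1)}" using e C by (intro gs_nbhd_l1) simp
        fix g assume g: "g \<in> {g \<in> test d. l1 d g < e / (C + 1)}"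
        have t: "(\<lambda>x. f x + g x) \<in> test d" using f g test_linear[of f d g 1 1] by simp
        have "norm (u g) \<le> C * l1 d g" using g bound by simp
        also have "\<dots> \<le> C * (e / (C + 1))" using g C by (intro mult_left_mono) auto
        also have "\<dots> < e" using e C by (simp add: field_simps)
        finally have "norm (u g) < e" .
        moreover have "u (\<lambda>x. f x + g x) = u f + u g" using lin[of f g 1 1] f g by simp
        ultimately have "u (\<lambda>x. f x + g x) \<in> ball (u f) e" by (simp add: dist_norm)
        then show "(\<lambda>x. f x + g x) \<in> {f \<in> test d. u f \<in> U}" using e t by auto
      qed
    qed auto
  qed simp
  then show ?thesis unfolding gs_dual_def using lin off by blast
qed

lemma topspace_gs_dual: "topspace (gs_dual_topology s d) = gs_dual s d"
proof
  show "topspace (gs_dual_topology s d) \<subseteq> gs_dual s d"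
    unfolding topspace_def openin_gs_dual_topology gs_dual_open_def by blast
  have "gs_bounded s d {}" unfolding gs_bounded_def by (auto intro: exI[of _ 1])
  then have "gs_dual_open s d (gs_dual s d)" unfolding gs_dual_open_def by (auto intro!: exI[of _ "{}"] exI[of _ 1])
  then show "gs_dual s d \<subseteq> topspace (gs_dual_topology s d)"
    unfolding openin_gs_dual_topology[symmetric] by (rule openin_subset)
qed

text \<open>A map into the strong dual that is bounded by L1 norms in both arguments is continuous: on a
  bounded set B of test functions the L1 norm is bounded, so \<open>T g\<close> is uniformly small on B when the L1
  norm of g is small.\<close>

lemma cont_opsI:
  assumes lin1: "\<And>f g a b. f \<in> test m \<Longrightarrow> g \<in> test m \<Longrightarrow> T (\<lambda>x. a * f x + b * g x) = (\<lambda>\<phi>. a * T f \<phi> + b * T g \<phi>)"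
    and lin2: "\<And>f \<phi> \<psi> a b. f \<in> test m \<Longrightarrow> \<phi> \<in> test n \<Longrightarrow> \<psi> \<in> test n \<Longrightarrow>
        T f (\<lambda>x. a * \<phi> x + b * \<psi> x) = a * T f \<phi> + b * T f \<psi>"
    and off: "\<And>f \<phi>. \<phi> \<notin> test n \<Longrightarrow> T f \<phi> = 0"
    and bound: "\<And>f \<phi>. f \<in> test m \<Longrightarrow> \<phi> \<in> test n \<Longrightarrow> norm (T f \<phi>) \<le> C * l1 m f * l1 n \<phi>" and C: "C \<ge> 0"
  shows "T \<in> cont_ops m n"
proof -
  have dual: "T f \<in> gs_dual (1/2) n" if "f \<in> test m" for f
    by (rule gs_dualI[where C = "C * l1 m f"]) (use lin2 off bound C that in auto)
  have "continuous_map (gs_topology (1/2) m) (gs_dual_topology (1/2) n) T"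
    unfolding continuous_map_def topspace_test topspace_gs_dual
  proof (intro conjI allI impI)
    show "T \<in> test m \<rightarrow> gs_dual (1/2) n" using dual by blast
    fix U assume U: "openin (gs_dual_topology (1/2) n) U"
    show "openin (gs_topology (1/2) m) {f \<in> test m. T f \<in> U}"
      unfolding openin_gs_topology gs_open_def
    proof (intro conjI ballI)
      fix f assume f: "f \<in> {f \<in> test m. T f \<in> U}"
      then obtain B e where B: "gs_bounded (1/2) n B" "e > 0"
        "\<And>v. v \<in> gs_dual (1/2) n \<Longrightarrow> (\<forall>\<phi>\<in>B. norm (v \<phi> - T f \<phi>) < e) \<Longrightarrow> v \<in> U"
        using U unfolding openin_gs_dual_topology gs_dual_open_def by blast
      obtain r where r: "r > 0" "\<And>\<phi>. \<phi> \<in> B \<Longrightarrow> \<phi> \<in> test n \<and> l1 n \<phi> \<le> r" using gs_bounded_l1[OF B(1)] by auto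
      have Cr: "C * r \<ge> 0" using C r by simp
      show "\<exists>V. gs_nbhd (1/2) m V \<and> (\<forall>g\<in>V. (\<lambda>x. f x + g x) \<in> {f \<in> test m. T f \<in> U})"
      proof (intro exI[of _ "{g \<in> test m. l1 m g < e / (C * r + 1)}"] conjI ballI)
        show "gs_nbhd (1/2) m {g \<in> test m. l1 m g < e / (C * r + 1)}" using B(2) Cr by (intro gs_nbhd_l1) simp
        fix g assume g: "g \<in> {g \<in> test m. l1 m g < e / (C * r + 1)}"
        have t: "(\<lambda>x. f x + g x) \<in> test m" using f g test_linear[of f m g 1 1] by simp
        have T: "T (\<lambda>x. f x + g x) = (\<lambda>\<phi>. T f \<phi> + T g \<phi>)" using lin1[of f g 1 1] f g by simp
        have "norm (T g \<phi>) < e" if "\<phi> \<in> B" for \<phi>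
        proof -
          have "norm (T g \<phi>) \<le> C * l1 m g * l1 n \<phi>" using g r(2)[OF that] bound by simp
          also have "\<dots> \<le> C * l1 m g * r" using r(2)[OF that] C by (intro mult_left_mono) auto
          also have "\<dots> = (C * r) * l1 m g" by simp
          also have "\<dots> \<le> (C * r) * (e / (C * r + 1))" using g Cr by (intro mult_left_mono) auto
          also have "\<dots> < e" using B(2) Cr by (simp add: field_simps)
          finally show ?thesis .
        qed
        then have "T (\<lambda>x. f x + g x) \<in> U" by (intro B(3) dual t) (simp add: T)
        then show "(\<lambda>x. f x + g x) \<in> {f \<in> test m. T f \<in> U}" using t by simp
      qed
    qed auto
  qed
  then show ?thesis unfolding cont_ops_def using lin1 by blast
qed

section \<open>Operators given by a coefficient kernel\<close>

text \<open>The operator with coefficient kernel k. The index \<open>\<gamma>\<close> consists of an index of R^n, followed by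
  an index of R^m; \<open>coef n \<phi> \<gamma>\<close> sees the first part only.\<close>

definition kernel_op :: "nat \<Rightarrow> nat \<Rightarrow> ((nat \<Rightarrow> nat) \<Rightarrow> complex) \<Rightarrow> seq_fun \<Rightarrow> functional" where
  "kernel_op m n k = (\<lambda>f \<phi>. if \<phi> \<in> test n
     then \<Sum>\<^sub>\<infinity>\<gamma>\<in>mi (n + m). k \<gamma> * (coef n \<phi> \<gamma> * coef m f (mi_drop n \<gamma>)) else 0)"

lemma hbound_split: "hbound n \<gamma> * hbound m (mi_drop n \<gamma>) = hbound (n + m) \<gamma>"
  unfolding hbound_def prod_lessThan_add mi_drop_def by simp

lemma kernel_op_term_le:
  assumes "integrable (leb m) f" "integrable (leb n) \<phi>"
  shows "norm (k \<gamma> * (coef n \<phi> \<gamma> * coef m f (mi_drop n \<gamma>))) \<le> norm (k \<gamma>) * hbound (n + m) \<gamma> * (l1 m f * l1 n \<phi>)"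
proof -
  have "norm (k \<gamma> * (coef n \<phi> \<gamma> * coef m f (mi_drop n \<gamma>))) \<le> norm (k \<gamma>) * ((hbound n \<gamma> * l1 n \<phi>) * (hbound m (mi_drop n \<gamma>) * l1 m f))"
    unfolding norm_mult l1_def
    by (intro mult_left_mono mult_mono coef_norm_le assms) auto
  also have "\<dots> = norm (k \<gamma>) * hbound (n + m) \<gamma> * (l1 m f * l1 n \<phi>)"
    unfolding hbound_split[symmetric] by (simp add: mult.assoc mult.commute mult.left_commute)
  finally show ?thesis .
qed

lemma kernel_op_summable:
  assumes k: "hsummable (n + m) k" and f: "f \<in> test m" and \<phi>: "\<phi> \<in> test n"
  shows "(\<lambda>\<gamma>. k \<gamma> * (coef n \<phi> \<gamma> * coef m f (mi_drop n \<gamma>))) summable_on mi (n + m)"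
  by (rule Infinite_Sum.abs_summable_summable,
      rule summable_on_comparison_test[OF summable_on_cmult_left[OF k[unfolded hsummable_def], of "l1 m f * l1 n \<phi>"]])
     (use kernel_op_term_le[OF test_integrable[OF f] test_integrable[OF \<phi>]] in auto)

lemma kernel_op_bound:
  assumes k: "hsummable (n + m) k" and f: "f \<in> test m" and \<phi>: "\<phi> \<in> test n"
  shows "norm (kernel_op m n k f \<phi>) \<le> (\<Sum>\<^sub>\<infinity>\<gamma>\<in>mi (n + m). norm (k \<gamma>) * hbound (n + m) \<gamma>) * l1 m f * l1 n \<phi>"
proof -
  have "norm (kernel_op m n k f \<phi>) \<le> (\<Sum>\<^sub>\<infinity>\<gamma>\<in>mi (n + m). norm (k \<gamma>) * hbound (n + m) \<gamma> * (l1 m f * l1 n \<phi>))"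
  proof -
    have "norm (\<Sum>\<^sub>\<infinity>\<gamma>\<in>mi (n + m). k \<gamma> * (coef n \<phi> \<gamma> * coef m f (mi_drop n \<gamma>))) \<le>
        (\<Sum>\<^sub>\<infinity>\<gamma>\<in>mi (n + m). norm (k \<gamma>) * hbound (n + m) \<gamma> * (l1 m f * l1 n \<phi>))"
    proof (rule norm_infsum_le[OF has_sum_infsum has_sum_infsum])
      show "(\<lambda>\<gamma>. norm (k \<gamma>) * hbound (n + m) \<gamma> * (l1 m f * l1 n \<phi>)) summable_on mi (n + m)"
        by (rule summable_on_cmult_left[OF k[unfolded hsummable_def]])
    qed (use kernel_op_summable[OF assms] kernel_op_term_le[OF test_integrable[OF f] test_integrable[OF \<phi>]] in auto)
    then show ?thesis unfolding kernel_op_def using \<phi> by simp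
  qed
  also have "\<dots> = (\<Sum>\<^sub>\<infinity>\<gamma>\<in>mi (n + m). norm (k \<gamma>) * hbound (n + m) \<gamma>) * (l1 m f * l1 n \<phi>)"
    by (rule infsum_cmult_left')
  finally show ?thesis by (simp add: mult.assoc)
qed

lemma infsum_linear:
  fixes A B :: "'a \<Rightarrow> complex"
  assumes "A summable_on S" "B summable_on S"
  shows "(\<Sum>\<^sub>\<infinity>x\<in>S. a * A x + b * B x) = a * (\<Sum>\<^sub>\<infinity>x\<in>S. A x) + b * (\<Sum>\<^sub>\<infinity>x\<in>S. B x)"
  using infsum_add[OF summable_on_cmult_right[OF assms(1), of a] summable_on_cmult_right[OF assms(2), of b]]
  by (simp add: infsum_cmult_right')

lemma kernel_op_cont:
  assumes k: "hsummable (n + m) k" shows "kernel_op m n k \<in> cont_ops m n"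
proof (rule cont_opsI)
  show "norm (kernel_op m n k f \<phi>) \<le> (\<Sum>\<^sub>\<infinity>\<gamma>\<in>mi (n + m). norm (k \<gamma>) * hbound (n + m) \<gamma>) * l1 m f * l1 n \<phi>"
    if "f \<in> test m" "\<phi> \<in> test n" for f \<phi> by (rule kernel_op_bound[OF k that])
  show "(\<Sum>\<^sub>\<infinity>\<gamma>\<in>mi (n + m). norm (k \<gamma>) * hbound (n + m) \<gamma>) \<ge> 0" by (intro infsum_nonneg) simp
  show "kernel_op m n k f \<phi> = 0" if "\<phi> \<notin> test n" for f \<phi> using that unfolding kernel_op_def by simp
  fix f assume f: "f \<in> test m"
  show "kernel_op m n k f (\<lambda>x. a * \<phi> x + b * \<psi> x) = a * kernel_op m n k f \<phi> + b * kernel_op m n k f \<psi>"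
    if \<phi>: "\<phi> \<in> test n" and \<psi>: "\<psi> \<in> test n" for \<phi> \<psi> a b
  proof -
    have "k \<gamma> * (coef n (\<lambda>x. a * \<phi> x + b * \<psi> x) \<gamma> * c) = a * (k \<gamma> * (coef n \<phi> \<gamma> * c)) + b * (k \<gamma> * (coef n \<psi> \<gamma> * c))" for \<gamma> c
      unfolding test_coef_linear[OF \<phi> \<psi>] by (simp add: algebra_simps)
    then show ?thesis unfolding kernel_op_def using \<phi> \<psi> test_linear[OF \<phi> \<psi>]
      by (simp add: infsum_linear kernel_op_summable[OF k f])
  qed
  show "kernel_op m n k (\<lambda>x. a * f x + b * g x) = (\<lambda>\<phi>. a * kernel_op m n k f \<phi> + b * kernel_op m n k g \<phi>)"
    if g: "g \<in> test m" for g a b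
  proof
    fix \<phi>
    show "kernel_op m n k (\<lambda>x. a * f x + b * g x) \<phi> = a * kernel_op m n k f \<phi> + b * kernel_op m n k g \<phi>"
    proof (cases "\<phi> \<in> test n")
      case True
      have "k \<gamma> * (c * coef m (\<lambda>x. a * f x + b * g x) \<delta>) = a * (k \<gamma> * (c * coef m f \<delta>)) + b * (k \<gamma> * (c * coef m g \<delta>))" for \<gamma> \<delta> c
        unfolding test_coef_linear[OF f g] by (simp add: algebra_simps)
      with True show ?thesis unfolding kernel_op_def
        by (simp add: infsum_linear kernel_op_summable[OF k _ True] f g)
    qed (simp add: kernel_op_def)
  qed
qed

text \<open>The pairing of the series with the tensor product is evaluated termwise, and the coefficients of
  a tensor product are products.\<close>

lemma kernel_op_has_kernel:
  assumes k: "hsummable (n + m) k"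
  shows "has_kernel m n (kernel_op m n k) (dist_of (n + m) (series (n + m) k))"
  unfolding has_kernel_def scalar_prod_def
proof (intro ballI)
  fix f g assume f: "f \<in> test m" and g: "g \<in> test n"
  let ?g = "\<lambda>x. cnj (g x)"
  have g': "?g \<in> test n" by (rule test_cnj[OF g])
  have t: "tensor n ?g f \<in> test (n + m)" by (rule test_tensor(1)[OF g' f])
  have e: "(\<lambda>x. cnj (tensor n g (\<lambda>y. cnj (f y)) x)) = tensor n ?g f" unfolding tensor_def by simp
  have "dist_of (n + m) (series (n + m) k) (tensor n ?g f) = (\<Sum>\<^sub>\<infinity>\<gamma>\<in>mi (n + m). k \<gamma> * coef (n + m) (tensor n ?g f) \<gamma>)"
    unfolding dist_of_def using t by (simp add: series_integral[OF k test_integrable[OF t]])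
  also have "\<dots> = kernel_op m n k f ?g"
    unfolding kernel_op_def using g' by (simp add: test_tensor(2)[OF g' f] cong: infsum_cong)
  finally show "kernel_op m n k f (\<lambda>x. cnj (g x)) = dist_of (n + m) (series (n + m) k) (\<lambda>x. cnj (tensor n g (\<lambda>y. cnj (f y)) x))"
    unfolding e by simp
qed

subsection \<open>Diagonal kernels\<close>

text \<open>The coefficients of \<open>\<Sum> l(\<eta>) h(\<eta>) \<otimes> h(\<eta>)\<close>. The two parts of the index are compared as
  sequences, so \<open>\<eta>\<close> runs through the multi-indices common to both dimensions, and in the larger
  dimension it is padded with zeros.\<close>

definition diag_kernel :: "nat \<Rightarrow> ((nat \<Rightarrow> nat) \<Rightarrow> real) \<Rightarrow> (nat \<Rightarrow> nat) \<Rightarrow> complex" where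
  "diag_kernel n l \<gamma> = (if mi_take n \<gamma> = mi_drop n \<gamma> then of_real (l (mi_drop n \<gamma>)) else 0)"

lemma mi_mono: "m \<le> n \<Longrightarrow> mi m \<subseteq> mi n"
  by (auto simp: mi_def)

lemma mi_min: "\<eta> \<in> mi (min m n) \<longleftrightarrow> \<eta> \<in> mi m \<and> \<eta> \<in> mi n"
  by (cases "m \<le> n") (use mi_mono[of m n] mi_mono[of n m] in \<open>auto simp: min_def\<close>)

lemma bij_diag: "bij_betw (\<lambda>\<eta>. mi_append n \<eta> \<eta>) (mi (min m n)) {\<gamma> \<in> mi (n + m). mi_take n \<gamma> = mi_drop n \<gamma>}"
proof (rule bij_betw_byWitness[where f' = "mi_drop n"])
  show "\<forall>\<gamma>\<in>{\<gamma> \<in> mi (n + m). mi_take n \<gamma> = mi_drop n \<gamma>}. mi_append n (mi_drop n \<gamma>) (mi_drop n \<gamma>) = \<gamma>"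
    by (metis (mono_tags, lifting) mem_Collect_eq mi_append_take_drop)
  show "mi_drop n ` {\<gamma> \<in> mi (n + m). mi_take n \<gamma> = mi_drop n \<gamma>} \<subseteq> mi (min m n)"
    using mi_drop_in mi_take_in by (auto simp: mi_min) (metis mi_take_in)
qed (auto simp: mi_min mi_append_in mi_take_append)

lemma kernel_op_diag:
  assumes "\<phi> \<in> test n"
  shows "kernel_op m n (diag_kernel n l) f \<phi> = (\<Sum>\<^sub>\<infinity>\<eta>\<in>mi (min m n). of_real (l \<eta>) * (coef n \<phi> \<eta> * coef m f \<eta>))"
proof -
  let ?F = "\<lambda>\<gamma>. diag_kernel n l \<gamma> * (coef n \<phi> \<gamma> * coef m f (mi_drop n \<gamma>))"
  have "(\<Sum>\<^sub>\<infinity>\<gamma>\<in>mi (n + m). ?F \<gamma>) = (\<Sum>\<^sub>\<infinity>\<gamma>\<in>{\<gamma> \<in> mi (n + m). mi_take n \<gamma> = mi_drop n \<gamma>}. ?F \<gamma>)"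
    by (rule infsum_cong_neutral) (auto simp: diag_kernel_def)
  also have "\<dots> = (\<Sum>\<^sub>\<infinity>\<eta>\<in>mi (min m n). ?F (mi_append n \<eta> \<eta>))"
    by (rule infsum_reindex_bij_betw[OF bij_diag, symmetric])
  also have "\<dots> = (\<Sum>\<^sub>\<infinity>\<eta>\<in>mi (min m n). of_real (l \<eta>) * (coef n \<phi> \<eta> * coef m f \<eta>))"
  proof (rule infsum_cong)
    fix \<eta> assume "\<eta> \<in> mi (min m n)"
    then have "\<eta> \<in> mi n" by (simp add: mi_min)
    then show "?F (mi_append n \<eta> \<eta>) = of_real (l \<eta>) * (coef n \<phi> \<eta> * coef m f \<eta>)"
      using coef_mi_take[of n \<phi> "mi_append n \<eta> \<eta>"] by (simp add: diag_kernel_def mi_take_append)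
  qed
  finally show ?thesis unfolding kernel_op_def using assms by simp
qed

lemma kernel_op_diag_eigen: "hermite_eigen m (kernel_op m m (diag_kernel m l))"
  unfolding hermite_eigen_def
proof (intro allI exI ext)
  fix \<alpha> \<phi>
  show "kernel_op m m (diag_kernel m l) (hermite m \<alpha>) \<phi> = of_real (l (mi_take m \<alpha>)) * dist_of m (hermite m \<alpha>) \<phi>"
  proof (cases "\<phi> \<in> test m")
    case True
    have "kernel_op m m (diag_kernel m l) (hermite m \<alpha>) \<phi> = (\<Sum>\<^sub>\<infinity>\<eta>\<in>mi m. of_real (l \<eta>) * (coef m \<phi> \<eta> * coef m (hermite m \<alpha>) \<eta>))"
      using kernel_op_diag[OF True, of m l] by simp
    also have "\<dots> = (\<Sum>\<^sub>\<infinity>\<eta>\<in>{mi_take m \<alpha>}. of_real (l \<eta>) * coef m \<phi> \<eta>)"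
    proof (rule infsum_cong_neutral)
      fix \<eta> assume \<eta>: "\<eta> \<in> mi m - {mi_take m \<alpha>}"
      have "\<not> (\<forall>i<m. \<alpha> i = \<eta> i)"
      proof
        assume "\<forall>i<m. \<alpha> i = \<eta> i"
        then have "\<eta> = mi_take m \<alpha>" using \<eta> by (auto simp: mi_take_def mi_def)
        with \<eta> show False by simp
      qed
      then show "of_real (l \<eta>) * (coef m \<phi> \<eta> * coef m (hermite m \<alpha>) \<eta>) = 0"
        unfolding hermite_eq coef_hprod by auto
    next
      fix \<eta> assume "\<eta> \<in> mi m \<inter> {mi_take m \<alpha>}"
      then show "of_real (l \<eta>) * (coef m \<phi> \<eta> * coef m (hermite m \<alpha>) \<eta>) = of_real (l \<eta>) * coef m \<phi> \<eta>"
        unfolding hermite_eq coef_hprod by (simp add: mi_take_def)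
    qed auto
    also have "\<dots> = of_real (l (mi_take m \<alpha>)) * coef m \<phi> \<alpha>" by (simp add: coef_mi_take)
    also have "coef m \<phi> \<alpha> = dist_of m (hermite m \<alpha>) \<phi>"
      using True unfolding dist_of_def hermite_eq coef_def by (simp add: mult.commute)
    finally show ?thesis .
  qed (simp add: kernel_op_def dist_of_def)
qed

lemma infsum_complex_of_real: "(\<Sum>\<^sub>\<infinity>x\<in>S. complex_of_real (g x)) = of_real (\<Sum>\<^sub>\<infinity>x\<in>S. g x)"
proof (cases "g summable_on S")
  case True
  then show ?thesis by (intro infsumI has_sum_of_real has_sum_infsum)
next
  case False
  then have "\<not> (\<lambda>x. complex_of_real (g x)) summable_on S"
    using summable_on_Re[of "\<lambda>x. complex_of_real (g x)" S] by auto
  with False show ?thesis by (simp add: infsum_not_exists)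
qed

lemma kernel_op_diag_pos:
  assumes l: "\<And>\<eta>. l \<eta> \<ge> 0"
  shows "pos_semidef m (kernel_op m m (diag_kernel m l))"
  unfolding pos_semidef_def scalar_prod_def
proof
  fix f assume f: "f \<in> test m"
  have "kernel_op m m (diag_kernel m l) f (\<lambda>x. cnj (f x)) = (\<Sum>\<^sub>\<infinity>\<eta>\<in>mi m. of_real (l \<eta> * (cmod (coef m f \<eta>))\<^sup>2))"
    unfolding kernel_op_diag[OF test_cnj[OF f]] coef_cnj
    unfolding of_real_mult complex_norm_square by (simp add: mult.commute)
  also have "\<dots> = of_real (\<Sum>\<^sub>\<infinity>\<eta>\<in>mi m. l \<eta> * (cmod (coef m f \<eta>))\<^sup>2)"
    by (rule infsum_complex_of_real)
  finally show "kernel_op m m (diag_kernel m l) f (\<lambda>x. cnj (f x)) \<in> \<real>\<^sub>\<ge>\<^sub>0"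
    using l by (auto simp: nonneg_Reals_of_real_iff intro!: infsum_nonneg mult_nonneg_nonneg)
qed

text \<open>An index of R^m padded with zeros belongs to the tensor product of a Hermite function on R^m with
  the Gaussian \<open>hermite (n - m) (\<lambda>_. 0)\<close>.\<close>

lemma kernel_op_diag_hermite:
  assumes mn: "m \<le> n" and k: "hsummable (m + m) (diag_kernel m l)" and l: "\<And>\<eta>. l \<eta> \<ge> 0"
  shows "pos_hermite_diag m n (kernel_op m n (diag_kernel n l))"
  unfolding pos_hermite_diag_def
proof (intro bexI[of _ "kernel_op m m (diag_kernel m l)"] conjI)
  show "hermite_eigen m (kernel_op m m (diag_kernel m l))" by (rule kernel_op_diag_eigen)
  show "pos_semidef m (kernel_op m m (diag_kernel m l))" by (rule kernel_op_diag_pos[OF l])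
  show "kernel_op m m (diag_kernel m l) \<in> cont_ops m m" by (rule kernel_op_cont[OF k])
  let ?T = "kernel_op m n (diag_kernel n l)" and ?D = "kernel_op m m (diag_kernel m l)"
  show "n = m \<and> (\<forall>f\<in>test m. ?T f = ?D f) \<or>
      m < n \<and> (\<exists>\<gamma>. \<forall>f\<in>test m. ?T f = dist_tensor m (n - m) (?D f) (dist_of (n - m) (hermite (n - m) \<gamma>)))"
  proof (cases "n = m")
    case False
    define p where "p = n - m"
    have n: "n = m + p" "m < n" unfolding p_def using mn False by auto
    have "?T f = dist_tensor m p (?D f) (dist_of p (hermite p (\<lambda>_. 0)))" if f: "f \<in> test m" for f
    proof
      fix \<phi>
      show "?T f \<phi> = dist_tensor m p (?D f) (dist_of p (hermite p (\<lambda>_. 0))) \<phi>"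
      proof (cases "\<phi> \<in> test n")
        case True
        then have \<phi>: "\<phi> \<in> test (m + p)" unfolding n(1) .
        let ?a = "\<lambda>\<alpha>. coef (m + p) \<phi> (mi_append m \<alpha> (mi_take p (\<lambda>_. 0)))"
        have a: "?a \<in> test_seqs m" by (rule test.coef_slice_in[OF test_coef[OF \<phi>] mi_take_in])
        have "dist_tensor m p (?D f) (dist_of p (hermite p (\<lambda>_. 0))) \<phi> = ?D f (series m ?a)"
          unfolding dist_tensor_def using \<phi> by (simp add: test_slice(2)[OF \<phi>] cong: if_cong)
        also have "\<dots> = (\<Sum>\<^sub>\<infinity>\<eta>\<in>mi m. of_real (l \<eta>) * (coef m (series m ?a) \<eta> * coef m f \<eta>))"
          using kernel_op_diag[OF test_series[OF a], of m l f] by simp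
        also have "\<dots> = (\<Sum>\<^sub>\<infinity>\<eta>\<in>mi m. of_real (l \<eta>) * (coef n \<phi> \<eta> * coef m f \<eta>))"
        proof (rule infsum_cong)
          fix \<eta> assume \<eta>: "\<eta> \<in> mi m"
          then have "mi_append m \<eta> (mi_take p (\<lambda>_. 0)) = \<eta>" by (auto simp: mi_append_def mi_take_def mi_def)
          then show "of_real (l \<eta>) * (coef m (series m ?a) \<eta> * coef m f \<eta>) = of_real (l \<eta>) * (coef n \<phi> \<eta> * coef m f \<eta>)"
            using coef_series[OF test_seqs_hsummable[OF a] \<eta>] unfolding n(1) by simp
        qed
        also have "\<dots> = ?T f \<phi>" using kernel_op_diag[OF True, of m l f] mn by simp
        finally show ?thesis by simp
      qed (simp add: kernel_op_def dist_tensor_def n(1))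
    qed
    then show ?thesis using n(2) unfolding p_def by blast
  qed simp
qed

lemma kernel_op_diag_adjoint:
  "is_adjoint m n (kernel_op m n (diag_kernel n l)) (kernel_op n m (diag_kernel m l))"
  unfolding is_adjoint_def scalar_prod_def
proof (intro ballI)
  fix f g assume f: "f \<in> test m" and g: "g \<in> test n"
  show "kernel_op n m (diag_kernel m l) g (\<lambda>x. cnj (f x)) = cnj (kernel_op m n (diag_kernel n l) f (\<lambda>x. cnj (g x)))"
    unfolding kernel_op_diag[OF test_cnj[OF f]] kernel_op_diag[OF test_cnj[OF g]] coef_cnj infsum_cnj[symmetric]
    by (simp add: min.commute mult.commute)
qed

section \<open>The factorization\<close>

text \<open>The choice of the diagonal: the root L of the supremum has the decay of a square root, and each
  \<open>F \<alpha>\<close> splits into L and a factor that decays like \<open>sqrt |F \<alpha>|\<close>. If \<open>L = 0\<close>, all \<open>F \<alpha>\<close> vanish, and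
  the convention \<open>0 / 0 = 0\<close> gives the right quotient.\<close>

lemma root_sup_majorant:
  fixes F :: "'a \<Rightarrow> complex" and r :: real
  assumes A: "A \<noteq> {}" and r: "r \<ge> 1" and b: "\<And>\<alpha> j. \<alpha> \<in> A \<Longrightarrow> norm (F \<alpha>) * r ^ j \<le> w j"
  defines "L \<equiv> sqrt (SUP \<alpha>\<in>A. norm (F \<alpha>))"
  shows "0 \<le> L" "\<bar>L\<bar> * r ^ j \<le> sqrt (w (2 * j))"
    "\<alpha> \<in> A \<Longrightarrow> norm (F \<alpha> / of_real L) \<le> sqrt (norm (F \<alpha>))"
    "\<alpha> \<in> A \<Longrightarrow> F \<alpha> / of_real L * of_real L = F \<alpha>"
proof -
  have bdd: "bdd_above ((\<lambda>\<alpha>. norm (F \<alpha>)) ` A)" using b[of _ 0] by (auto simp: bdd_above_def)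
  have up: "norm (F \<alpha>) \<le> (SUP \<alpha>\<in>A. norm (F \<alpha>))" if "\<alpha> \<in> A" for \<alpha> using cSUP_upper[OF that bdd] .
  obtain \<alpha>0 where "\<alpha>0 \<in> A" using A by auto
  then have "0 \<le> (SUP \<alpha>\<in>A. norm (F \<alpha>))" using up[of \<alpha>0] norm_ge_zero order_trans by blast
  then show L0: "0 \<le> L" unfolding L_def by simp
  have rj: "r ^ j > 0" using r by simp
  have "L \<le> sqrt (w (2 * j) / (r ^ j)\<^sup>2)"
    unfolding L_def
  proof (intro real_sqrt_le_mono cSUP_least A)
    fix \<alpha> assume "\<alpha> \<in> A"
    from b[OF this, of "2 * j"] have "norm (F \<alpha>) * (r ^ j)\<^sup>2 \<le> w (2 * j)"
      unfolding power_mult[symmetric] by (simp add: mult.commute)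
    then show "norm (F \<alpha>) \<le> w (2 * j) / (r ^ j)\<^sup>2"
      by (simp only: pos_le_divide_eq[OF zero_less_power[OF rj]])
  qed
  then show "\<bar>L\<bar> * r ^ j \<le> sqrt (w (2 * j))" using rj L0 by (simp add: real_sqrt_divide pos_le_divide_eq)
  assume \<alpha>: "\<alpha> \<in> A"
  have L: "sqrt (norm (F \<alpha>)) \<le> L" unfolding L_def by (intro real_sqrt_le_mono up \<alpha>)
  show "norm (F \<alpha> / of_real L) \<le> sqrt (norm (F \<alpha>))"
  proof (cases "L = 0")
    case False
    then have "L > 0" using L0 by simp
    moreover have "norm (F \<alpha>) \<le> sqrt (norm (F \<alpha>)) * L"
      using mult_left_mono[OF L, of "sqrt (norm (F \<alpha>))"] by simp
    ultimately show ?thesis by (simp add: norm_divide pos_divide_le_eq)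
  qed simp
  show "F \<alpha> / of_real L * of_real L = F \<alpha>"
  proof (cases "L = 0")
    case True
    then show ?thesis using L by simp
  qed simp
qed

lemma mlen_mi: "p \<le> n \<Longrightarrow> \<eta> \<in> mi p \<Longrightarrow> mlen n \<eta> = mlen p \<eta>"
  unfolding mlen_def mi_def by (intro sum.mono_neutral_right) auto

lemma mi_nonempty: "mi d \<noteq> {}"
  using mi_take_in[of d "\<lambda>_. 0"] by blast

context weight_class
begin

lemma diag_kernel_in:
  assumes v: "v \<in> W" and l: "\<And>\<eta> j. \<eta> \<in> mi (min m n) \<Longrightarrow> \<bar>l \<eta>\<bar> * mroot (min m n) \<eta> ^ j \<le> v j"
  shows "diag_kernel n l \<in> weighted_seqs W (n + m)"
proof (rule weighted_seqsI)
  show "(\<lambda>j. 1 * sqrt 2 ^ j * v j) \<in> W" by (rule scale[OF v]) auto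
  have v0: "0 \<le> v j" for j
    by (rule weighted_bound_nonneg[where d = "min m n" and a = "\<lambda>\<eta>. complex_of_real (l \<eta>)" and w = v]) (use l in simp)
  fix \<gamma> j assume \<gamma>: "\<gamma> \<in> mi (n + m)"
  show "norm (diag_kernel n l \<gamma>) * mroot (n + m) \<gamma> ^ j \<le> 1 * sqrt 2 ^ j * v j"
  proof (cases "mi_take n \<gamma> = mi_drop n \<gamma>")
    case True
    define \<eta> where "\<eta> = mi_drop n \<gamma>"
    have g: "\<gamma> = mi_append n \<eta> \<eta>" using True mi_append_take_drop[of n \<gamma>] by (simp add: \<eta>_def)
    have \<eta>: "\<eta> \<in> mi m" "\<eta> \<in> mi n" "\<eta> \<in> mi (min m n)"
      using mi_drop_in[OF \<gamma>] mi_take_in[of n \<gamma>] True unfolding \<eta>_def mi_min by auto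
    have "mroot (n + m) \<gamma> \<le> sqrt 2 * mroot (min m n) \<eta>"
      unfolding mroot_def g mlen_append real_sqrt_mult[symmetric] mlen_mi[OF min.cobounded1 \<eta>(3)] mlen_mi[OF min.cobounded2 \<eta>(3)]
      by (intro real_sqrt_le_mono) simp
    then have "mroot (n + m) \<gamma> ^ j \<le> sqrt 2 ^ j * mroot (min m n) \<eta> ^ j"
      unfolding power_mult_distrib[symmetric] using mroot_ge_1[of "n + m" \<gamma>] by (intro power_mono) auto
    then have "\<bar>l \<eta>\<bar> * mroot (n + m) \<gamma> ^ j \<le> \<bar>l \<eta>\<bar> * (sqrt 2 ^ j * mroot (min m n) \<eta> ^ j)" by (intro mult_left_mono) auto
    also have "\<dots> = sqrt 2 ^ j * (\<bar>l \<eta>\<bar> * mroot (min m n) \<eta> ^ j)" by simp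
    also have "\<dots> \<le> sqrt 2 ^ j * v j" by (intro mult_left_mono l \<eta>) auto
    finally show ?thesis using True by (simp add: diag_kernel_def \<eta>_def)
  qed (use v0 in \<open>simp add: diag_kernel_def\<close>)
qed

text \<open>Parseval's identity in the inner variable.\<close>

lemma kernel_comp_series:
  assumes k2: "k2 \<in> weighted_seqs W (n + l)" and k1: "k1 \<in> weighted_seqs W (l + m)"
  shows "kernel_comp n l (series (n + l) k2) (series (l + m) k1) w =
    (\<Sum>\<^sub>\<infinity>\<zeta>\<in>mi l. slice_fst n k2 w \<zeta> * slice_snd l m k1 (drop_pt n w) \<zeta>)"
proof -
  have h: "hsummable (n + l) k2" "hsummable (l + m) k1" using k1 k2 by (auto intro!: rapid_hsummable weighted_seqs_rapid)
  have s2: "rapid l (slice_fst n k2 w)" and s1: "rapid l (slice_snd l m k1 (drop_pt n w))"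
    using slice_norm_bounds(1)[OF k2, of w] slice_norm_bounds(2)[OF k1, of "drop_pt n w"] weighted_seqs_rapid by auto
  have e2: "series (n + l) k2 (append_pt n w z) = series l (slice_fst n k2 w) z" for z
    unfolding series_slice_fst[OF h(1)] slice_fst_append_pt by simp
  have e1: "series (l + m) k1 (append_pt l z y) = series l (slice_snd l m k1 y) z" for z y
    unfolding series_slice_snd[OF h(2)] drop_append_pt by (rule series_cong_pt) (simp add: append_pt_def)
  have "kernel_comp n l (series (n + l) k2) (series (l + m) k1) w =
     (\<integral>z. series l (slice_fst n k2 w) z * series l (slice_snd l m k1 (drop_pt n w)) z \<partial>leb l)"
    unfolding kernel_comp_def e2 e1 ..
  also have "\<dots> = (\<Sum>\<^sub>\<infinity>\<zeta>\<in>mi l. slice_fst n k2 w \<zeta> * coef l (series l (slice_snd l m k1 (drop_pt n w))) \<zeta>)"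
    by (intro series_integral rapid_hsummable s2 quad_decay_integrable series_quad_decay s1)
  also have "\<dots> = (\<Sum>\<^sub>\<infinity>\<zeta>\<in>mi l. slice_fst n k2 w \<zeta> * slice_snd l m k1 (drop_pt n w) \<zeta>)"
    by (intro infsum_cong) (simp add: coef_series[OF rapid_hsummable[OF s1]])
  finally show ?thesis .
qed

text \<open>The sequence l is the root of the supremum over the indices of R^d2, and \<open>k2\<close> is the quotient. The
  indices of R^d0 that are not indices of R^d1 are given the coefficient 0.\<close>

lemma factor_diag_right:
  assumes k: "k \<in> weighted_seqs W (d2 + d1)" and d: "d1 \<le> d0"
  obtains l k2 where "\<And>\<eta>. l \<eta> \<ge> (0 :: real)" "\<And>n. min d1 n = d1 \<Longrightarrow> diag_kernel n l \<in> weighted_seqs W (n + d1)"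
    "k2 \<in> weighted_seqs W (d2 + d0)"
    "kernel_comp d2 d0 (series (d2 + d0) k2) (series (d0 + d1) (diag_kernel d0 l)) = series (d2 + d1) k"
proof -
  obtain w where w: "w \<in> W" "\<And>\<gamma> n. \<gamma> \<in> mi (d2 + d1) \<Longrightarrow> norm (k \<gamma>) * mroot (d2 + d1) \<gamma> ^ n \<le> w n"
    using k unfolding weighted_seqs_def by auto
  define l where "l = (\<lambda>\<eta>. if \<eta> \<in> mi d1 then sqrt (SUP \<alpha>\<in>mi d2. norm (k (mi_append d2 \<alpha> \<eta>))) else 0)"
  have L: "l \<eta> = sqrt (SUP \<alpha>\<in>mi d2. norm (k (mi_append d2 \<alpha> \<eta>)))" if "\<eta> \<in> mi d1" for \<eta>
    using that by (simp add: l_def)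
  have root: "0 \<le> l \<eta>" "\<bar>l \<eta>\<bar> * mroot d1 \<eta> ^ j \<le> sqrt (w (2 * j))"
    "\<alpha> \<in> mi d2 \<Longrightarrow> norm (k (mi_append d2 \<alpha> \<eta>) / of_real (l \<eta>)) \<le> sqrt (norm (k (mi_append d2 \<alpha> \<eta>)))"
    "\<alpha> \<in> mi d2 \<Longrightarrow> k (mi_append d2 \<alpha> \<eta>) / of_real (l \<eta>) * of_real (l \<eta>) = k (mi_append d2 \<alpha> \<eta>)"
    if \<eta>: "\<eta> \<in> mi d1" for \<eta> \<alpha> j
    using root_sup_majorant[where A = "mi d2" and F = "\<lambda>\<alpha>. k (mi_append d2 \<alpha> \<eta>)" and r = "mroot d1 \<eta>" and w = w,
      OF mi_nonempty mroot_ge_1 slice_bounds(2)[OF w(2) \<eta>]] unfolding L[OF \<eta>] by blast+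
  have l0: "l \<eta> \<ge> 0" for \<eta> using root(1)[of \<eta>] by (cases "\<eta> \<in> mi d1") (simp_all add: l_def)
  have diag: "diag_kernel n l \<in> weighted_seqs W (n + d1)" if "min d1 n = d1" for n
    by (rule diag_kernel_in[OF halve[OF w(1)]]) (unfold that, rule root(2))
  define k2 where "k2 = (\<lambda>\<gamma>. if mi_drop d2 \<gamma> \<in> mi d1 then k \<gamma> / of_real (l (mi_drop d2 \<gamma>)) else 0)"
  have w0: "w n \<ge> 0" for n by (rule weighted_bound_nonneg[where a = k and w = w, OF w(2)])
  have k2: "k2 \<in> weighted_seqs W (d2 + d0)"
  proof (rule weighted_seqsI[OF halve[OF w(1)]])
    fix \<gamma> n assume \<gamma>: "\<gamma> \<in> mi (d2 + d0)"
    show "norm (k2 \<gamma>) * mroot (d2 + d0) \<gamma> ^ n \<le> sqrt (w (2 * n))"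
    proof (cases "mi_drop d2 \<gamma> \<in> mi d1")
      case True
      have \<gamma>1: "\<gamma> \<in> mi (d2 + d1)" using mi_append_in[OF True, of d2 "mi_take d2 \<gamma>"] by simp
      have m: "mroot (d2 + d0) \<gamma> = mroot (d2 + d1) \<gamma>"
        unfolding mroot_def using mlen_mi[OF _ \<gamma>1, of "d2 + d0"] d by simp
      have "norm (k2 \<gamma>) \<le> sqrt (norm (k \<gamma>))"
        using root(3)[OF True mi_take_in[of d2 \<gamma>]] True by (simp add: k2_def)
      then have "norm (k2 \<gamma>) * mroot (d2 + d0) \<gamma> ^ n \<le> sqrt (norm (k \<gamma>)) * mroot (d2 + d1) \<gamma> ^ n"
        unfolding m using mroot_ge_1[of "d2 + d1" \<gamma>] by (intro mult_right_mono) auto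
      also have "\<dots> = sqrt (norm (k \<gamma>) * mroot (d2 + d1) \<gamma> ^ (2 * n))"
        using mroot_ge_1[of "d2 + d1" \<gamma>] by (simp add: real_sqrt_mult mult.commute[of 2] power_mult)
      also have "\<dots> \<le> sqrt (w (2 * n))" by (intro real_sqrt_le_mono w(2) \<gamma>1)
      finally show ?thesis .
    qed (use w0 in \<open>simp add: k2_def\<close>)
  qed
  have "kernel_comp d2 d0 (series (d2 + d0) k2) (series (d0 + d1) (diag_kernel d0 l)) w' = series (d2 + d1) k w'" for w'
  proof -
    let ?y = "drop_pt d2 w'"
    have d01: "min d1 d0 = d1" using d by simp
    have "kernel_comp d2 d0 (series (d2 + d0) k2) (series (d0 + d1) (diag_kernel d0 l)) w' =
       (\<Sum>\<^sub>\<infinity>\<zeta>\<in>mi d0. slice_fst d2 k2 w' \<zeta> * slice_snd d0 d1 (diag_kernel d0 l) ?y \<zeta>)"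
      by (rule kernel_comp_series[OF k2 diag[OF d01]])
    also have "\<dots> = (\<Sum>\<^sub>\<infinity>\<zeta>\<in>mi d1. slice_fst d2 k w' \<zeta> * of_real (hprod d1 \<zeta> ?y))"
    proof (rule infsum_cong_neutral)
      show "slice_fst d2 k2 w' \<zeta> * slice_snd d0 d1 (diag_kernel d0 l) ?y \<zeta> = 0" if "\<zeta> \<in> mi d0 - mi d1" for \<zeta>
        using that by (simp add: slice_fst_def series_def k2_def)
      show "slice_fst d2 k w' \<zeta> * of_real (hprod d1 \<zeta> ?y) = 0" if "\<zeta> \<in> mi d1 - mi d0" for \<zeta>
        using that mi_mono[OF d] by blast
      fix \<zeta> assume "\<zeta> \<in> mi d0 \<inter> mi d1"
      then have \<zeta>: "\<zeta> \<in> mi d0" "\<zeta> \<in> mi d1" by auto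
      have "slice_snd d0 d1 (diag_kernel d0 l) ?y \<zeta> = (\<Sum>\<^sub>\<infinity>\<eta>\<in>{\<zeta>}. of_real (l \<eta>) * of_real (hprod d1 \<eta> ?y))"
        unfolding slice_snd_def series_def
        by (rule infsum_cong_neutral) (use \<zeta> in \<open>auto simp: diag_kernel_def mi_take_append\<close>)
      then have 1: "slice_snd d0 d1 (diag_kernel d0 l) ?y \<zeta> = of_real (l \<zeta>) * of_real (hprod d1 \<zeta> ?y)" by simp
      have "slice_fst d2 k2 w' \<zeta> * of_real (l \<zeta>) = series d2 (\<lambda>\<alpha>. of_real (l \<zeta>) * k2 (mi_append d2 \<alpha> \<zeta>)) w'"
        unfolding slice_fst_def series_cmult by (rule mult.commute)
      also have "\<dots> = slice_fst d2 k w' \<zeta>"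
        unfolding slice_fst_def series_def
      proof (rule infsum_cong)
        fix \<alpha> assume "\<alpha> \<in> mi d2"
        from root(4)[OF \<zeta>(2) this]
        show "of_real (l \<zeta>) * k2 (mi_append d2 \<alpha> \<zeta>) * of_real (hprod d2 \<alpha> w') = k (mi_append d2 \<alpha> \<zeta>) * of_real (hprod d2 \<alpha> w')"
          using \<zeta> by (simp add: k2_def mult.commute)
      qed
      finally show "slice_fst d2 k2 w' \<zeta> * slice_snd d0 d1 (diag_kernel d0 l) ?y \<zeta> = slice_fst d2 k w' \<zeta> * of_real (hprod d1 \<zeta> ?y)"
        unfolding 1 by (simp add: mult.assoc[symmetric])
    qed
    also have "\<dots> = series (d2 + d1) k w'"
      using series_slice_fst[OF rapid_hsummable[OF weighted_seqs_rapid[OF k]], of w'] by (simp add: series_def)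
    finally show ?thesis .
  qed
  then show thesis using that[OF l0 diag k2] by blast
qed

text \<open>The mirror image, with the supremum over the indices of R^d1. Diagonal kernels in both directions
  between R^d2 and R^d0 are admissible: one is the kernel of the left factor, the other one that of its
  adjoint.\<close>

lemma factor_diag_left:
  assumes k: "k \<in> weighted_seqs W (d2 + d1)" and d: "d2 \<le> d0"
  obtains l k1 where "\<And>\<eta>. l \<eta> \<ge> (0 :: real)"
    "\<And>n m. min m n = d2 \<Longrightarrow> diag_kernel n l \<in> weighted_seqs W (n + m)"
    "k1 \<in> weighted_seqs W (d0 + d1)"
    "kernel_comp d2 d0 (series (d2 + d0) (diag_kernel d2 l)) (series (d0 + d1) k1) = series (d2 + d1) k"
proof -
  obtain w where w: "w \<in> W" "\<And>\<gamma> n. \<gamma> \<in> mi (d2 + d1) \<Longrightarrow> norm (k \<gamma>) * mroot (d2 + d1) \<gamma> ^ n \<le> w n"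
    using k unfolding weighted_seqs_def by auto
  define l where "l = (\<lambda>\<alpha>. sqrt (SUP \<eta>\<in>mi d1. norm (k (mi_append d2 \<alpha> \<eta>))))"
  have root: "0 \<le> l \<alpha>" "\<bar>l \<alpha>\<bar> * mroot d2 \<alpha> ^ j \<le> sqrt (w (2 * j))"
    "\<eta> \<in> mi d1 \<Longrightarrow> norm (k (mi_append d2 \<alpha> \<eta>) / of_real (l \<alpha>)) \<le> sqrt (norm (k (mi_append d2 \<alpha> \<eta>)))"
    "\<eta> \<in> mi d1 \<Longrightarrow> k (mi_append d2 \<alpha> \<eta>) / of_real (l \<alpha>) * of_real (l \<alpha>) = k (mi_append d2 \<alpha> \<eta>)" for \<alpha> \<eta> j
    using root_sup_majorant[where A = "mi d1" and F = "\<lambda>\<eta>. k (mi_append d2 \<alpha> \<eta>)" and r = "mroot d2 \<alpha>" and w = w,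
      OF mi_nonempty mroot_ge_1 slice_bounds(1)[OF w(2)]] unfolding l_def by blast+
  have diag: "diag_kernel n l \<in> weighted_seqs W (n + m)" if "min m n = d2" for n m
    by (rule diag_kernel_in[OF halve[OF w(1)]]) (unfold that, rule root(2))
  define k1 where "k1 = (\<lambda>\<gamma>. if mi_take d0 \<gamma> \<in> mi d2
     then k (mi_append d2 (mi_take d0 \<gamma>) (mi_drop d0 \<gamma>)) / of_real (l (mi_take d0 \<gamma>)) else 0)"
  have w0: "w n \<ge> 0" for n by (rule weighted_bound_nonneg[where a = k and w = w, OF w(2)])
  have k1: "k1 \<in> weighted_seqs W (d0 + d1)"
  proof (rule weighted_seqsI[OF halve[OF w(1)]])
    fix \<gamma> n assume \<gamma>: "\<gamma> \<in> mi (d0 + d1)"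
    obtain \<zeta> \<eta> where g: "\<gamma> = mi_append d0 \<zeta> \<eta>" "\<zeta> \<in> mi d0" "\<eta> \<in> mi d1" using mi_eq_append[OF \<gamma>] .
    show "norm (k1 \<gamma>) * mroot (d0 + d1) \<gamma> ^ n \<le> sqrt (w (2 * n))"
    proof (cases "\<zeta> \<in> mi d2")
      case True
      let ?\<gamma> = "mi_append d2 \<zeta> \<eta>"
      have m: "mroot (d0 + d1) \<gamma> = mroot (d2 + d1) ?\<gamma>"
        unfolding mroot_def g(1) mlen_append using mlen_mi[OF d True] by simp
      have "norm (k1 \<gamma>) \<le> sqrt (norm (k ?\<gamma>))"
        using root(3)[OF g(3), of \<zeta>] True unfolding k1_def g(1) mi_take_append[OF g(2)] by simp
      then have "norm (k1 \<gamma>) * mroot (d0 + d1) \<gamma> ^ n \<le> sqrt (norm (k ?\<gamma>)) * mroot (d2 + d1) ?\<gamma> ^ n"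
        unfolding m using mroot_ge_1[of "d2 + d1" ?\<gamma>] by (intro mult_right_mono) auto
      also have "\<dots> = sqrt (norm (k ?\<gamma>) * mroot (d2 + d1) ?\<gamma> ^ (2 * n))"
        using mroot_ge_1[of "d2 + d1" ?\<gamma>] by (simp add: real_sqrt_mult mult.commute[of 2] power_mult)
      also have "\<dots> \<le> sqrt (w (2 * n))" by (intro real_sqrt_le_mono w(2) mi_append_in g)
      finally show ?thesis .
    qed (use w0 in \<open>simp add: k1_def g(1) mi_take_append[OF g(2)]\<close>)
  qed
  have "kernel_comp d2 d0 (series (d2 + d0) (diag_kernel d2 l)) (series (d0 + d1) k1) w' = series (d2 + d1) k w'" for w'
  proof -
    let ?y = "drop_pt d2 w'"
    have d02: "min d0 d2 = d2" using d by simp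
    have "kernel_comp d2 d0 (series (d2 + d0) (diag_kernel d2 l)) (series (d0 + d1) k1) w' =
       (\<Sum>\<^sub>\<infinity>\<zeta>\<in>mi d0. slice_fst d2 (diag_kernel d2 l) w' \<zeta> * slice_snd d0 d1 k1 ?y \<zeta>)"
      by (rule kernel_comp_series[OF diag[OF d02] k1])
    also have "\<dots> = (\<Sum>\<^sub>\<infinity>\<zeta>\<in>mi d2. slice_snd d2 d1 k ?y \<zeta> * of_real (hprod d2 \<zeta> w'))"
    proof (rule infsum_cong_neutral)
      show "slice_fst d2 (diag_kernel d2 l) w' \<zeta> * slice_snd d0 d1 k1 ?y \<zeta> = 0" if "\<zeta> \<in> mi d0 - mi d2" for \<zeta>
        using that by (simp add: slice_snd_def series_def k1_def mi_take_append)
      show "slice_snd d2 d1 k ?y \<zeta> * of_real (hprod d2 \<zeta> w') = 0" if "\<zeta> \<in> mi d2 - mi d0" for \<zeta>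
        using that mi_mono[OF d] by blast
      fix \<zeta> assume "\<zeta> \<in> mi d0 \<inter> mi d2"
      then have \<zeta>: "\<zeta> \<in> mi d0" "\<zeta> \<in> mi d2" by auto
      have "slice_fst d2 (diag_kernel d2 l) w' \<zeta> = (\<Sum>\<^sub>\<infinity>\<alpha>\<in>{\<zeta>}. of_real (l \<alpha>) * of_real (hprod d2 \<alpha> w'))"
        unfolding slice_fst_def series_def
        by (rule infsum_cong_neutral) (use \<zeta> in \<open>auto simp: diag_kernel_def mi_take_append\<close>)
      then have 1: "slice_fst d2 (diag_kernel d2 l) w' \<zeta> = of_real (l \<zeta>) * of_real (hprod d2 \<zeta> w')" by simp
      have "of_real (l \<zeta>) * slice_snd d0 d1 k1 ?y \<zeta> = series d1 (\<lambda>\<eta>. of_real (l \<zeta>) * k1 (mi_append d0 \<zeta> \<eta>)) ?y"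
        unfolding slice_snd_def series_cmult ..
      also have "\<dots> = slice_snd d2 d1 k ?y \<zeta>"
        unfolding slice_snd_def series_def
      proof (rule infsum_cong)
        fix \<eta> assume "\<eta> \<in> mi d1"
        from root(4)[OF this, of \<zeta>]
        show "of_real (l \<zeta>) * k1 (mi_append d0 \<zeta> \<eta>) * of_real (hprod d1 \<eta> ?y) = k (mi_append d2 \<zeta> \<eta>) * of_real (hprod d1 \<eta> ?y)"
          using \<zeta> by (simp add: k1_def mi_take_append mult.commute)
      qed
      finally have 2: "of_real (l \<zeta>) * slice_snd d0 d1 k1 ?y \<zeta> = slice_snd d2 d1 k ?y \<zeta>" .
      have "slice_fst d2 (diag_kernel d2 l) w' \<zeta> * slice_snd d0 d1 k1 ?y \<zeta> = (of_real (l \<zeta>) * slice_snd d0 d1 k1 ?y \<zeta>) * of_real (hprod d2 \<zeta> w')"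
        unfolding 1 by (simp only: ac_simps)
      then show "slice_fst d2 (diag_kernel d2 l) w' \<zeta> * slice_snd d0 d1 k1 ?y \<zeta> = slice_snd d2 d1 k ?y \<zeta> * of_real (hprod d2 \<zeta> w')"
        unfolding 2 .
    qed
    also have "\<dots> = series (d2 + d1) k w'"
      using series_slice_snd[OF rapid_hsummable[OF weighted_seqs_rapid[OF k]], of w'] by (simp add: series_def)
    finally show ?thesis .
  qed
  then show thesis using that[OF root(1) diag k1] by blast
qed

lemma weighted_seqs_hsummable: "a \<in> weighted_seqs W d \<Longrightarrow> hsummable d a"
  by (intro rapid_hsummable weighted_seqs_rapid)

theorem factorizes_within_weighted_space:
  assumes f: "f \<in> weighted_space W (d2 + d1)" and T: "has_kernel d1 d2 T (dist_of (d2 + d1) f)"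
    and d: "d0 \<ge> min d1 d2"
  shows "factorizes_within (weighted_space W) d0 d1 d2 T"
proof (cases "d1 \<le> d0")
  case True
  obtain l k2 where l: "\<And>\<eta>. l \<eta> \<ge> (0 :: real)" "\<And>n. min d1 n = d1 \<Longrightarrow> diag_kernel n l \<in> weighted_seqs W (n + d1)"
    and k2: "k2 \<in> weighted_seqs W (d2 + d0)"
    and comp: "kernel_comp d2 d0 (series (d2 + d0) k2) (series (d0 + d1) (diag_kernel d0 l)) = series (d2 + d1) (coef (d2 + d1) f)"
    using factor_diag_right[OF weighted_space_coef(2)[OF f] True] by metis
  have k1: "diag_kernel d0 l \<in> weighted_seqs W (d0 + d1)" using l(2)[of d0] True by simp
  show ?thesis unfolding factorizes_within_def
  proof (intro bexI conjI)
    show "has_kernel d1 d0 (kernel_op d1 d0 (diag_kernel d0 l)) (dist_of (d0 + d1) (series (d0 + d1) (diag_kernel d0 l)))"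
      by (intro kernel_op_has_kernel weighted_seqs_hsummable k1)
    show "has_kernel d0 d2 (kernel_op d0 d2 k2) (dist_of (d2 + d0) (series (d2 + d0) k2))"
      by (intro kernel_op_has_kernel weighted_seqs_hsummable k2)
    show "has_kernel d1 d2 T (dist_of (d2 + d1) (kernel_comp d2 d0 (series (d2 + d0) k2) (series (d0 + d1) (diag_kernel d0 l))))"
      unfolding comp weighted_space_expansion[OF f] by (rule T)
    have "pos_hermite_diag d1 d0 (kernel_op d1 d0 (diag_kernel d0 l))"
      by (rule kernel_op_diag_hermite[OF True weighted_seqs_hsummable[OF l(2)] l(1)]) simp
    then show "pos_hermite_diag d1 d0 (kernel_op d1 d0 (diag_kernel d0 l)) \<or> pos_hermite_diag d0 d2 (kernel_op d0 d2 k2) \<or>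
         d2 < d0 \<and> d0 < d1 \<and> (\<exists>S\<in>cont_ops d2 d0. is_adjoint d0 d2 (kernel_op d0 d2 k2) S \<and> pos_hermite_diag d2 d0 S)" by blast
    show "series (d0 + d1) (diag_kernel d0 l) \<in> weighted_space W (d0 + d1)" "series (d2 + d0) k2 \<in> weighted_space W (d2 + d0)"
      using k1 k2 by (auto intro: series_in_weighted_space)
    show "kernel_op d1 d0 (diag_kernel d0 l) \<in> cont_ops d1 d0" "kernel_op d0 d2 k2 \<in> cont_ops d0 d2"
      using k1 k2 by (auto intro!: kernel_op_cont weighted_seqs_hsummable)
  qed
next
  case False
  then have d20: "d2 \<le> d0" "d0 < d1" using d by auto
  obtain l k1 where l: "\<And>\<eta>. l \<eta> \<ge> (0 :: real)" "\<And>n m. min m n = d2 \<Longrightarrow> diag_kernel n l \<in> weighted_seqs W (n + m)"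
    and k1: "k1 \<in> weighted_seqs W (d0 + d1)"
    and comp: "kernel_comp d2 d0 (series (d2 + d0) (diag_kernel d2 l)) (series (d0 + d1) k1) = series (d2 + d1) (coef (d2 + d1) f)"
    using factor_diag_left[OF weighted_space_coef(2)[OF f] d20(1)] by metis
  have k2: "diag_kernel d2 l \<in> weighted_seqs W (d2 + d0)" using l(2)[of d0 d2] d20 by simp
  let ?T2 = "kernel_op d0 d2 (diag_kernel d2 l)" and ?S = "kernel_op d2 d0 (diag_kernel d0 l)"
  have S: "?S \<in> cont_ops d2 d0" using l(2)[of d2 d0] d20 by (intro kernel_op_cont weighted_seqs_hsummable) simp
  have posS: "pos_hermite_diag d2 d0 ?S"
    by (rule kernel_op_diag_hermite[OF d20(1) weighted_seqs_hsummable[OF l(2)] l(1)]) simp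
  show ?thesis unfolding factorizes_within_def
  proof (intro bexI conjI)
    show "has_kernel d1 d0 (kernel_op d1 d0 k1) (dist_of (d0 + d1) (series (d0 + d1) k1))"
      by (intro kernel_op_has_kernel weighted_seqs_hsummable k1)
    show "has_kernel d0 d2 ?T2 (dist_of (d2 + d0) (series (d2 + d0) (diag_kernel d2 l)))"
      by (intro kernel_op_has_kernel weighted_seqs_hsummable k2)
    show "has_kernel d1 d2 T (dist_of (d2 + d1) (kernel_comp d2 d0 (series (d2 + d0) (diag_kernel d2 l)) (series (d0 + d1) k1)))"
      unfolding comp weighted_space_expansion[OF f] by (rule T)
    show "pos_hermite_diag d1 d0 (kernel_op d1 d0 k1) \<or> pos_hermite_diag d0 d2 ?T2 \<or>
         d2 < d0 \<and> d0 < d1 \<and> (\<exists>S\<in>cont_ops d2 d0. is_adjoint d0 d2 ?T2 S \<and> pos_hermite_diag d2 d0 S)"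
    proof (cases "d2 = d0")
      case True
      then show ?thesis using posS by simp
    next
      case False
      then show ?thesis using d20 S posS kernel_op_diag_adjoint by auto
    qed
    show "series (d0 + d1) k1 \<in> weighted_space W (d0 + d1)" "series (d2 + d0) (diag_kernel d2 l) \<in> weighted_space W (d2 + d0)"
      using k1 k2 by (auto intro: series_in_weighted_space)
    show "kernel_op d1 d0 k1 \<in> cont_ops d1 d0" "?T2 \<in> cont_ops d0 d2"
      using k1 k2 by (auto intro!: kernel_op_cont weighted_seqs_hsummable)
  qed
qed

end

theorem theorem3p2:
  fixes d0 d1 d2 :: nat and T :: "seq_fun \<Rightarrow> functional" and K :: functional
  assumes "T \<in> cont_ops d1 d2"
    and "K \<in> gs_dual (1/2) (d2 + d1)"
    and "has_kernel d1 d2 T K"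
    and "d0 \<ge> min d1 d2"
  shows "(K \<in> dist_of (d2 + d1) ` schwartz (d2 + d1) \<longrightarrow>
            factorizes_within schwartz d0 d1 d2 T) \<and>
         (\<forall>s\<ge>1/2. K \<in> dist_of (d2 + d1) ` gs s (d2 + d1) \<longrightarrow>
            factorizes_within (gs s) d0 d1 d2 T) \<and>
         (\<forall>s>1/2. K \<in> dist_of (d2 + d1) ` gs_proj s (d2 + d1) \<longrightarrow>
            factorizes_within (gs_proj s) d0 d1 d2 T)"
proof -
  have main: "factorizes_within X d0 d1 d2 T"
    if W: "weight_class W" and X: "\<And>d. X d = weighted_space W d" and K: "K \<in> dist_of (d2 + d1) ` X (d2 + d1)" for W X
  proof -
    obtain f where "f \<in> weighted_space W (d2 + d1)" "K = dist_of (d2 + d1) f" using K X by auto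
    then have "factorizes_within (weighted_space W) d0 d1 d2 T"
      using weight_class.factorizes_within_weighted_space[OF W] assms(3,4) by blast
    moreover have "X = weighted_space W" using X by blast
    ultimately show ?thesis by simp
  qed
  show ?thesis
    using main[OF weight_class_UNIV, of schwartz] main[OF weight_class_some_growth, of _ "gs s" for s]
      main[OF weight_class_every_growth, of _ "gs_proj s" for s]
    by (auto simp: schwartz_eq gs_eq gs_proj_eq)
qed

end
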